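(* Let $W=W(n,p)$ be the number of triangles in the Erdős–Rényi random graph $G(n,p)$ (on $n$ vertices, each edge present independently with probability $p=p(n)$). Suppose $n^\alpha p\to c>0$ as $n\to\infty$ for some $1/2\le\alpha<1$. With $\mu_n=\mathbb{E}W$ and $\sigma_n^2=\mathrm{Var}(W)$, we have $\sigma_n^2\asymp n^3p^3$ and \[ d_{\mathrm{TV}}\bigl(\mathcal{L}(W),\mathrm{TP}(\mu_n,\sigma_n^2)\bigr)=O\bigl(n^{-(1-\alpha)}\bigr),\qquad d_{\mathrm{loc}}\bigl(\mathcal{L}(W),\mathrm{TP}(\mu_n,\sigma_n^2)\bigr)=O\bigl(\sigma_n^{-1}n^{-(1-\alpha)/2}\bigr). \]
   Context: For integer-supported laws with distribution functions $F,G$ (where $F(j)=\mathbb{P}[X\le j]$) and $\Delta F(j)=F(j+1)-F(j)$: $d_{\mathrm{loc}}(F,G)=\sup_{j}|\Delta F(j)-\Delta G(j)|$, $d_{\mathrm{TV}}(F,G)=\frac12\sum_j|\Delta F(j)-\Delta G(j)|$. Translated Poisson: for $\mu\in\mathbb{R}$, $s^2>0$, $Z\sim\mathrm{TP}(\mu,s^2)$ means $Z-\lfloor\mu-s^2\rfloor\sim\mathrm{Po}(s^2+\gamma)$ with $\gamma=\mu-s^2-\lfloor\mu-s^2\rfloor$. *)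

theory Defs
  imports "HOL-Probability.Probability" "HOL-Library.Landau_Symbols"
begin

definition pot_edges :: "nat \<Rightarrow> (nat \<times> nat) set" where
  "pot_edges n = {(i, j). i < j \<and> j < n}"

definition erdos_renyi :: "nat \<Rightarrow> real \<Rightarrow> (nat \<times> nat \<Rightarrow> bool) pmf" where
  "erdos_renyi n p = Pi_pmf (pot_edges n) False (\<lambda>_. bernoulli_pmf p)"

definition triangles :: "nat \<Rightarrow> (nat \<times> nat \<Rightarrow> bool) \<Rightarrow> nat" where
  "triangles n e = card {(i, j, k). i < j \<and> j < k \<and> k < n \<and> e (i, j) \<and> e (j, k) \<and> e (i, k)}"

definition tri_law :: "nat \<Rightarrow> real \<Rightarrow> int pmf" where
  "tri_law n p = map_pmf (\<lambda>e. int (triangles n e)) (erdos_renyi n p)"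

definition transl_poisson :: "real \<Rightarrow> real \<Rightarrow> int pmf" where
  "transl_poisson mu s2 =
     (let m = \<lfloor>mu - s2\<rfloor>; \<gamma> = mu - s2 - of_int m
      in map_pmf (\<lambda>k. int k + m) (poisson_pmf (s2 + \<gamma>)))"

definition d_loc :: "int pmf \<Rightarrow> int pmf \<Rightarrow> real" where
  "d_loc P Q = (SUP j. \<bar>pmf P j - pmf Q j\<bar>)"

definition d_TV :: "int pmf \<Rightarrow> int pmf \<Rightarrow> real" where
  "d_TV P Q = (1/2) * (\<Sum>\<^sub>\<infinity>j\<in>UNIV. \<bar>pmf P j - pmf Q j\<bar>)"

end

theory Submission
  imports Defs
begin

text \<open>
  Write \<open>I\<^sub>e\<close> for the indicator and \<open>C\<^sub>e\<close> for the codegree of a potential edge \<open>e\<close>, so that adding \<open>e\<close>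
  creates \<open>C\<^sub>e\<close> triangles. Replacing the edges of a triangle one at a time by their mean, averaged over all
  orders, gives the pointwise identity \<open>W - \<mu> = \<Sum>\<^sub>e (I\<^sub>e - p) H\<^sub>e\<close> with \<open>H\<^sub>e\<close> not depending on \<open>I\<^sub>e\<close>. Resampling
  \<open>e\<close> then turns \<open>E[(W - \<mu>) g(W)]\<close> into \<open>p \<Sum>\<^sub>i E[Y\<^sub>i (g(W + i + 1) - g(W + i))]\<close>, where \<open>Y\<^sub>i\<close> is the sum of
  \<open>(1 - I\<^sub>e) H\<^sub>e\<close> over the edges with \<open>C\<^sub>e > i\<close>. By the Efron--Stein inequality each \<open>Y\<^sub>i\<close> has standard
  deviation \<open>O(2\<^sup>-\<^sup>i \<sigma>/p)\<close>.

  Comparing the edges with codegree one that are present with those that are absent yields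
  \<open>\<bar>E f(W + 1) - E f(W)\<bar> = O(\<theta>/\<sigma>)\<close> whenever \<open>E f(W)\<^sup>2\<close> and \<open>E f(W + 1)\<^sup>2\<close> are at most \<open>\<theta>\<^sup>2\<close>. Consequently
  \<open>E[(W - \<mu>) g(W)] = \<sigma>\<^sup>2 E[g(W + 1) - g(W)] + O(\<theta> \<sigma>)\<close>, where \<open>\<theta>\<close> bounds the root mean square of
  \<open>g(W + i + 1) - g(W + i)\<close>.

  For the Poisson--Stein solution of an arbitrary set one has \<open>\<theta> \<le> 1/\<sigma>\<^sup>2\<close>, giving total variation distance
  \<open>O(1/\<sigma>)\<close>. For a single point, the increments of the solution moreover have total sum \<open>O(1/\<sigma>\<^sup>2)\<close>, and the
  point probabilities of \<open>W\<close> are \<open>O(1/\<sigma>)\<close>, so \<open>\<theta> = O(\<sigma>\<^sup>-\<^sup>5\<^sup>/\<^sup>2)\<close> and the local distance is \<open>O(\<sigma>\<^sup>-\<^sup>3\<^sup>/\<^sup>2)\<close>.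
  Both rates are stronger than required, because \<open>\<sigma>\<^sup>2\<close> is of order \<open>(n p)\<^sup>3\<close>.
\<close>

section \<open>Functions on the Bernoulli cube\<close>

text \<open>Kept outside the locale, with the index set as an argument, because the proof of
  \<open>Efron_Stein_bernoulli\<close> adds coordinates one at a time.\<close>

definition cube_exp :: "'a set \<Rightarrow> real \<Rightarrow> (('a \<Rightarrow> bool) \<Rightarrow> real) \<Rightarrow> real" where
  "cube_exp A p F = measure_pmf.expectation (Pi_pmf A False (\<lambda>_. bernoulli_pmf p)) F"

locale bernoulli_cube =
  fixes A :: "'a set" and p :: real
  assumes finite_index: "finite A" and prob_nonneg: "0 \<le> p" and prob_le_1: "p \<le> 1"
begin

abbreviation Ex :: "(('a \<Rightarrow> bool) \<Rightarrow> real) \<Rightarrow> real" where "Ex \<equiv> cube_exp A p"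

lemma integrable_cube [simp]:
  fixes F :: "_ \<Rightarrow> real"
  shows "integrable (measure_pmf (Pi_pmf A False (\<lambda>_. bernoulli_pmf p))) F"
  by (rule integrable_measure_pmf_finite)
     (auto simp: set_Pi_pmf finite_index intro!: finite_PiE_dflt)

lemma Ex_add: "Ex (\<lambda>x. F x + G x) = Ex F + Ex G"
  by (simp add: cube_exp_def)

lemma Ex_diff: "Ex (\<lambda>x. F x - G x) = Ex F - Ex G"
  by (simp add: cube_exp_def)

lemma Ex_minus: "Ex (\<lambda>x. - F x) = - Ex F"
  by (simp add: cube_exp_def)

lemma Ex_cmult: "Ex (\<lambda>x. c * F x) = c * Ex F"
  by (simp add: cube_exp_def)

lemma Ex_multc: "Ex (\<lambda>x. F x * c) = Ex F * c"
  by (simp add: cube_exp_def)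

lemma Ex_const [simp]: "Ex (\<lambda>x. c) = c"
  by (simp add: cube_exp_def)

lemma Ex_sum: "Ex (\<lambda>x. \<Sum>i\<in>I. F i x) = (\<Sum>i\<in>I. Ex (F i))"
  by (simp add: cube_exp_def)

lemma Ex_mono: "(\<And>x. F x \<le> G x) \<Longrightarrow> Ex F \<le> Ex G"
  unfolding cube_exp_def by (rule integral_mono) auto

lemma Ex_nonneg: "(\<And>x. 0 \<le> F x) \<Longrightarrow> 0 \<le> Ex F"
  using Ex_mono[of "\<lambda>_. 0" F] by simp

lemma Ex_abs: "\<bar>Ex F\<bar> \<le> Ex (\<lambda>x. \<bar>F x\<bar>)"
  unfolding cube_exp_def by (rule integral_abs_bound)

text \<open>The expectation of \<open>(s * F - t * G)^2\<close> is a nonnegative quadratic form in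
  \<open>s\<close> and \<open>t\<close>, which forces \<open>m^2 \<le> a * b\<close>.\<close>

lemma Ex_Cauchy_Schwarz: "\<bar>Ex (\<lambda>x. F x * G x)\<bar> \<le> sqrt (Ex (\<lambda>x. (F x)\<^sup>2)) * sqrt (Ex (\<lambda>x. (G x)\<^sup>2))"
proof -
  have nn: "0 \<le> Ex (\<lambda>x. (s * F x - t * G x)\<^sup>2)" for s t
    by (rule Ex_nonneg) simp
  define a where "a = Ex (\<lambda>x. (F x)\<^sup>2)"
  define b where "b = Ex (\<lambda>x. (G x)\<^sup>2)"
  define m where "m = Ex (\<lambda>x. F x * G x)"
  have q: "0 \<le> s\<^sup>2 * a - 2 * s * t * m + t\<^sup>2 * b" for s t
  proof -
    have "Ex (\<lambda>x. (s * F x - t * G x)\<^sup>2)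
        = Ex (\<lambda>x. s\<^sup>2 * (F x)\<^sup>2 - (2 * s * t) * (F x * G x) + t\<^sup>2 * (G x)\<^sup>2)"
      by (intro arg_cong[where f = Ex] ext) (simp add: power2_eq_square algebra_simps)
    also have "\<dots> = s\<^sup>2 * a - 2 * s * t * m + t\<^sup>2 * b"
      by (simp add: Ex_add Ex_diff Ex_cmult a_def b_def m_def)
    finally show ?thesis using nn[of s t] by simp
  qed
  have a0: "0 \<le> a" and b0: "0 \<le> b"
    unfolding a_def b_def by (auto intro: Ex_nonneg)
  have "m\<^sup>2 \<le> a * b"
  proof (cases "b = 0")
    case True
    then have *: "0 \<le> a - 2 * t * m" for t using q[of 1 t] by simp
    have "m = 0"
    proof (rule ccontr)
      assume "m \<noteq> 0"
      \<comment> \<open>With this \<open>t\<close> the expression \<open>a - 2 * t * m\<close>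
        equals -1.\<close>
      then show False using *[of "(a + 1) / (2 * m)"] by simp
    qed
    then show ?thesis using True by simp
  next
    case False
    then have "b > 0" using b0 by simp
    \<comment> \<open>The choice \<open>s = b\<close>, \<open>t = m\<close> is, up to scaling, the
      minimiser of the form.\<close>
    have "0 \<le> b * (b * a - m\<^sup>2)"
      using q[of b m] by (simp add: power2_eq_square algebra_simps)
    then show ?thesis using \<open>b > 0\<close> by (simp add: zero_le_mult_iff mult.commute)
  qed
  then have "sqrt (m\<^sup>2) \<le> sqrt (a * b)" by (rule real_sqrt_le_mono)
  then show ?thesis by (simp add: real_sqrt_mult a_def b_def m_def)
qed

end

section \<open>Conditioning on single coordinates and the Efron--Stein inequality\<close>

lemma cube_exp_empty [simp]: "cube_exp {} p F = F (\<lambda>_. False)"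
  by (simp add: cube_exp_def)

lemma cube_exp_insert:
  assumes "finite A" "e \<notin> A" "0 \<le> p" "p \<le> 1"
  shows "cube_exp (insert e A) p F
       = p * cube_exp A p (\<lambda>x. F (x(e := True))) + (1 - p) * cube_exp A p (\<lambda>x. F (x(e := False)))"
proof -
  let ?P = "Pi_pmf A False (\<lambda>_. bernoulli_pmf p)"
  interpret bernoulli_cube A p by unfold_locales (use assms in auto)
  have fin: "finite (set_pmf ?P)" using assms
    by (auto simp: set_Pi_pmf intro!: finite_PiE_dflt)
  have fin2: "finite (set_pmf (bernoulli_pmf p))" by simp
  have "cube_exp (insert e A) p F
      = measure_pmf.expectation (bernoulli_pmf p \<bind> (\<lambda>y. map_pmf (\<lambda>f. f(e := y)) ?P)) F"
    using assms by (simp add: cube_exp_def Pi_pmf_insert' map_pmf_def)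
  also have "\<dots> = measure_pmf.expectation (bernoulli_pmf p) (\<lambda>y. cube_exp A p (\<lambda>x. F (x(e := y))))"
    by (subst pmf_expectation_bind[where A = UNIV])
       (use fin in \<open>auto simp: cube_exp_def integral_measure_pmf_real[where A = UNIV] UNIV_bool mult.commute\<close>)
  also have "\<dots> = p * cube_exp A p (\<lambda>x. F (x(e := True))) + (1 - p) * cube_exp A p (\<lambda>x. F (x(e := False)))"
    using assms by (simp add: integral_measure_pmf_real[where A = UNIV] UNIV_bool mult.commute)
  finally show ?thesis .
qed

context bernoulli_cube
begin

text \<open>Conditioning on the coordinate \<open>e\<close>. The overwritten functions no longer
  depend on \<open>e\<close>, so both averages can be taken over the whole cube and no smaller index
  set appears.\<close>

lemma Ex_resample:
  assumes "e \<in> A"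
  shows "Ex F = p * Ex (\<lambda>x. F (x(e := True))) + (1 - p) * Ex (\<lambda>x. F (x(e := False)))"
proof -
  have "A = insert e (A - {e})" using assms by auto
  then obtain A' where A: "A = insert e A'" "e \<notin> A'" by blast
  have "finite A'" using finite_index A by simp
  then have ins: "cube_exp A p G = p * cube_exp A' p (\<lambda>x. G (x(e := True)))
      + (1 - p) * cube_exp A' p (\<lambda>x. G (x(e := False)))" for G
    using cube_exp_insert[OF _ A(2) prob_nonneg prob_le_1] A(1) by simp
  show ?thesis
    unfolding ins[of F] ins[of "\<lambda>x. F (x(e := True))"] ins[of "\<lambda>x. F (x(e := False))"] fun_upd_upd
    by (simp add: algebra_simps)
qed

lemma Ex_edge_mult:
  assumes "e \<in> A" and inv: "\<And>x b. F (x(e := b)) = F x"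
  shows "Ex (\<lambda>x. of_bool (x e) * F x) = p * Ex F"
  by (subst Ex_resample[OF assms(1)]) (simp add: inv)

lemma Ex_nonedge_mult:
  assumes "e \<in> A" and inv: "\<And>x b. F (x(e := b)) = F x"
  shows "Ex (\<lambda>x. (1 - of_bool (x e)) * F x) = (1 - p) * Ex F"
  by (subst Ex_resample[OF assms(1)]) (simp add: inv)

lemma Ex_edges_mult:
  assumes "finite S" "S \<subseteq> A" and inv: "\<And>x b e. e \<in> S \<Longrightarrow> F (x(e := b)) = F x"
  shows "Ex (\<lambda>x. (\<Prod>e\<in>S. of_bool (x e)) * F x) = p ^ card S * Ex F"
  using assms
proof (induction S rule: finite_induct)
  case empty
  then show ?case by simp
next
  case (insert e S)
  have "Ex (\<lambda>x. (\<Prod>e\<in>insert e S. of_bool (x e)) * F x)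
      = Ex (\<lambda>x. of_bool (x e) * ((\<Prod>e\<in>S. of_bool (x e)) * F x))"
    using insert by (simp add: mult.assoc)
  also have "\<dots> = p * Ex (\<lambda>x. (\<Prod>e\<in>S. of_bool (x e)) * F x)"
  proof (rule Ex_edge_mult)
    fix x b
    have "(\<Prod>e'\<in>S. of_bool ((x(e := b)) e')) = (\<Prod>e'\<in>S. of_bool (x e') :: real)"
      using insert by (intro prod.cong) auto
    moreover have "F (x(e := b)) = F x" using insert.prems(2)[of e] by blast
    ultimately show "(\<Prod>e'\<in>S. of_bool ((x(e := b)) e')) * F (x(e := b)) = (\<Prod>e'\<in>S. of_bool (x e')) * F x"
      by (rule arg_cong2)
  qed (use insert in auto)
  finally show ?case using insert by simp
qed

lemma Ex_edges:
  assumes "finite S" "S \<subseteq> A"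
  shows "Ex (\<lambda>x. \<Prod>e\<in>S. of_bool (x e)) = p ^ card S"
  using Ex_edges_mult[OF assms, of "\<lambda>_. 1"] by simp

end

text \<open>Induction on the coordinates with the law of total variance: given the new coordinate
  \<open>a\<close>, the two conditional variances are covered by the induction hypothesis, and the
  variance of the conditional mean is \<open>p * (1 - p) * (m1 - m0)^2\<close>. The factor
  \<open>1 - p\<close> is bounded by 1.\<close>

theorem Efron_Stein_bernoulli:
  assumes "finite A" "0 \<le> p" "p \<le> 1"
  shows "cube_exp A p (\<lambda>x. (F x - cube_exp A p F)\<^sup>2)
       \<le> p * (\<Sum>e\<in>A. cube_exp A p (\<lambda>x. (F (x(e := True)) - F (x(e := False)))\<^sup>2))"
  using assms(1)
proof (induction A arbitrary: F rule: finite_induct)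
  case empty
  then show ?case by simp
next
  case (insert a A)
  interpret bernoulli_cube A p by unfold_locales (use assms insert in auto)
  note ins = cube_exp_insert[OF insert(1,2) assms(2,3)]
  define F1 where "F1 = (\<lambda>x. F (x(a := True)))"
  define F0 where "F0 = (\<lambda>x. F (x(a := False)))"
  define m1 where "m1 = Ex F1"
  define m0 where "m0 = Ex F0"
  have m: "cube_exp (insert a A) p F = p * m1 + (1 - p) * m0"
    by (simp add: ins m1_def m0_def F1_def F0_def)
  have shift: "Ex (\<lambda>x. (H x - c)\<^sup>2) = Ex (\<lambda>x. (H x - Ex H)\<^sup>2) + (Ex H - c)\<^sup>2" for H c
  proof -
    have "Ex (\<lambda>x. (H x - c)\<^sup>2)
        = Ex (\<lambda>x. (H x - Ex H)\<^sup>2 + (2 * (Ex H - c)) * (H x - Ex H) + (Ex H - c)\<^sup>2)"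
      by (intro arg_cong[where f = Ex] ext) (simp add: power2_eq_square algebra_simps)
    also have "\<dots> = Ex (\<lambda>x. (H x - Ex H)\<^sup>2) + (Ex H - c)\<^sup>2"
      by (simp add: Ex_add Ex_cmult Ex_diff)
    finally show ?thesis .
  qed
  have lhs: "cube_exp (insert a A) p (\<lambda>x. (F x - cube_exp (insert a A) p F)\<^sup>2)
      = p * Ex (\<lambda>x. (F1 x - m1)\<^sup>2) + (1 - p) * Ex (\<lambda>x. (F0 x - m0)\<^sup>2) + p * (1 - p) * (m1 - m0)\<^sup>2"
  proof -
    have "cube_exp (insert a A) p (\<lambda>x. (F x - cube_exp (insert a A) p F)\<^sup>2)
      = p * Ex (\<lambda>x. (F1 x - (p * m1 + (1 - p) * m0))\<^sup>2)
         + (1 - p) * Ex (\<lambda>x. (F0 x - (p * m1 + (1 - p) * m0))\<^sup>2)"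
      unfolding m by (simp add: ins F1_def F0_def)
    also have "\<dots> = p * (Ex (\<lambda>x. (F1 x - m1)\<^sup>2) + (m1 - (p * m1 + (1 - p) * m0))\<^sup>2)
         + (1 - p) * (Ex (\<lambda>x. (F0 x - m0)\<^sup>2) + (m0 - (p * m1 + (1 - p) * m0))\<^sup>2)"
      by (simp only: shift[of F1 "p * m1 + (1 - p) * m0"] shift[of F0 "p * m1 + (1 - p) * m0"]
          flip: m1_def m0_def)
    also have "\<dots> = p * Ex (\<lambda>x. (F1 x - m1)\<^sup>2) + (1 - p) * Ex (\<lambda>x. (F0 x - m0)\<^sup>2)
        + p * (1 - p) * (m1 - m0)\<^sup>2"
      by algebra
    finally show ?thesis .
  qed
  \<comment> \<open>The square of a mean is at most the mean of the square, read off from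
    \<open>shift\<close> with \<open>c = 0\<close>.\<close>
  have "(m1 - m0)\<^sup>2 \<le> Ex (\<lambda>x. (F1 x - F0 x)\<^sup>2)"
    using shift[of "\<lambda>x. F1 x - F0 x" 0] Ex_nonneg[of "\<lambda>x. (F1 x - F0 x - Ex (\<lambda>x. F1 x - F0 x))\<^sup>2"]
    by (simp add: Ex_diff m1_def m0_def)
  moreover have "p * (1 - p) * (m1 - m0)\<^sup>2 \<le> p * (m1 - m0)\<^sup>2"
    using assms by (intro mult_right_mono) (auto simp: mult_left_le)
  ultimately have t: "p * (1 - p) * (m1 - m0)\<^sup>2 \<le> p * Ex (\<lambda>x. (F1 x - F0 x)\<^sup>2)"
    using assms by (meson mult_left_mono order_trans)
  have own: "cube_exp (insert a A) p (\<lambda>x. (F (x(a := True)) - F (x(a := False)))\<^sup>2)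
      = Ex (\<lambda>x. (F1 x - F0 x)\<^sup>2)"
    unfolding ins F1_def F0_def by (simp flip: distrib_right)
  have other: "cube_exp (insert a A) p (\<lambda>x. (F (x(e := True)) - F (x(e := False)))\<^sup>2)
      = p * Ex (\<lambda>x. (F1 (x(e := True)) - F1 (x(e := False)))\<^sup>2)
        + (1 - p) * Ex (\<lambda>x. (F0 (x(e := True)) - F0 (x(e := False)))\<^sup>2)" if "e \<in> A" for e
  proof -
    have "e \<noteq> a" using that insert by auto
    then show ?thesis by (simp add: ins F1_def F0_def fun_upd_twist[of e a])
  qed
  have "p * Ex (\<lambda>x. (F1 x - m1)\<^sup>2)
      \<le> p * (p * (\<Sum>e\<in>A. Ex (\<lambda>x. (F1 (x(e := True)) - F1 (x(e := False)))\<^sup>2)))"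
    unfolding m1_def by (rule mult_left_mono[OF insert.IH]) (use assms in simp)
  moreover have "(1 - p) * Ex (\<lambda>x. (F0 x - m0)\<^sup>2)
      \<le> (1 - p) * (p * (\<Sum>e\<in>A. Ex (\<lambda>x. (F0 (x(e := True)) - F0 (x(e := False)))\<^sup>2)))"
    unfolding m0_def by (rule mult_left_mono[OF insert.IH]) (use assms in simp)
  ultimately have "cube_exp (insert a A) p (\<lambda>x. (F x - cube_exp (insert a A) p F)\<^sup>2)
      \<le> p * (p * (\<Sum>e\<in>A. Ex (\<lambda>x. (F1 (x(e := True)) - F1 (x(e := False)))\<^sup>2)))
      + (1 - p) * (p * (\<Sum>e\<in>A. Ex (\<lambda>x. (F0 (x(e := True)) - F0 (x(e := False)))\<^sup>2)))
      + p * Ex (\<lambda>x. (F1 x - F0 x)\<^sup>2)"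
    unfolding lhs using t by linarith
  also have "\<dots> = p * (\<Sum>e\<in>insert a A. cube_exp (insert a A) p (\<lambda>x. (F (x(e := True)) - F (x(e := False)))\<^sup>2))"
    using insert(1,2) by (simp add: own other sum.distrib distrib_left sum_distrib_left mult.left_commute)
  finally show ?case .
qed

section \<open>Stein's equation for the Poisson distribution\<close>

text \<open>The equation \<open>l * f (k + 1) - k * f k = indicator A k - Po A\<close>, solved
  forwards. At \<open>k = 0\<close> the value \<open>f 0\<close> has coefficient zero and is free;
  the choice 0 fits the extension by zero to the negative integers.\<close>

fun stein_sol :: "real \<Rightarrow> nat set \<Rightarrow> nat \<Rightarrow> real" where
  "stein_sol l A 0 = 0"
| "stein_sol l A (Suc k) =
     (real k * stein_sol l A k + indicator A k - measure_pmf.prob (poisson_pmf l) A) / l"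

locale poisson_stein =
  fixes l :: real
  assumes rate_pos: "0 < l"
begin

abbreviation Po :: "nat set \<Rightarrow> real" where "Po A \<equiv> measure_pmf.prob (poisson_pmf l) A"
abbreviation wt :: "nat \<Rightarrow> real" where "wt k \<equiv> pmf (poisson_pmf l) k"

lemma wt_pos: "0 < wt k"
  using rate_pos by simp

lemma wt_Suc: "real (Suc k) * wt (Suc k) = l * wt k"
  using rate_pos by (simp add: field_simps del: of_nat_Suc)

declare pmf_poisson [simp del]

lemma Po_singleton: "Po {k} = wt k"
  by (simp add: measure_pmf_single)

lemma Po_atMost_Suc: "Po {..Suc k} = Po {..k} + wt (Suc k)"
proof -
  have "{..Suc k} = {..k} \<union> {Suc k}" by auto
  then show ?thesis
    by (simp only: Po_singleton[symmetric]) (subst measure_pmf.finite_measure_Union, auto)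
qed

lemma Po_atMost_0: "Po {..0} = wt 0"
  by (simp add: Po_singleton)

lemma Po_Int_atMost_Suc: "Po (A \<inter> {..Suc k}) = Po (A \<inter> {..k}) + indicator A (Suc k) * wt (Suc k)"
proof (cases "Suc k \<in> A")
  case True
  then have "A \<inter> {..Suc k} = (A \<inter> {..k}) \<union> {Suc k}" by (auto simp: le_Suc_eq)
  then show ?thesis using True
    by (simp only: Po_singleton[symmetric]) (subst measure_pmf.finite_measure_Union, auto)
next
  case False
  then have "A \<inter> {..Suc k} = A \<inter> {..k}" by (auto simp: le_Suc_eq)
  then show ?thesis using False by simp
qed

lemma Po_atMost_tendsto: "(\<lambda>k. Po {..k}) \<longlonglongrightarrow> 1"
proof -
  have "(\<lambda>k. Po {..k}) \<longlonglongrightarrow> Po (\<Union>k. {..k})"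
    by (rule measure_pmf.finite_Lim_measure_incseq) (auto simp: incseq_def)
  moreover have "(\<Union>k. {..k::nat}) = UNIV" by auto
  ultimately show ?thesis by simp
qed

text \<open>Multiplied by the weights, the recursion telescopes because of \<open>wt_Suc\<close>.
  This is the classical closed form of the Poisson--Stein solution.\<close>

lemma stein_sol_closed:
  "l * wt k * stein_sol l A (Suc k) = Po (A \<inter> {..k}) - Po A * Po {..k}"
proof (induction k)
  case 0
  have "Po (A \<inter> {..0}) = indicator A 0 * wt 0"
    by (cases "0 \<in> A") (auto simp: Po_singleton)
  then have "l * wt 0 * stein_sol l A (Suc 0) = Po (A \<inter> {..0}) - Po A * wt 0"
    using rate_pos by (simp add: field_simps)
  then show ?case by (simp only: Po_atMost_0)
next
  case (Suc k)
  have step: "l * stein_sol l A (Suc (Suc k)) = real (Suc k) * stein_sol l A (Suc k) + indicator A (Suc k) - Po A"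
    using rate_pos by (simp only: stein_sol.simps(2)[of l A "Suc k"]) simp
  have "l * wt (Suc k) * stein_sol l A (Suc (Suc k))
     = wt (Suc k) * (l * stein_sol l A (Suc (Suc k)))"
    by (simp only: ac_simps)
  also have "\<dots> = (real (Suc k) * wt (Suc k)) * stein_sol l A (Suc k) + indicator A (Suc k) * wt (Suc k) - Po A * wt (Suc k)"
    unfolding step by (simp only: algebra_simps)
  also have "\<dots> = l * wt k * stein_sol l A (Suc k) + indicator A (Suc k) * wt (Suc k) - Po A * wt (Suc k)"
    by (simp only: wt_Suc)
  also have "\<dots> = Po (A \<inter> {..k}) - Po A * Po {..k} + indicator A (Suc k) * wt (Suc k) - Po A * wt (Suc k)"
    by (simp only: Suc.IH)
  also have "\<dots> = Po (A \<inter> {..Suc k}) - Po A * Po {..Suc k}"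
    by (simp add: Po_Int_atMost_Suc Po_atMost_Suc algebra_simps)
  finally show ?case .
qed

text \<open>For \<open>k \<le> n\<close> one has
  \<open>l * wt k = (k + 1) * wt (k + 1) \<le> (n + 1) * wt (k + 1)\<close>. Summed over
  \<open>k\<close>, the right side omits \<open>wt 0\<close>, the deficit carried by the inner
  inequality.\<close>

lemma head_ratio: "l * Po {..n} \<le> real (Suc n) * Po {..Suc n}"
proof -
  have "l * Po {..n} \<le> real (Suc n) * (Po {..Suc n} - wt 0)"
  proof (induction n)
    case 0
    have "Po {..Suc 0} = wt 0 + wt (Suc 0)" by (simp only: Po_atMost_Suc Po_atMost_0)
    then show ?case using wt_Suc[of 0] by (simp add: Po_singleton)
  next
    case (Suc n)
    have "l * Po {..Suc n} = l * Po {..n} + real (Suc (Suc n)) * wt (Suc (Suc n))"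
      by (simp only: Po_atMost_Suc wt_Suc distrib_left)
    also have "\<dots> \<le> real (Suc n) * (Po {..Suc n} - wt 0) + real (Suc (Suc n)) * wt (Suc (Suc n))"
      using Suc by simp
    also have "\<dots> \<le> real (Suc (Suc n)) * (Po {..Suc n} - wt 0) + real (Suc (Suc n)) * wt (Suc (Suc n))"
    proof -
      have "wt 0 \<le> Po {..Suc n}"
        using measure_pmf.finite_measure_mono[of "{0}" "{..Suc n}" "poisson_pmf l"] by (simp add: Po_singleton)
      then show ?thesis by (simp add: mult_right_mono)
    qed
    also have "\<dots> = real (Suc (Suc n)) * (Po {..Suc (Suc n)} - wt 0)"
      unfolding Po_atMost_Suc[of "Suc n"] by (simp add: algebra_simps)
    finally show ?case .
  qed
  also have "\<dots> \<le> real (Suc n) * Po {..Suc n}"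
    using wt_pos[of 0] by (intro mult_left_mono) auto
  finally show ?thesis .
qed

text \<open>The opposite comparison beyond \<open>n\<close>, where \<open>k + 1 \<ge> n + 1\<close>.
  It is proved for the finite blocks \<open>n < k \<le> n + j\<close> and passed to the limit in
  \<open>j\<close>.\<close>

lemma tail_ratio: "real (Suc n) * (1 - Po {..Suc n}) \<le> l * (1 - Po {..n})"
proof -
  have *: "real (Suc n) * (Po {..Suc (n + j)} - Po {..Suc n}) \<le> l * (Po {..n + j} - Po {..n})" for j
  proof (induction j)
    case 0
    then show ?case by simp
  next
    case (Suc j)
    have "real (Suc n) * wt (Suc (Suc (n + j))) \<le> real (Suc (Suc (n + j))) * wt (Suc (Suc (n + j)))"
      by (intro mult_right_mono) (use wt_pos less_imp_le in auto)
    also have "\<dots> = l * wt (Suc (n + j))" by (rule wt_Suc)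
    finally show ?case using Suc
      by (simp add: Po_atMost_Suc algebra_simps)
  qed
  have l1: "(\<lambda>j. real (Suc n) * (Po {..Suc (n + j)} - Po {..Suc n})) \<longlonglongrightarrow> real (Suc n) * (1 - Po {..Suc n})"
    using LIMSEQ_ignore_initial_segment[OF Po_atMost_tendsto, of "Suc n"]
    by (intro tendsto_intros) (simp add: add.commute)
  have l2: "(\<lambda>j. l * (Po {..n + j} - Po {..n})) \<longlonglongrightarrow> l * (1 - Po {..n})"
    using LIMSEQ_ignore_initial_segment[OF Po_atMost_tendsto, of n]
    by (intro tendsto_intros) (simp add: add.commute)
  show ?thesis by (rule LIMSEQ_le[OF l1 l2]) (use * in blast)
qed

section \<open>Increments of the Stein solution\<close>

lemma Po_split3: "Po A = Po (A \<inter> {..n}) + indicator A (Suc n) * wt (Suc n) + Po (A \<inter> {Suc n<..})"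
proof -
  have "A = (A \<inter> {..Suc n}) \<union> (A \<inter> {Suc n<..})" by auto
  then have "Po A = Po (A \<inter> {..Suc n}) + Po (A \<inter> {Suc n<..})"
    using measure_pmf.finite_measure_Union[of "A \<inter> {..Suc n}" "poisson_pmf l" "A \<inter> {Suc n<..}"] by fastforce
  then show ?thesis by (simp add: Po_Int_atMost_Suc)
qed

text \<open>Separates the parts of \<open>A\<close> below, at and above \<open>Suc n\<close>. By
  \<open>ratio_facts\<close> the two outer terms are nonpositive, so only the point
  \<open>Suc n\<close> can make the increment positive.\<close>

lemma stein_sol_diff:
  defines "r \<equiv> \<lambda>n. l / real (Suc n)"
  shows "l * wt (Suc n) * (stein_sol l A (Suc (Suc n)) - stein_sol l A (Suc n))
    = Po (A \<inter> {..n}) * ((1 - Po {..Suc n}) - r n * (1 - Po {..n}))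
      + indicator A (Suc n) * wt (Suc n) * (1 - Po {..Suc n} + r n * Po {..n})
      + Po (A \<inter> {Suc n<..}) * (r n * Po {..n} - Po {..Suc n})"
proof -
  have 1: "l * wt (Suc n) * stein_sol l A (Suc (Suc n)) = Po (A \<inter> {..Suc n}) - Po A * Po {..Suc n}"
    by (rule stein_sol_closed)
  have "l * wt (Suc n) = r n * (l * wt n)"
    using wt_Suc[of n] rate_pos unfolding r_def by (simp add: field_simps del: of_nat_Suc)
  then have 2: "l * wt (Suc n) * stein_sol l A (Suc n) = r n * (Po (A \<inter> {..n}) - Po A * Po {..n})"
    using stein_sol_closed[of n A] by (simp only: mult.assoc)
  have 3: "Po (A \<inter> {..Suc n}) = Po (A \<inter> {..n}) + indicator A (Suc n) * wt (Suc n)"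
    by (rule Po_Int_atMost_Suc)
  show ?thesis
    unfolding right_diff_distrib[of "l * wt (Suc n)"] 1 2 3 Po_split3[of A n] by algebra
qed

lemma ratio_facts:
  defines "r \<equiv> \<lambda>n. l / real (Suc n)"
  shows "(1 - Po {..Suc n}) - r n * (1 - Po {..n}) \<le> 0"
    and "r n * Po {..n} - Po {..Suc n} \<le> 0"
  using head_ratio[of n] tail_ratio[of n]
  by (auto simp: r_def field_simps simp del: of_nat_Suc)

text \<open>The one positive term of \<open>stein_sol_diff\<close> is at most
  \<open>wt (Suc k)\<close>, since its bracket is at most 1 by the head comparison.\<close>

lemma stein_sol_diff_le: "stein_sol l A (Suc n) - stein_sol l A n \<le> 1 / l"
proof (cases n)
  case 0
  have "indicator A 0 \<le> (1 :: real)" "0 \<le> Po A" by (auto simp: indicator_def)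
  then have "indicator A 0 - Po A \<le> 1" by linarith
  then show ?thesis using 0 rate_pos by (simp add: divide_right_mono)
next
  case (Suc k)
  define r where "r = l / real (Suc k)"
  have t1: "Po (A \<inter> {..k}) * ((1 - Po {..Suc k}) - r * (1 - Po {..k})) \<le> 0"
    using ratio_facts(1)[of k] by (intro mult_nonneg_nonpos) (auto simp: r_def)
  have t3: "Po (A \<inter> {Suc k<..}) * (r * Po {..k} - Po {..Suc k}) \<le> 0"
    using ratio_facts(2)[of k] by (intro mult_nonneg_nonpos) (auto simp: r_def)
  have q: "0 \<le> 1 - Po {..Suc k} + r * Po {..k}" "1 - Po {..Suc k} + r * Po {..k} \<le> 1"
    using ratio_facts(2)[of k] rate_pos by (auto simp: r_def intro!: add_nonneg_nonneg)
  have "indicator A (Suc k) * wt (Suc k) * (1 - Po {..Suc k} + r * Po {..k}) \<le> wt (Suc k) * 1"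
    using q wt_pos[of "Suc k"] by (intro mult_mono) (auto simp: indicator_def)
  then have "l * wt (Suc k) * (stein_sol l A (Suc (Suc k)) - stein_sol l A (Suc k)) \<le> wt (Suc k)"
    unfolding stein_sol_diff using t1 t3 unfolding r_def by linarith
  then have "wt (Suc k) * (l * (stein_sol l A (Suc (Suc k)) - stein_sol l A (Suc k))) \<le> wt (Suc k) * 1"
    by (simp add: ac_simps del: stein_sol.simps)
  then have "l * (stein_sol l A (Suc (Suc k)) - stein_sol l A (Suc k)) \<le> 1"
    using wt_pos[of "Suc k"] by (subst (asm) mult_le_cancel_left_pos) auto
  then show ?thesis using Suc rate_pos by (simp add: pos_le_divide_eq mult.commute del: stein_sol.simps)
qed

text \<open>Used to turn the upper bound on increments, valid for every set, into a two-sided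
  one.\<close>

lemma stein_sol_compl: "stein_sol l (- A) n = - stein_sol l A n"
proof (induction n)
  case (Suc n)
  have "Po (- A) = 1 - Po A"
    using measure_pmf.prob_compl[of A "poisson_pmf l"] by (simp add: Compl_eq_Diff_UNIV)
  moreover have "indicator (- A) n = 1 - (indicator A n :: real)" by (simp add: indicator_def)
  ultimately have "real n * stein_sol l (- A) n + indicator (- A) n - Po (- A)
      = - (real n * stein_sol l A n + indicator A n - Po A)"
    using Suc by simp
  then show ?case by (simp only: stein_sol.simps minus_divide_left)
qed simp

lemma abs_stein_sol_diff_le: "\<bar>stein_sol l A (Suc n) - stein_sol l A n\<bar> \<le> 1 / l"
  using stein_sol_diff_le[of A n] stein_sol_diff_le[of "- A" n] unfolding stein_sol_compl by linarith

text \<open>For a singleton the positive term of \<open>stein_sol_diff\<close> is absent away from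
  \<open>j\<close>: the solution can rise only from \<open>j\<close> to
  \<open>j + 1\<close>.\<close>

lemma stein_sol_point_decreasing:
  assumes "n \<noteq> j"
  shows "stein_sol l {j} (Suc n) \<le> stein_sol l {j} n"
proof (cases n)
  case 0
  then show ?thesis using assms rate_pos by (simp add: divide_nonpos_pos)
next
  case (Suc k)
  define r where "r = l / real (Suc k)"
  have t1: "Po ({j} \<inter> {..k}) * ((1 - Po {..Suc k}) - r * (1 - Po {..k})) \<le> 0"
    using ratio_facts(1)[of k] by (intro mult_nonneg_nonpos) (auto simp: r_def)
  have t3: "Po ({j} \<inter> {Suc k<..}) * (r * Po {..k} - Po {..Suc k}) \<le> 0"
    using ratio_facts(2)[of k] by (intro mult_nonneg_nonpos) (auto simp: r_def)
  have "l * wt (Suc k) * (stein_sol l {j} (Suc (Suc k)) - stein_sol l {j} (Suc k)) \<le> 0"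
    unfolding stein_sol_diff using t1 t3 assms Suc unfolding r_def by simp
  then show ?thesis using wt_pos[of "Suc k"] rate_pos Suc
    by (simp add: mult_le_0_iff del: stein_sol.simps)
qed

lemma stein_sol_point_nonneg:
  assumes "j \<le> k"
  shows "0 \<le> stein_sol l {j} (Suc k)"
proof -
  have "Po ({j} \<inter> {..k}) = Po {j}" using assms by (intro arg_cong[where f = Po]) auto
  then have "l * wt k * stein_sol l {j} (Suc k) = Po {j} * (1 - Po {..k})"
    unfolding stein_sol_closed by (simp add: algebra_simps)
  then have "0 \<le> l * wt k * stein_sol l {j} (Suc k)" by simp
  moreover have "0 < l * wt k" using wt_pos[of k] rate_pos by simp
  ultimately show ?thesis by (simp add: zero_le_mult_iff del: stein_sol.simps)
qed

text \<open>The solution starts at 0, falls except for one upward jump of at most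
  \<open>1 / l\<close>, and is nonnegative after \<open>j\<close>; its total variation is at most
  twice that jump.\<close>

lemma stein_sol_point_variation:
  assumes "finite S"
  shows "(\<Sum>k\<in>S. \<bar>stein_sol l {j} (Suc k) - stein_sol l {j} k\<bar>) \<le> 2 / l"
proof -
  define d where "d = (\<lambda>k. stein_sol l {j} (Suc k) - stein_sol l {j} k)"
  \<comment> \<open>The range reaches past \<open>j\<close>, so that the telescoped end value is
    nonnegative by \<open>stein_sol_point_nonneg\<close>.\<close>
  define N where "N = Suc (Max (insert j S))"
  have S: "S \<subseteq> {..<N}" and j: "j < N" using assms
    by (auto simp: N_def less_Suc_eq_le)
  have "(\<Sum>k\<in>S. \<bar>d k\<bar>) \<le> (\<Sum>k<N. \<bar>d k\<bar>)"
    using S by (intro sum_mono2) auto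
  \<comment> \<open>Away from \<open>j\<close> the modulus is \<open>- d k\<close>; at
    \<open>j\<close> both \<open>d j\<close> and its modulus are at most \<open>1 / l\<close>,
    whence \<open>2 / l\<close>.\<close>
  also have "\<dots> \<le> (\<Sum>k<N. (if k = j then 2 / l else 0) - d k)"
    using stein_sol_point_decreasing[of _ j] abs_stein_sol_diff_le[of "{j}" j] rate_pos
    by (intro sum_mono) (auto simp: d_def abs_if simp del: stein_sol.simps)
  also have "\<dots> = 2 / l - (\<Sum>k<N. d k)"
    using j by (simp add: sum_subtractf)
  also have "(\<Sum>k<N. d k) = stein_sol l {j} N"
    unfolding d_def by (subst sum_lessThan_telescope) simp
  also have "2 / l - stein_sol l {j} N \<le> 2 / l"
    using stein_sol_point_nonneg[of j "N - 1"] j by (simp add: N_def del: stein_sol.simps)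
  finally show ?thesis by (simp only: d_def)
qed

text \<open>The argument will be \<open>W\<close> minus the translation, which may be negative;
  \<open>nat\<close> sends negative integers to 0, where the solution vanishes.\<close>

definition stein_int :: "nat set \<Rightarrow> int \<Rightarrow> real" where
  "stein_int A z = stein_sol l A (nat z)"

lemma stein_int_eq:
  "0 \<le> z \<Longrightarrow> l * stein_int A (z + 1) - of_int z * stein_int A z = indicator A (nat z) - Po A"
  using rate_pos by (simp add: stein_int_def Suc_nat_eq_nat_zadd1[symmetric] add.commute)

lemma stein_int_nonpos: "z \<le> 0 \<Longrightarrow> stein_int A z = 0"
  by (simp add: stein_int_def)

lemma stein_int_diff_neg: "z < 0 \<Longrightarrow> stein_int A (z + 1) - stein_int A z = 0"
  by (simp add: stein_int_nonpos)

lemma stein_int_diff_nat: "stein_int A (int k + 1) - stein_int A (int k) = stein_sol l A (Suc k) - stein_sol l A k"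
  by (simp add: stein_int_def nat_add_distrib del: stein_sol.simps)

lemma abs_stein_int_diff_le: "\<bar>stein_int A (z + 1) - stein_int A z\<bar> \<le> 1 / l"
proof (cases "z < 0")
  case True
  then show ?thesis using rate_pos by (simp add: stein_int_diff_neg)
next
  case False
  then obtain k where "z = int k" by (metis nonneg_int_cases not_less)
  then show ?thesis using abs_stein_sol_diff_le by (simp add: stein_int_diff_nat del: stein_sol.simps)
qed

lemma stein_int_point_variation:
  assumes "finite S"
  shows "(\<Sum>z\<in>S. \<bar>stein_int {j} (z + 1) - stein_int {j} z\<bar>) \<le> 2 / l"
proof -
  have "(\<Sum>z\<in>S. \<bar>stein_int {j} (z + 1) - stein_int {j} z\<bar>)
      = (\<Sum>z\<in>{z \<in> S. 0 \<le> z}. \<bar>stein_int {j} (z + 1) - stein_int {j} z\<bar>)"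
  proof (intro sum.mono_neutral_right ballI)
    fix z assume "z \<in> S - {z \<in> S. 0 \<le> z}"
    then show "\<bar>stein_int {j} (z + 1) - stein_int {j} z\<bar> = 0" by (auto simp: stein_int_nonpos)
  qed (use assms in auto)
  also have "\<dots> = (\<Sum>k\<in>nat ` {z \<in> S. 0 \<le> z}. \<bar>stein_int {j} (int k + 1) - stein_int {j} (int k)\<bar>)"
    by (subst sum.reindex) (auto simp: inj_on_def)
  also have "\<dots> \<le> 2 / l"
    unfolding stein_int_diff_nat using assms by (intro stein_sol_point_variation) simp
  finally show ?thesis .
qed

end

section \<open>Triangles and codegrees\<close>

text \<open>Chooses the representative of an unordered pair that lies in \<open>pot_edges\<close>,
  so that the two endpoints can be treated symmetrically.\<close>

definition edge :: "nat \<Rightarrow> nat \<Rightarrow> nat \<times> nat" where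
  "edge u v = (min u v, max u v)"

definition adj :: "(nat \<times> nat \<Rightarrow> bool) \<Rightarrow> nat \<Rightarrow> nat \<Rightarrow> real" where
  "adj x u v = of_bool (x (edge u v))"

lemma edge_commute: "edge u v = edge v u"
  by (simp add: edge_def min.commute max.commute)

lemma adj_commute: "adj x u v = adj x v u"
  by (simp add: adj_def edge_commute)

lemma edge_less [simp]: "u < v \<Longrightarrow> edge u v = (u, v)"
  by (simp add: edge_def)

lemma edge_eq_iff: "edge u v = edge a b \<longleftrightarrow> u = a \<and> v = b \<or> u = b \<and> v = a"
  by (auto simp: edge_def min_def max_def split: if_splits)

lemma edge_in_pot_edges: "u < n \<Longrightarrow> v < n \<Longrightarrow> u \<noteq> v \<Longrightarrow> edge u v \<in> pot_edges n"
  by (auto simp: edge_def pot_edges_def)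

lemma adj_upd: "adj (x(edge a b := t)) u v = (if edge u v = edge a b then of_bool t else adj x u v)"
  by (simp add: adj_def)

lemma adj_nonneg [simp]: "0 \<le> adj x u v" and adj_le_1 [simp]: "adj x u v \<le> 1"
  by (auto simp: adj_def)

text \<open>The third vertices range over an explicit set \<open>S\<close>: leaving out a vertex
  gives codegrees that do not depend on the edges at it.\<close>

definition codeg :: "nat set \<Rightarrow> (nat \<times> nat \<Rightarrow> bool) \<Rightarrow> nat \<Rightarrow> nat \<Rightarrow> nat" where
  "codeg S x u v = card {k \<in> S. x (edge u k) \<and> x (edge v k)}"

lemma real_codeg: "finite S \<Longrightarrow> real (codeg S x u v) = (\<Sum>k\<in>S. adj x u k * adj x v k)"
  by (simp add: codeg_def adj_def Int_def conj_commute flip: of_bool_conj)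

lemma codeg_commute: "codeg S x u v = codeg S x v u"
  by (simp add: codeg_def conj_commute)

lemma codeg_le_card: "finite S \<Longrightarrow> codeg S x u v \<le> card S"
  unfolding codeg_def by (intro card_mono) auto

lemma codeg_upd:
  assumes "\<And>k. k \<in> S \<Longrightarrow> edge u k \<noteq> e \<and> edge v k \<noteq> e"
  shows "codeg S (x(e := t)) u v = codeg S x u v"
  unfolding codeg_def by (intro arg_cong[where f = card] Collect_cong) (use assms in auto)

text \<open>The \<open>H\<close> of the outline. Among the six orders of replacing the edges of a
  triangle by \<open>p\<close>, the edge \<open>uv\<close> comes first, second or last in two each;
  the other two factors are then both intact, half replaced or both replaced, which gives the
  weights 1/3, 1/6 + 1/6 and 1/3.\<close>

definition chaos :: "real \<Rightarrow> nat set \<Rightarrow> (nat \<times> nat \<Rightarrow> bool) \<Rightarrow> nat \<Rightarrow> nat \<Rightarrow> real" where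
  "chaos p S x u v = (\<Sum>k\<in>S. adj x u k * adj x v k / 3 + p * (adj x u k + adj x v k) / 6 + p\<^sup>2 / 3)"

lemma chaos_upd:
  assumes "\<And>k. k \<in> S \<Longrightarrow> edge u k \<noteq> e \<and> edge v k \<noteq> e"
  shows "chaos p S (x(e := t)) u v = chaos p S x u v"
  unfolding chaos_def by (intro sum.cong) (use assms in \<open>auto simp: adj_def\<close>)

lemma chaos_commute: "chaos p S x u v = chaos p S x v u"
  unfolding chaos_def by (intro sum.cong) (auto simp: algebra_simps)

section \<open>Regrouping triangles by their edges\<close>

definition tri_set :: "nat \<Rightarrow> (nat \<times> nat \<times> nat) set" where
  "tri_set n = {(i, j, k). i < j \<and> j < k \<and> k < n}"

lemma finite_pot_edges [simp]: "finite (pot_edges n)"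
  by (rule finite_subset[of _ "{..<n} \<times> {..<n}"]) (auto simp: pot_edges_def)

lemma finite_tri_set [simp]: "finite (tri_set n)"
  by (rule finite_subset[of _ "{..<n} \<times> {..<n} \<times> {..<n}"]) (auto simp: tri_set_def)

text \<open>A triangle \<open>i < j < k\<close> arises from three pairs of an edge and an opposite
  vertex; \<open>P1\<close>, \<open>P2\<close> and \<open>P3\<close> sort the pairs by whether the
  vertex lies below, between or above the endpoints.\<close>

lemma sum_edge_vertex:
  fixes s :: "nat \<Rightarrow> nat \<Rightarrow> nat \<Rightarrow> real"
  shows "(\<Sum>(u, v)\<in>pot_edges n. \<Sum>w\<in>{..<n} - {u, v}. s u v w)
       = (\<Sum>(i, j, k)\<in>tri_set n. s i j k + s j k i + s i k j)"
proof -
  define P where "P = (SIGMA e:pot_edges n. {..<n} - {fst e, snd e})"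
  define f where "f = (\<lambda>(e, w). s (fst e) (snd e) w)"
  define P1 where "P1 = {(e, w) \<in> P. w < fst e}"
  define P2 where "P2 = {(e, w) \<in> P. fst e < w \<and> w < snd e}"
  define P3 where "P3 = {(e, w) \<in> P. snd e < w}"
  have fin: "finite P" unfolding P_def by auto
  have P: "P = P1 \<union> (P2 \<union> P3)"
    by (auto simp: P_def P1_def P2_def P3_def pot_edges_def)
  have d: "P1 \<inter> (P2 \<union> P3) = {}" "P2 \<inter> P3 = {}"
    by (auto simp: P_def P1_def P2_def P3_def pot_edges_def)
  have fs: "finite P1" "finite P2" "finite P3"
    using fin P by (auto intro: finite_subset)
  have "(\<Sum>(u, v)\<in>pot_edges n. \<Sum>w\<in>{..<n} - {u, v}. s u v w) = sum f P"
    unfolding P_def f_def by (subst sum.Sigma[symmetric]) (auto simp: case_prod_beta)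
  also have "\<dots> = sum f P1 + (sum f P2 + sum f P3)"
    unfolding P using fs d by (simp add: sum.union_disjoint)
  also have "sum f P1 = (\<Sum>(i, j, k)\<in>tri_set n. s j k i)"
    by (rule sum.reindex_bij_witness[where i = "\<lambda>(i, j, k). ((j, k), i)" and j = "\<lambda>((u, v), w). (w, u, v)"])
       (auto simp: P1_def P_def pot_edges_def tri_set_def f_def)
  also have "sum f P2 = (\<Sum>(i, j, k)\<in>tri_set n. s i k j)"
    by (rule sum.reindex_bij_witness[where i = "\<lambda>(i, j, k). ((i, k), j)" and j = "\<lambda>((u, v), w). (u, w, v)"])
       (auto simp: P2_def P_def pot_edges_def tri_set_def f_def)
  also have "sum f P3 = (\<Sum>(i, j, k)\<in>tri_set n. s i j k)"
    by (rule sum.reindex_bij_witness[where i = "\<lambda>(i, j, k). ((i, j), k)" and j = "\<lambda>((u, v), w). (u, v, w)"])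
       (auto simp: P3_def P_def pot_edges_def tri_set_def f_def)
  finally show ?thesis by (simp add: case_prod_beta sum.distrib)
qed

lemma real_triangles:
  "real (triangles n x) = (\<Sum>(i, j, k)\<in>tri_set n. adj x i j * adj x j k * adj x i k)"
proof -
  have "{(i, j, k). i < j \<and> j < k \<and> k < n \<and> x (i, j) \<and> x (j, k) \<and> x (i, k)}
      = {t \<in> tri_set n. case t of (i, j, k) \<Rightarrow> x (i, j) \<and> x (j, k) \<and> x (i, k)}"
    by (auto simp: tri_set_def)
  then have "real (triangles n x) = (\<Sum>t\<in>tri_set n. of_bool (case t of (i, j, k) \<Rightarrow> x (i, j) \<and> x (j, k) \<and> x (i, k)))"
    by (simp add: triangles_def Int_def)
  also have "\<dots> = (\<Sum>(i, j, k)\<in>tri_set n. adj x i j * adj x j k * adj x i k)"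
    by (intro sum.cong) (auto simp: tri_set_def adj_def)
  finally show ?thesis .
qed

lemma triangles_upd:
  assumes "a < b" "b < n"
  shows "triangles n (x((a, b) := True)) = triangles n (x((a, b) := False)) + codeg ({..<n} - {a, b}) x a b"
proof -
  define x1 where "x1 = x((a, b) := True)"
  define x0 where "x0 = x((a, b) := False)"
  \<comment> \<open>Selecting the single edge \<open>(a, b)\<close> in
    \<open>sum_edge_vertex\<close> leaves exactly the triangles through it.\<close>
  define s where "s = (\<lambda>u v w. if (u, v) = (a, b) then adj x u w * adj x v w else 0)"
  have ab: "(a, b) \<in> pot_edges n" using assms by (simp add: pot_edges_def)
  have "real (triangles n x1) - real (triangles n x0)
      = (\<Sum>(i, j, k)\<in>tri_set n. adj x1 i j * adj x1 j k * adj x1 i k - adj x0 i j * adj x0 j k * adj x0 i k)"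
    unfolding real_triangles by (simp add: sum_subtractf case_prod_beta)
  also have "\<dots> = (\<Sum>(i, j, k)\<in>tri_set n. s i j k + s j k i + s i k j)"
    by (intro sum.cong)
       (auto simp: tri_set_def s_def x1_def x0_def adj_def edge_commute[of b a] edge_commute[of _ a] edge_def min_def max_def split: if_splits)
  also have "\<dots> = (\<Sum>(u, v)\<in>pot_edges n. \<Sum>w\<in>{..<n} - {u, v}. s u v w)"
    by (rule sum_edge_vertex[symmetric])
  also have "\<dots> = (\<Sum>e\<in>pot_edges n. if e = (a, b) then \<Sum>w\<in>{..<n} - {a, b}. adj x a w * adj x b w else 0)"
  proof (intro sum.cong refl)
    fix e assume "e \<in> pot_edges n"
    show "(case e of (u, v) \<Rightarrow> \<Sum>w\<in>{..<n} - {u, v}. s u v w)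
      = (if e = (a, b) then \<Sum>w\<in>{..<n} - {a, b}. adj x a w * adj x b w else 0)"
      by (cases e; cases "e = (a, b)") (auto simp: s_def intro!: sum.neutral)
  qed
  also have "\<dots> = real (codeg ({..<n} - {a, b}) x a b)"
    using ab by (simp add: real_codeg)
  finally show ?thesis unfolding x1_def x0_def by linarith
qed

text \<open>Adding \<open>s\<close> over the three edges of one triangle, all mixed terms cancel and
  the product of the indicators minus \<open>p ^ 3\<close> remains; \<open>sum_edge_vertex\<close>
  then collects by edges.\<close>

lemma triangles_decomposition:
  "real (triangles n x) - real (card (tri_set n)) * p ^ 3
     = (\<Sum>(u, v)\<in>pot_edges n. (adj x u v - p) * chaos p ({..<n} - {u, v}) x u v)"
proof -
  define s where "s = (\<lambda>u v w. (adj x u v - p) * (adj x u w * adj x v w / 3 + p * (adj x u w + adj x v w) / 6 + p\<^sup>2 / 3))"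
  have "real (triangles n x) - real (card (tri_set n)) * p ^ 3
     = (\<Sum>(i, j, k)\<in>tri_set n. adj x i j * adj x j k * adj x i k - p ^ 3)"
    unfolding real_triangles by (simp add: sum_subtractf case_prod_beta)
  also have "\<dots> = (\<Sum>(i, j, k)\<in>tri_set n. s i j k + s j k i + s i k j)"
  proof (intro sum.cong refl, clarify)
    fix i j k
    have "adj x j i = adj x i j" "adj x k i = adj x i k" "adj x k j = adj x j k" 
      by (auto simp: adj_commute)
    then show "adj x i j * adj x j k * adj x i k - p ^ 3 = s i j k + s j k i + s i k j"
      unfolding s_def by (simp add: field_simps power2_eq_square power3_eq_cube)
  qed
  also have "\<dots> = (\<Sum>(u, v)\<in>pot_edges n. \<Sum>w\<in>{..<n} - {u, v}. s u v w)"
    by (rule sum_edge_vertex[symmetric])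
  finally show ?thesis by (simp add: s_def chaos_def sum_distrib_left)
qed

definition edge_codeg :: "nat \<Rightarrow> (nat \<times> nat \<Rightarrow> bool) \<Rightarrow> nat \<times> nat \<Rightarrow> nat" where
  "edge_codeg n x e = codeg ({..<n} - {fst e, snd e}) x (fst e) (snd e)"

definition edge_chaos :: "nat \<Rightarrow> real \<Rightarrow> (nat \<times> nat \<Rightarrow> bool) \<Rightarrow> nat \<times> nat \<Rightarrow> real" where
  "edge_chaos n p x e = chaos p ({..<n} - {fst e, snd e}) x (fst e) (snd e)"

definition absent :: "(nat \<times> nat \<Rightarrow> bool) \<Rightarrow> nat \<times> nat \<Rightarrow> real" where
  "absent x e = 1 - of_bool (x e)"

text \<open>The sum \<open>Y_i\<close> of the outline. A jump by the codegree is cut into unit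
  steps, and the step from \<open>i\<close> to \<open>i + 1\<close> occurs for the edges of codegree
  above \<open>i\<close>.\<close>

definition level :: "nat \<Rightarrow> real \<Rightarrow> nat \<Rightarrow> (nat \<times> nat \<Rightarrow> bool) \<Rightarrow> real" where
  "level n p i x = (\<Sum>e\<in>pot_edges n. absent x e * edge_chaos n p x e * of_bool (i < edge_codeg n x e))"

lemma edge_codeg_own [simp]: "e \<in> pot_edges n \<Longrightarrow> edge_codeg n (x(e := t)) e = edge_codeg n x e"
  unfolding edge_codeg_def by (rule codeg_upd) (auto simp: pot_edges_def edge_def min_def max_def)

lemma edge_chaos_own [simp]: "e \<in> pot_edges n \<Longrightarrow> edge_chaos n p (x(e := t)) e = edge_chaos n p x e"
  unfolding edge_chaos_def by (rule chaos_upd) (auto simp: pot_edges_def edge_def min_def max_def)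

lemma triangles_upd':
  "e \<in> pot_edges n \<Longrightarrow> triangles n (x(e := True)) = triangles n (x(e := False)) + edge_codeg n x e"
  using triangles_upd[of "fst e" "snd e" n x] by (auto simp: edge_codeg_def pot_edges_def)

lemma edge_codeg_le: "edge_codeg n x e \<le> n"
  unfolding edge_codeg_def
  by (rule order_trans[OF codeg_le_card]) (auto intro: order_trans[OF card_mono[of "{..<n}"]])

section \<open>The covariance identity for the triangle count\<close>

locale tri_graph =
  fixes n :: nat and p :: real
  assumes prob01: "0 \<le> p" "p \<le> 1"

sublocale tri_graph \<subseteq> bernoulli_cube "pot_edges n" p
  by unfold_locales (use prob01 in auto)

context tri_graph
begin

abbreviation W :: "(nat \<times> nat \<Rightarrow> bool) \<Rightarrow> int" where "W x \<equiv> int (triangles n x)"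

definition mean :: real where "mean = Ex (\<lambda>x. of_int (W x))"

lemma mean_eq: "mean = real (card (tri_set n)) * p ^ 3"
proof -
  have "Ex (\<lambda>x. adj x i j * adj x j k * adj x i k) = p ^ 3" if "(i, j, k) \<in> tri_set n" for i j k
  proof -
    have ijk: "i < j" "j < k" "k < n" using that by (auto simp: tri_set_def)
    have "Ex (\<lambda>x. \<Prod>e\<in>{(i, j), (j, k), (i, k)}. of_bool (x e)) = p ^ card {(i, j), (j, k), (i, k)}"
      using ijk by (intro Ex_edges) (auto simp: pot_edges_def)
    then show ?thesis using ijk by (simp add: adj_def mult.assoc power3_eq_cube)
  qed
  then have "(\<Sum>(i, j, k)\<in>tri_set n. Ex (\<lambda>x. adj x i j * adj x j k * adj x i k)) = (\<Sum>t\<in>tri_set n. p ^ 3)"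
    by (intro sum.cong) auto
  then show ?thesis
    by (simp add: mean_def real_triangles case_prod_beta Ex_sum)
qed

text \<open>At \<open>e\<close>, neither \<open>edge_chaos\<close> nor \<open>edge_codeg\<close>
  involves the state of \<open>e\<close>. Averaging over that state,
  \<open>of_bool (x e) - p\<close> is \<open>1 - p\<close> with probability \<open>p\<close> and
  \<open>- p\<close> otherwise, so a difference of values of \<open>g\<close> with weight
  \<open>p * (1 - p)\<close> remains; the factor \<open>1 - p\<close> is written back as the absence
  of \<open>e\<close>.\<close>

lemma Ex_centered_mult:
  fixes g :: "int \<Rightarrow> real"
  shows "Ex (\<lambda>x. (of_int (W x) - mean) * g (W x))
    = p * (\<Sum>e\<in>pot_edges n. Ex (\<lambda>x. absent x e * edge_chaos n p x e * (g (W x + int (edge_codeg n x e)) - g (W x))))"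
proof -
  have dec: "of_int (W x) - mean = (\<Sum>e\<in>pot_edges n. (of_bool (x e) - p) * edge_chaos n p x e)" for x
  proof -
    have "of_int (W x) - mean = (\<Sum>(u, v)\<in>pot_edges n. (adj x u v - p) * chaos p ({..<n} - {u, v}) x u v)"
      by (simp add: mean_eq triangles_decomposition)
    also have "\<dots> = (\<Sum>e\<in>pot_edges n. (of_bool (x e) - p) * edge_chaos n p x e)"
      by (intro sum.cong) (auto simp: edge_chaos_def adj_def pot_edges_def)
    finally show ?thesis .
  qed
  have edge: "Ex (\<lambda>x. (of_bool (x e) - p) * edge_chaos n p x e * g (W x))
      = p * Ex (\<lambda>x. absent x e * edge_chaos n p x e * (g (W x + int (edge_codeg n x e)) - g (W x)))"
    if e: "e \<in> pot_edges n" for e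
  proof -
    define h1 where "h1 = Ex (\<lambda>x. edge_chaos n p x e * g (W (x(e := False)) + int (edge_codeg n x e)))"
    define h0 where "h0 = Ex (\<lambda>x. edge_chaos n p x e * g (W (x(e := False))))"
    have "Ex (\<lambda>x. (of_bool (x e) - p) * edge_chaos n p x e * g (W x))
        = p * ((1 - p) * h1) + (1 - p) * (- p * h0)"
      by (subst Ex_resample[OF e])
         (simp add: e triangles_upd' h1_def h0_def Ex_minus mult.assoc flip: Ex_cmult)
    moreover have "Ex (\<lambda>x. absent x e * edge_chaos n p x e * (g (W x + int (edge_codeg n x e)) - g (W x)))
       = (1 - p) * (h1 - h0)"
      by (subst Ex_resample[OF e])
         (simp add: e absent_def h1_def h0_def right_diff_distrib flip: Ex_diff)
    moreover have "p * ((1 - p) * h1) + (1 - p) * (- p * h0) = p * ((1 - p) * (h1 - h0))" by algebra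
    ultimately show ?thesis by (simp only:)
  qed
  have "Ex (\<lambda>x. (of_int (W x) - mean) * g (W x))
      = (\<Sum>e\<in>pot_edges n. Ex (\<lambda>x. (of_bool (x e) - p) * edge_chaos n p x e * g (W x)))"
    unfolding dec by (simp add: sum_distrib_right Ex_sum)
  also have "\<dots> = (\<Sum>e\<in>pot_edges n. p * Ex (\<lambda>x. absent x e * edge_chaos n p x e * (g (W x + int (edge_codeg n x e)) - g (W x))))"
    by (intro sum.cong refl edge)
  finally show ?thesis by (simp add: sum_distrib_left)
qed

lemma Ex_centered_mult_levels:
  fixes g :: "int \<Rightarrow> real"
  shows "Ex (\<lambda>x. (of_int (W x) - mean) * g (W x))
    = p * (\<Sum>i<n. Ex (\<lambda>x. level n p i x * (g (W x + int i + 1) - g (W x + int i))))"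
proof -
  \<comment> \<open>The bound \<open>c \<le> n\<close> permits one range \<open>i < n\<close> for
    all edges, so that the sums over edges and steps can be exchanged.\<close>
  have tel: "g (z + int c) - g z = (\<Sum>i<n. of_bool (i < c) * (g (z + int i + 1) - g (z + int i)))"
    if "c \<le> n" for c and z :: int
  proof -
    have "(\<Sum>i<n. of_bool (i < c) * (g (z + int i + 1) - g (z + int i)))
        = (\<Sum>i<c. g (z + int (Suc i)) - g (z + int i))"
      using that by (intro sum.mono_neutral_cong_right) (auto simp: algebra_simps)
    also have "\<dots> = g (z + int c) - g z"
      by (subst sum_lessThan_telescope) simp
    finally show ?thesis by simp
  qed
  have "(\<Sum>e\<in>pot_edges n. Ex (\<lambda>x. absent x e * edge_chaos n p x e * (g (W x + int (edge_codeg n x e)) - g (W x))))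
     = Ex (\<lambda>x. \<Sum>e\<in>pot_edges n. \<Sum>i<n. absent x e * edge_chaos n p x e * of_bool (i < edge_codeg n x e) * (g (W x + int i + 1) - g (W x + int i)))"
    by (simp add: tel[OF edge_codeg_le] sum_distrib_left mult.assoc Ex_sum del: sum_of_bool_mult_eq sum_mult_of_bool_eq)
  also have "\<dots> = (\<Sum>i<n. Ex (\<lambda>x. level n p i x * (g (W x + int i + 1) - g (W x + int i))))"
    by (subst sum.swap)
       (simp add: level_def sum_distrib_right Ex_sum del: sum_of_bool_mult_eq sum_mult_of_bool_eq)
  finally show ?thesis unfolding Ex_centered_mult by simp
qed

end

section \<open>Moments and edge influences\<close>

text \<open>By convexity the power lies below its chord over \<open>[0, 1]\<close>.\<close>

lemma one_add_power_le:
  assumes "0 \<le> y" "y \<le> (1 :: real)"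
  shows "(1 + y) ^ k - 1 \<le> (2 ^ k - 1) * y"
proof (induction k)
  case (Suc k)
  have "(1 + y) ^ k \<le> 2 ^ k" using assms by (intro power_mono) auto
  then have "(1 + y) ^ k * y \<le> 2 ^ k * y" using assms by (intro mult_right_mono) auto
  then show ?case using Suc by (simp add: algebra_simps)
qed simp

lemma one_add_power_le_exp:
  assumes "0 \<le> y" "real m * y \<le> L"
  shows "(1 + y) ^ m \<le> exp L"
proof -
  have "(1 + y) ^ m \<le> exp y ^ m"
    using assms by (intro power_mono) (auto simp: exp_ge_add_one_self)
  also have "\<dots> = exp (real m * y)" by (simp add: exp_of_nat_mult)
  finally show ?thesis using assms by (meson exp_le_cancel_iff order_trans)
qed

lemma exp_minus_one_le: "exp y - 1 \<le> y * exp (y :: real)"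
proof -
  have "(1 - y) * exp y \<le> exp (- y) * exp y"
    using exp_ge_add_one_self[of "- y"] by (intro mult_right_mono) auto
  then show ?thesis by (simp add: algebra_simps flip: exp_add)
qed

text \<open>Dominates a moment by a generating function at \<open>2 ^ k\<close>. Subtracting 1 keeps
  the bound zero at \<open>c = 0\<close>, so that the moments of a codegree come out proportional to
  \<open>n * p^2\<close> and not merely bounded.\<close>

lemma power_le_two_power:
  assumes "0 < k"
  shows "real c ^ k \<le> (2 ^ k) ^ c - 1"
proof -
  have "Suc c \<le> 2 ^ c" by (simp add: Suc_leI)
  then have c: "real c \<le> 2 ^ c - 1"
    using of_nat_mono[of "Suc c" "2 ^ c", where 'a = real] by simp
  have gen: "(y - 1) ^ k \<le> y ^ k - 1" if "1 \<le> y" for y :: real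
    using assms
  proof (induction k rule: nat_induct_non_zero)
    case (Suc k)
    have "(y - 1) ^ Suc k \<le> (y - 1) * (y ^ k - 1)"
      using Suc that by (simp add: mult_left_mono)
    moreover have "y ^ Suc k - 1 - (y - 1) * (y ^ k - 1) = (y - 1) + (y ^ k - 1)"
      by (simp add: algebra_simps)
    ultimately show ?case using that one_le_power[of y k] by linarith
  qed simp
  have "real c ^ k \<le> (2 ^ c - 1) ^ k" using c by (intro power_mono) auto
  also have "\<dots> \<le> (2 ^ c) ^ k - 1" by (rule gen) simp
  finally show ?thesis by (simp add: power_mult[symmetric] mult.commute)
qed

lemma card_pot_edges: "2 * real (card (pot_edges n)) = real n * (real n - 1)"
proof -
  have "pot_edges n = (\<lambda>(j, i). (i, j)) ` (SIGMA j:{..<n}. {..<j})"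
    by (auto simp: pot_edges_def)
  moreover have "inj_on (\<lambda>(j, i). (i, j)) (SIGMA j:{..<n}. {..<j})"
    by (auto simp: inj_on_def)
  ultimately have "card (pot_edges n) = (\<Sum>j<n. j)"
    by (simp add: card_image)
  moreover have "2 * real (\<Sum>j<n. j) = real n * (real n - 1)"
    by (induction n) (auto simp: algebra_simps)
  ultimately show ?thesis by simp
qed

definition deg :: "nat set \<Rightarrow> (nat \<times> nat \<Rightarrow> bool) \<Rightarrow> nat \<Rightarrow> nat" where
  "deg S x u = card {k \<in> S. x (edge u k)}"

lemma real_deg: "finite S \<Longrightarrow> real (deg S x u) = (\<Sum>k\<in>S. adj x u k)"
  by (simp add: deg_def adj_def Int_def conj_commute)

lemma codeg_insert:
  assumes "finite S" "k \<notin> S"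
  shows "codeg (insert k S) x u v = codeg S x u v + of_bool (x (edge u k) \<and> x (edge v k))"
proof -
  have "{l \<in> insert k S. x (edge u l) \<and> x (edge v l)}
      = (if x (edge u k) \<and> x (edge v k) then insert k {l \<in> S. x (edge u l) \<and> x (edge v l)} else {l \<in> S. x (edge u l) \<and> x (edge v l)})"
    by auto
  then show ?thesis using assms by (auto simp: codeg_def)
qed

lemma deg_insert:
  assumes "finite S" "k \<notin> S"
  shows "deg (insert k S) x u = deg S x u + of_bool (x (edge u k))"
proof -
  have "{l \<in> insert k S. x (edge u l)}
      = (if x (edge u k) then insert k {l \<in> S. x (edge u l)} else {l \<in> S. x (edge u l)})"
    by auto
  then show ?thesis using assms by (auto simp: deg_def)
qed

lemma deg_upd:
  assumes "\<And>k. k \<in> S \<Longrightarrow> edge u k \<noteq> e"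
  shows "deg S (x(e := t)) u = deg S x u"
  unfolding deg_def by (intro arg_cong[where f = card] Collect_cong) (use assms in auto)

lemma chaos_eq:
  "finite S \<Longrightarrow> chaos p S x u v = real (codeg S x u v) / 3 + p * (real (deg S x u) + real (deg S x v)) / 6 + real (card S) * p\<^sup>2 / 3"
  unfolding chaos_def real_codeg real_deg
  by (simp add: sum.distrib flip: sum_divide_distrib sum_distrib_left)

section \<open>Binomial laws of degrees and codegrees\<close>

context tri_graph
begin

lemma Ex_adj_mult:
  assumes "u < n" "k < n" "u \<noteq> k" "\<And>x b. F (x(edge u k := b)) = F x"
  shows "Ex (\<lambda>x. adj x u k * F x) = p * Ex F"
  unfolding adj_def by (rule Ex_edge_mult) (use assms edge_in_pot_edges in auto)

lemma Ex_pair_mult: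
  assumes "u < n" "v < n" "k < n" "u \<noteq> v" "u \<noteq> k" "v \<noteq> k"
    and "\<And>x b. F (x(edge u k := b)) = F x" "\<And>x b. F (x(edge v k := b)) = F x"
  shows "Ex (\<lambda>x. adj x u k * adj x v k * F x) = p\<^sup>2 * Ex F"
proof -
  have "Ex (\<lambda>x. adj x u k * (adj x v k * F x)) = p * Ex (\<lambda>x. adj x v k * F x)"
    by (rule Ex_adj_mult) (use assms in \<open>auto simp: adj_upd edge_eq_iff\<close>)
  also have "\<dots> = p * (p * Ex F)"
    by (subst Ex_adj_mult) (use assms in auto)
  finally show ?thesis by (simp add: mult.assoc power2_eq_square)
qed

text \<open>Different third vertices use disjoint pairs of edges, so the codegree is binomial with
  success probability \<open>p^2\<close>; this is its generating function.\<close>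

lemma Ex_power_codeg:
  assumes "u < n" "v < n" "u \<noteq> v" "S \<subseteq> {..<n} - {u, v}"
  shows "Ex (\<lambda>x. t ^ codeg S x u v) = (1 + (t - 1) * p\<^sup>2) ^ card S"
proof -
  have "finite S" using assms by (auto intro: finite_subset)
  then show ?thesis using assms(4)
  proof (induction S rule: finite_induct)
    case empty
    then show ?case by (simp add: codeg_def)
  next
    case (insert k S)
    have k: "k < n" "u \<noteq> k" "v \<noteq> k" using insert by auto
    have "Ex (\<lambda>x. t ^ codeg (insert k S) x u v)
        = Ex (\<lambda>x. t ^ codeg S x u v + (t - 1) * (adj x u k * adj x v k * t ^ codeg S x u v))"
      using insert by (intro arg_cong[where f = Ex] ext) (auto simp: codeg_insert adj_def algebra_simps)
    also have "\<dots> = Ex (\<lambda>x. t ^ codeg S x u v) + (t - 1) * (p\<^sup>2 * Ex (\<lambda>x. t ^ codeg S x u v))"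
      using k assms insert
      by (simp only: Ex_add Ex_cmult) (subst Ex_pair_mult, auto intro!: arg_cong[where f = "power t"] codeg_upd simp: edge_eq_iff)
    finally show ?case using insert by (simp add: algebra_simps)
  qed
qed

lemma Ex_power_deg:
  assumes "u < n" "S \<subseteq> {..<n} - {u}"
  shows "Ex (\<lambda>x. t ^ deg S x u) = (1 + (t - 1) * p) ^ card S"
proof -
  have "finite S" using assms by (auto intro: finite_subset)
  then show ?thesis using assms(2)
  proof (induction S rule: finite_induct)
    case empty
    then show ?case by (simp add: deg_def)
  next
    case (insert k S)
    have k: "k < n" "u \<noteq> k" using insert by auto
    have "Ex (\<lambda>x. t ^ deg (insert k S) x u)
        = Ex (\<lambda>x. t ^ deg S x u + (t - 1) * (adj x u k * t ^ deg S x u))"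
      using insert by (intro arg_cong[where f = Ex] ext) (auto simp: deg_insert adj_def algebra_simps)
    also have "\<dots> = Ex (\<lambda>x. t ^ deg S x u) + (t - 1) * (p * Ex (\<lambda>x. t ^ deg S x u))"
      using k assms insert
      by (simp only: Ex_add Ex_cmult) (subst Ex_adj_mult, auto intro!: arg_cong[where f = "power t"] deg_upd simp: edge_eq_iff)
    finally show ?case using insert by (simp add: algebra_simps)
  qed
qed

text \<open>The exact binomial value has exponent \<open>card S - 1\<close>; giving away one factor
  \<open>1 - p^2\<close> avoids the truncated subtraction.\<close>

lemma Ex_codeg_eq_1:
  assumes "u < n" "v < n" "u \<noteq> v" "S \<subseteq> {..<n} - {u, v}"
  shows "real (card S) * p\<^sup>2 * (1 - p\<^sup>2) ^ card S \<le> Ex (\<lambda>x. of_bool (codeg S x u v = 1))"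
proof -
  have "finite S" using assms by (auto intro: finite_subset)
  then show ?thesis using assms(4)
  proof (induction S rule: finite_induct)
    case empty
    then show ?case by (simp add: codeg_def)
  next
    case (insert k S)
    have k: "k < n" "u \<noteq> k" "v \<noteq> k" using insert by auto
    have S: "S \<subseteq> {..<n} - {u, v}" using insert by auto
    have p2: "0 \<le> 1 - p\<^sup>2" "1 - p\<^sup>2 \<le> 1" using prob01 by (auto simp: power_le_one)
    have upd: "codeg S (x(edge u k := b)) u v = codeg S x u v" "codeg S (x(edge v k := b)) u v = codeg S x u v" for x b
      using insert assms by (auto intro!: codeg_upd simp: edge_eq_iff)
    define q1 where "q1 = Ex (\<lambda>x. of_bool (codeg S x u v = 1))"
    \<comment> \<open>Since \<open>0 ^ 0 = 1\<close>, this power is the indicator of codegree zero,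
      evaluated by \<open>Ex_power_codeg\<close> at \<open>t = 0\<close>.\<close>
    define q0 where "q0 = Ex (\<lambda>x. (0 :: real) ^ codeg S x u v)"
    have q0: "q0 = (1 - p\<^sup>2) ^ card S"
      unfolding q0_def by (subst Ex_power_codeg[OF assms(1-3) S]) simp
    have "Ex (\<lambda>x. of_bool (codeg (insert k S) x u v = 1))
        = Ex (\<lambda>x. of_bool (codeg S x u v = 1) - adj x u k * adj x v k * of_bool (codeg S x u v = 1)
                + adj x u k * adj x v k * (0 :: real) ^ codeg S x u v)"
      using insert by (intro arg_cong[where f = Ex] ext) (auto simp: codeg_insert adj_def of_bool_def power_0_left)
    also have "\<dots> = q1 - p\<^sup>2 * q1 + p\<^sup>2 * q0"
      unfolding q1_def q0_def using k assms
      by (simp only: Ex_add Ex_diff) (subst Ex_pair_mult, auto simp: upd)+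
    finally have eq: "Ex (\<lambda>x. of_bool (codeg (insert k S) x u v = 1)) = (1 - p\<^sup>2) * q1 + p\<^sup>2 * q0"
      by (simp add: algebra_simps)
    have "(1 - p\<^sup>2) * (real (card S) * p\<^sup>2 * (1 - p\<^sup>2) ^ card S) \<le> (1 - p\<^sup>2) * q1"
      using insert.IH[OF S] p2 unfolding q1_def by (intro mult_left_mono) auto
    moreover have "(1 - p\<^sup>2) * (p\<^sup>2 * (1 - p\<^sup>2) ^ card S) \<le> p\<^sup>2 * q0"
      unfolding q0 using p2 by (intro mult_left_le_one_le) auto
    moreover have "real (card (insert k S)) * p\<^sup>2 * (1 - p\<^sup>2) ^ card (insert k S)
       = (1 - p\<^sup>2) * (real (card S) * p\<^sup>2 * (1 - p\<^sup>2) ^ card S) + (1 - p\<^sup>2) * (p\<^sup>2 * (1 - p\<^sup>2) ^ card S)"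
      using insert by (simp add: algebra_simps)
    ultimately show ?case unfolding eq by linarith
  qed
qed

end

text \<open>A majorant for the summands of \<open>level\<close> and their changes. The power of two
  dominates \<open>2 ^ i\<close> when \<open>i \<le> codeg\<close>, which gives geometric decay in
  \<open>i\<close>; the 2 leaves room for the change of \<open>chaos\<close> due to one more third
  vertex.\<close>

definition growth :: "real \<Rightarrow> nat set \<Rightarrow> (nat \<times> nat \<Rightarrow> bool) \<Rightarrow> nat \<Rightarrow> nat \<Rightarrow> real" where
  "growth p S x u v = (2 + chaos p S x u v) * 2 ^ codeg S x u v"

text \<open>Flipping \<open>ab\<close> also affects the edges \<open>aw\<close> and
  \<open>bw\<close>. The codegree of \<open>aw\<close> changes only if \<open>bw\<close> is present,
  and otherwise only its \<open>chaos\<close> moves, by order \<open>p\<close>: hence the weight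
  \<open>adj x b w + p\<close>. Removing \<open>b\<close> from the third vertices makes
  \<open>growth\<close> independent of this weight.\<close>

definition influence :: "nat \<Rightarrow> real \<Rightarrow> nat \<times> nat \<Rightarrow> (nat \<times> nat \<Rightarrow> bool) \<Rightarrow> real" where
  "influence n p f x = (case f of (a, b) \<Rightarrow> growth p ({..<n} - {a, b}) x a b
     + (\<Sum>w\<in>{..<n} - {a, b}. (adj x b w + p) * growth p ({..<n} - {a, b, w}) x a w)
     + (\<Sum>w\<in>{..<n} - {a, b}. (adj x a w + p) * growth p ({..<n} - {a, b, w}) x b w))"

lemma chaos_nonneg: "0 \<le> p \<Longrightarrow> 0 \<le> chaos p S x u v"
  unfolding chaos_def by (intro sum_nonneg) auto

lemma growth_ge_1: "0 \<le> p \<Longrightarrow> 1 \<le> growth p S x u v"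
  unfolding growth_def using mult_mono[of 1 "2 + chaos p S x u v" 1 "2 ^ codeg S x u v"] chaos_nonneg[of p S x u v]
  by auto

lemma growth_upd:
  assumes "\<And>k. k \<in> S \<Longrightarrow> edge u k \<noteq> e \<and> edge v k \<noteq> e"
  shows "growth p S (x(e := t)) u v = growth p S x u v"
proof -
  have "chaos p S (x(e := t)) u v = chaos p S x u v" by (rule chaos_upd) (rule assms)
  moreover have "codeg S (x(e := t)) u v = codeg S x u v" by (rule codeg_upd) (rule assms)
  ultimately show ?thesis by (simp add: growth_def)
qed

text \<open>\<open>L\<close> bounds the mean codegree. The constants \<open>C_growth\<close>,
  \<open>C_sd\<close> and so on depend on \<open>L\<close> alone, which makes the estimates uniform
  in \<open>n\<close>; \<open>np1\<close> absorbs lower powers of \<open>n * p\<close> into higher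
  ones.\<close>

locale tri_regime = tri_graph +
  fixes L :: real
  assumes np2: "real n * p\<^sup>2 \<le> L" and p_half: "p \<le> 1 / 2" and np1: "1 \<le> real n * p" and n4: "4 \<le> n"
begin

lemma L_nonneg: "0 \<le> L"
  using np2 by (meson mult_nonneg_nonneg of_nat_0_le_iff order_trans zero_le_power2)

lemma card_le_n: "S \<subseteq> {..<n} \<Longrightarrow> card S \<le> n"
  using card_mono[of "{..<n}" S] by simp

lemma card_p2_le: "S \<subseteq> {..<n} \<Longrightarrow> real (card S) * p\<^sup>2 \<le> real n * p\<^sup>2"
  using card_le_n by (intro mult_right_mono) auto

lemma Ex_codeg_power_le:
  assumes "u < n" "v < n" "u \<noteq> v" "S \<subseteq> {..<n} - {u, v}" "0 < k"
  shows "Ex (\<lambda>x. real (codeg S x u v) ^ k) \<le> 2 ^ k * exp (2 ^ k * L) * (real n * p\<^sup>2)"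
proof -
  \<comment> \<open>The increment \<open>(t - 1) * p^2\<close> of \<open>Ex_power_codeg\<close> at
    \<open>t = 2 ^ k\<close>.\<close>
  define y where "y = (2 ^ k - 1) * p\<^sup>2"
  define m where "m = real (card S)"
  have y0: "0 \<le> y" unfolding y_def by simp
  have m: "m * p\<^sup>2 \<le> real n * p\<^sup>2" unfolding m_def using assms by (intro card_p2_le) auto
  have my: "m * y \<le> 2 ^ k * (real n * p\<^sup>2)"
  proof -
    have "m * y = (2 ^ k - 1) * (m * p\<^sup>2)" by (simp add: y_def)
    also have "\<dots> \<le> 2 ^ k * (real n * p\<^sup>2)" by (intro mult_mono m) (simp_all add: m_def)
    finally show ?thesis .
  qed
  have "Ex (\<lambda>x. real (codeg S x u v) ^ k) \<le> Ex (\<lambda>x. (2 ^ k) ^ codeg S x u v - 1)"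
    by (intro Ex_mono power_le_two_power assms)
  also have "\<dots> = (1 + y) ^ card S - 1"
    using Ex_power_codeg[OF assms(1-4), of "2 ^ k"] by (simp add: Ex_diff y_def)
  also have "\<dots> \<le> exp (m * y) - 1"
    using one_add_power_le_exp[OF y0, of "card S" "m * y"] by (simp add: m_def)
  also have "\<dots> \<le> m * y * exp (m * y)" by (rule exp_minus_one_le)
  also have "\<dots> \<le> (2 ^ k * (real n * p\<^sup>2)) * exp (2 ^ k * L)"
  proof (rule mult_mono[OF my])
    show "exp (m * y) \<le> exp (2 ^ k * L)"
      using my np2 by (simp only: exp_le_cancel_iff) (meson mult_left_mono order_trans zero_le_power zero_le_numeral)
  qed (use my y0 in \<open>auto simp: m_def\<close>)
  finally show ?thesis by (simp add: ac_simps)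
qed

text \<open>Bounding the linear expression for \<open>chaos\<close> by a product of exponentials,
  and splitting products by \<open>a * b \<le> a^2 + b^2\<close>, leaves pure powers in the codegree
  or in one degree, so that one-variable binomial generating functions suffice.\<close>

lemma Ex_growth_sq_le:
  assumes "u < n" "v < n" "u \<noteq> v" "S \<subseteq> {..<n} - {u, v}"
  shows "Ex (\<lambda>x. (growth p S x u v)\<^sup>2) \<le> 3 * (2 + L)\<^sup>2 * exp (255 * L)"
proof -
  have fin: "finite S" using assms by (auto intro: finite_subset)
  define m where "m = card S"
  have mp: "real m * p\<^sup>2 \<le> L"
    unfolding m_def by (rule order_trans[OF card_p2_le np2]) (use assms in auto)
  define c where "c = (\<lambda>x. codeg S x u v)"
  define d where "d = (\<lambda>x. deg S x u)"
  define d' where "d' = (\<lambda>x. deg S x v)"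
  define Y where "Y = (\<lambda>x. (1 + p) ^ d x)"
  define Y' where "Y' = (\<lambda>x. (1 + p) ^ d' x)"
  have pw: "(growth p S x u v)\<^sup>2 \<le> (2 + L)\<^sup>2 * (256 ^ c x + ((1 + p) ^ 8) ^ d x + ((1 + p) ^ 8) ^ d' x)" for x
  proof -
    have bern: "1 + p * real k \<le> (1 + p) ^ k" for k
      using Bernoulli_inequality[of p k] prob01 by (simp add: mult.commute)
    have "Suc (c x) \<le> 2 ^ c x" by (simp add: Suc_leI)
    then have c1: "1 + real (c x) \<le> 2 ^ c x"
      using of_nat_mono[of "Suc (c x)" "2 ^ c x", where 'a = real] by simp
    have y1: "1 + p * real (d x) \<le> Y x" and y2: "1 + p * real (d' x) \<le> Y' x"
      unfolding Y_def Y'_def by (rule bern)+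
    have pd: "0 \<le> p * real (d x)" "0 \<le> p * real (d' x)" using prob01 by auto
    have "2 + chaos p S x u v \<le> 2 + real (c x) / 3 + (p * real (d x) + p * real (d' x)) / 6 + L / 3"
      unfolding chaos_eq[OF fin] using mp by (simp add: c_def d_def d'_def m_def distrib_left)
    also have "\<dots> \<le> 2 + 2 * (real (c x) + p * real (d x) + p * real (d' x)) + L"
    proof -
      have "2 + a / 3 + (u + v) / 6 + l / 3 \<le> 2 + 2 * (a + u + v) + l"
        if "0 \<le> a" "0 \<le> u" "0 \<le> v" "0 \<le> l" for a u v l :: real
        using that by argo
      then show ?thesis using pd L_nonneg by simp
    qed
    also have "\<dots> \<le> (2 + L) * (1 + (real (c x) + p * real (d x) + p * real (d' x)))"
      using L_nonneg pd by (simp add: algebra_simps)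
    also have "\<dots> \<le> (2 + L) * ((1 + real (c x)) * ((1 + p * real (d x)) * (1 + p * real (d' x))))"
    proof (rule mult_left_mono)
      have e: "(1 + a) * ((1 + b) * (1 + e)) = 1 + (a + b + e) + (a * b + a * e + b * e + a * (b * e))" for a b e :: real
        by (simp add: algebra_simps)
      show "1 + (real (c x) + p * real (d x) + p * real (d' x)) \<le> (1 + real (c x)) * ((1 + p * real (d x)) * (1 + p * real (d' x)))"
        unfolding e using pd by simp
    qed (use L_nonneg in simp)
    also have "\<dots> \<le> (2 + L) * (2 ^ c x * (Y x * Y' x))"
      using c1 y1 y2 pd L_nonneg by (intro mult_left_mono mult_mono) auto
    finally have "2 + chaos p S x u v \<le> (2 + L) * (2 ^ c x * (Y x * Y' x))" .
    moreover have "codeg S x u v = c x" by (simp add: c_def)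
    ultimately have "growth p S x u v \<le> (2 + L) * (2 ^ c x * (Y x * Y' x)) * 2 ^ c x"
      unfolding growth_def by (simp only:) (rule mult_right_mono, auto)
    also have "\<dots> = (2 + L) * (4 ^ c x * (Y x * Y' x))"
      by (simp flip: power_mult_distrib)
    finally have g: "growth p S x u v \<le> (2 + L) * (4 ^ c x * (Y x * Y' x))" .
    have "(growth p S x u v)\<^sup>2 \<le> ((2 + L) * (4 ^ c x * (Y x * Y' x)))\<^sup>2"
      using g growth_ge_1[of p S x u v] prob01 by (intro power_mono) auto
    also have "\<dots> = (2 + L)\<^sup>2 * ((4 ^ c x)\<^sup>2 * ((Y x)\<^sup>2 * (Y' x)\<^sup>2))"
      by (simp only: power_mult_distrib)
    \<comment> \<open>Two splittings. Counting the square of \<open>growth\<close> itself, the base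
      4 is squared twice, giving 256, and each power of \<open>1 + p\<close> three times, giving the
      exponent 8.\<close>
    also have "\<dots> \<le> (2 + L)\<^sup>2 * (((4 ^ c x)\<^sup>2)\<^sup>2 + ((Y x) ^ 8 + (Y' x) ^ 8))"
    proof (rule mult_left_mono)
      have am: "a * b \<le> a\<^sup>2 + b\<^sup>2" for a b :: real
        using sum_squares_bound[of a b] mult_nonneg_nonneg[of a b] zero_le_power2[of a] zero_le_power2[of b] by (cases "0 \<le> a * b") linarith+
      have "(4 ^ c x)\<^sup>2 * ((Y x)\<^sup>2 * (Y' x)\<^sup>2) \<le> ((4 ^ c x)\<^sup>2)\<^sup>2 + ((Y x)\<^sup>2 * (Y' x)\<^sup>2)\<^sup>2"
        by (rule am)
      also have "((Y x)\<^sup>2 * (Y' x)\<^sup>2)\<^sup>2 = (Y x) ^ 4 * (Y' x) ^ 4"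
        by (simp add: power_mult_distrib flip: power_mult)
      also have "\<dots> \<le> ((Y x) ^ 4)\<^sup>2 + ((Y' x) ^ 4)\<^sup>2"
        by (rule am)
      also have "\<dots> = (Y x) ^ 8 + (Y' x) ^ 8"
        by (simp flip: power_mult)
      finally show "(4 ^ c x)\<^sup>2 * ((Y x)\<^sup>2 * (Y' x)\<^sup>2) \<le> ((4 ^ c x)\<^sup>2)\<^sup>2 + ((Y x) ^ 8 + (Y' x) ^ 8)" by simp
    qed simp
    also have "((4 ^ c x)\<^sup>2)\<^sup>2 = (256 :: real) ^ c x"
    proof -
      have "((4 ^ c x)\<^sup>2)\<^sup>2 = ((4 :: real) ^ 4) ^ c x" by (simp only: power_mult[symmetric]) (simp add: mult.commute)
      then show ?thesis by simp
    qed
    finally show ?thesis by (simp add: Y_def Y'_def mult.commute add.assoc flip: power_mult)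
  qed
  have "Ex (\<lambda>x. (growth p S x u v)\<^sup>2)
      \<le> Ex (\<lambda>x. (2 + L)\<^sup>2 * (256 ^ c x + ((1 + p) ^ 8) ^ d x + ((1 + p) ^ 8) ^ d' x))"
    by (rule Ex_mono) (rule pw)
  also have "\<dots> = (2 + L)\<^sup>2 * ((1 + 255 * p\<^sup>2) ^ m + (1 + ((1 + p) ^ 8 - 1) * p) ^ m + (1 + ((1 + p) ^ 8 - 1) * p) ^ m)"
    using assms Ex_power_codeg[of u v S 256] Ex_power_deg[of u S "(1 + p) ^ 8"] Ex_power_deg[of v S "(1 + p) ^ 8"]
    by (simp add: Ex_cmult Ex_add c_def d_def d'_def m_def subset_Diff_insert)
  also have "\<dots> \<le> (2 + L)\<^sup>2 * (exp (255 * L) + exp (255 * L) + exp (255 * L))"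
  proof (intro mult_left_mono add_mono one_add_power_le_exp)
    show "real m * (255 * p\<^sup>2) \<le> 255 * L" using mp by simp
    \<comment> \<open>The chord bound gives \<open>2 ^ 8 - 1 = 255\<close>; a degree thus
      contributes order \<open>p^2\<close> per vertex, like the codegree.\<close>
    have "((1 + p) ^ 8 - 1) * p \<le> 255 * p\<^sup>2"
      using mult_right_mono[OF one_add_power_le[of p 8], of p] prob01 by (simp add: power2_eq_square)
    then have "real m * (((1 + p) ^ 8 - 1) * p) \<le> real m * (255 * p\<^sup>2)" by (intro mult_left_mono) auto
    then show "real m * (((1 + p) ^ 8 - 1) * p) \<le> 255 * L" "real m * (((1 + p) ^ 8 - 1) * p) \<le> 255 * L"
      using mp by simp_all
    show "0 \<le> ((1 + p) ^ 8 - 1) * p" "0 \<le> ((1 + p) ^ 8 - 1) * p" using prob01 by simp_all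
  qed auto
  finally show ?thesis by (simp add: mult.assoc)
qed

text \<open>After \<open>G w * G w' \<le> ((G w)^2 + (G w')^2) / 2\<close> and symmetrisation only
  \<open>(G w)^2\<close> is left. It does not depend on the edges at \<open>b\<close> that form the
  two weights, so expectations factor. The product of the weights has mean \<open>4 * p^2\<close>
  off the diagonal and at most \<open>4 * p^2 + 4 * p\<close> on it.\<close>

lemma Ex_growth_sum_sq_le:
  assumes "b < n" "T \<subseteq> {..<n} - {b}" "0 \<le> K"
    and G_inv: "\<And>w k x t. w \<in> T \<Longrightarrow> k \<in> T \<Longrightarrow> G w (x(edge b k := t)) = G w x"
    and G_sq: "\<And>w. w \<in> T \<Longrightarrow> Ex (\<lambda>x. (G w x)\<^sup>2) \<le> K"
  shows "Ex (\<lambda>x. (\<Sum>w\<in>T. (adj x b w + p) * G w x)\<^sup>2) \<le> 8 * K * (real n * p)\<^sup>2"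
proof -
  have T: "T \<subseteq> {..<n}" "b \<notin> T" and fin: "finite T" using assms(2) by (auto intro: finite_subset)
  define xi where "xi = (\<lambda>x w. adj x b w + p)"
  have xi0: "0 \<le> xi x w" for x w unfolding xi_def using prob01 by simp
  have "Ex (\<lambda>x. (\<Sum>w\<in>T. xi x w * G w x)\<^sup>2) \<le> Ex (\<lambda>x. \<Sum>w\<in>T. \<Sum>w'\<in>T. xi x w * xi x w' * (G w x)\<^sup>2)"
  proof (rule Ex_mono)
    fix x
    have "(\<Sum>w\<in>T. xi x w * G w x)\<^sup>2 = (\<Sum>w\<in>T. \<Sum>w'\<in>T. xi x w * xi x w' * (G w x * G w' x))"
      by (simp add: power2_eq_square sum_product ac_simps)
    also have "\<dots> \<le> (\<Sum>w\<in>T. \<Sum>w'\<in>T. xi x w * xi x w' * (((G w x)\<^sup>2 + (G w' x)\<^sup>2) / 2))"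
    proof (intro sum_mono mult_left_mono)
      fix w w'
      show "G w x * G w' x \<le> ((G w x)\<^sup>2 + (G w' x)\<^sup>2) / 2"
        using sum_squares_bound[of "G w x" "G w' x"] by simp
    qed (simp add: xi0)
    also have "\<dots> = (\<Sum>w\<in>T. \<Sum>w'\<in>T. xi x w * xi x w' * (G w x)\<^sup>2) / 2
        + (\<Sum>w\<in>T. \<Sum>w'\<in>T. xi x w * xi x w' * (G w' x)\<^sup>2) / 2"
      by (simp add: sum_divide_distrib add_divide_distrib distrib_left sum.distrib)
    also have "(\<Sum>w\<in>T. \<Sum>w'\<in>T. xi x w * xi x w' * (G w' x)\<^sup>2) = (\<Sum>w\<in>T. \<Sum>w'\<in>T. xi x w * xi x w' * (G w x)\<^sup>2)"
      by (subst sum.swap) (simp add: mult.commute mult.left_commute)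
    finally show "(\<Sum>w\<in>T. xi x w * G w x)\<^sup>2 \<le> (\<Sum>w\<in>T. \<Sum>w'\<in>T. xi x w * xi x w' * (G w x)\<^sup>2)" by simp
  qed
  also have "\<dots> = (\<Sum>w\<in>T. \<Sum>w'\<in>T. Ex (\<lambda>x. xi x w * xi x w' * (G w x)\<^sup>2))"
    by (simp add: Ex_sum)
  also have "\<dots> \<le> (\<Sum>w\<in>T. \<Sum>w'\<in>T. 4 * p\<^sup>2 * K + (if w' = w then 4 * p * K else 0))"
  proof (intro sum_mono)
    fix w w' assume w: "w \<in> T" "w' \<in> T"
    define F where "F = (\<lambda>x. (G w x)\<^sup>2)"
    have F_inv: "F (x(edge b k := t)) = F x" if "k \<in> T" for x k t
      unfolding F_def using G_inv w that by simp
    have F0: "0 \<le> Ex F" unfolding F_def by (rule Ex_nonneg) simp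
    have FK: "Ex F \<le> K" unfolding F_def using G_sq w by simp
    have one: "Ex (\<lambda>x. adj x b k * F x) = p * Ex F" if "k \<in> T" for k
      by (rule Ex_adj_mult) (use that T assms F_inv in auto)
    have wb: "w < n" "w' < n" "w \<noteq> b" "w' \<noteq> b" using w T by auto
    show "Ex (\<lambda>x. xi x w * xi x w' * (G w x)\<^sup>2) \<le> 4 * p\<^sup>2 * K + (if w' = w then 4 * p * K else 0)"
    proof (cases "w' = w")
      case True
      have "Ex (\<lambda>x. xi x w * xi x w' * (G w x)\<^sup>2) = Ex (\<lambda>x. (1 + 2 * p) * (adj x b w * F x) + p\<^sup>2 * F x)"
        unfolding True F_def xi_def
        by (intro arg_cong[where f = Ex] ext) (auto simp: adj_def algebra_simps power2_eq_square)
      also have "\<dots> = ((1 + 2 * p) * p + p\<^sup>2) * Ex F"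
        by (simp only: Ex_add Ex_cmult one[OF w(1)]) (simp add: algebra_simps)
      also have "\<dots> \<le> (4 * p\<^sup>2 + 4 * p) * K"
        using FK F0 prob01 by (intro mult_mono) (auto simp: power2_eq_square algebra_simps)
      finally show ?thesis using True by (simp add: algebra_simps)
    next
      case False
      have two: "Ex (\<lambda>x. adj x b w * (adj x b w' * F x)) = p * (p * Ex F)"
        by (subst Ex_adj_mult)
           (use wb w assms F_inv one[OF w(2)] False in \<open>auto simp: adj_upd edge_eq_iff\<close>)
      have "Ex (\<lambda>x. xi x w * xi x w' * (G w x)\<^sup>2)
          = Ex (\<lambda>x. adj x b w * (adj x b w' * F x) + p * (adj x b w * F x) + p * (adj x b w' * F x) + p\<^sup>2 * F x)"
        unfolding F_def xi_def
        by (intro arg_cong[where f = Ex] ext) (simp add: algebra_simps power2_eq_square)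
      also have "\<dots> = 4 * p\<^sup>2 * Ex F"
        using one[OF w(1)] one[OF w(2)] two by (simp add: Ex_add Ex_cmult power2_eq_square)
      also have "\<dots> \<le> 4 * p\<^sup>2 * K" using FK by (intro mult_left_mono) auto
      finally show ?thesis using False by simp
    qed
  qed
  also have "\<dots> = real (card T) * (real (card T) * (4 * p\<^sup>2 * K) + 4 * p * K)"
    using fin by (simp add: sum.distrib algebra_simps)
  \<comment> \<open>The diagonal contributes order \<open>n * p\<close>, which \<open>np1\<close>
    raises to \<open>(n * p)^2\<close>.\<close>
  also have "\<dots> \<le> real n * (real n * (4 * p\<^sup>2 * K) + (real n * p) * (4 * p * K))"
  proof (rule mult_mono, simp add: card_le_n T, rule add_mono)
    show "real (card T) * (4 * p\<^sup>2 * K) \<le> real n * (4 * p\<^sup>2 * K)"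
      using card_le_n[OF T(1)] assms(3) by (intro mult_right_mono) auto
    show "4 * p * K \<le> real n * p * (4 * p * K)"
      using mult_right_mono[OF np1, of "4 * p * K"] prob01 assms(3) by simp
  qed (use T prob01 assms(3) card_le_n in auto)
  also have "\<dots> = 8 * K * (real n * p)\<^sup>2" by (simp add: power2_eq_square algebra_simps)
  finally show ?thesis by (simp add: xi_def)
qed

definition C_growth :: real where "C_growth = 3 * (2 + L)\<^sup>2 * exp (255 * L)"

lemma C_growth_nonneg: "0 \<le> C_growth" unfolding C_growth_def by simp

text \<open>The constant is \<open>3 * (1 + 8 + 8)\<close>: the 3 comes from squaring a sum of three
  terms, and the term of the edge itself is raised to order \<open>(n * p)^2\<close> by
  \<open>np1\<close>.\<close>

lemma Ex_influence_sq_le: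
  assumes "f \<in> pot_edges n"
  shows "Ex (\<lambda>x. (influence n p f x)\<^sup>2) \<le> 51 * C_growth * (real n * p)\<^sup>2"
proof -
  obtain a b where f: "f = (a, b)" "a < b" "b < n" using assms by (auto simp: pot_edges_def)
  define T where "T = {..<n} - {a, b}"
  define S1 where "S1 = (\<lambda>x. \<Sum>w\<in>T. (adj x b w + p) * growth p ({..<n} - {a, b, w}) x a w)"
  define S2 where "S2 = (\<lambda>x. \<Sum>w\<in>T. (adj x a w + p) * growth p ({..<n} - {a, b, w}) x b w)"
  define G0 where "G0 = growth p T"
  have b0: "Ex (\<lambda>x. (G0 x a b)\<^sup>2) \<le> C_growth"
    unfolding G0_def C_growth_def by (rule Ex_growth_sq_le) (use f in \<open>auto simp: T_def\<close>)
  have b1: "Ex (\<lambda>x. (S1 x)\<^sup>2) \<le> 8 * C_growth * (real n * p)\<^sup>2"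
    unfolding S1_def
  proof (rule Ex_growth_sum_sq_le)
    fix w k x t assume "w \<in> T" "k \<in> T"
    then show "growth p ({..<n} - {a, b, w}) (x(edge b k := t)) a w = growth p ({..<n} - {a, b, w}) x a w"
      by (intro growth_upd) (use f in \<open>auto simp: T_def edge_eq_iff\<close>)
  next
    fix w assume "w \<in> T"
    then show "Ex (\<lambda>x. (growth p ({..<n} - {a, b, w}) x a w)\<^sup>2) \<le> C_growth"
      unfolding C_growth_def by (intro Ex_growth_sq_le) (use f in \<open>auto simp: T_def\<close>)
  qed (use f C_growth_nonneg in \<open>auto simp: T_def\<close>)
  have b2: "Ex (\<lambda>x. (S2 x)\<^sup>2) \<le> 8 * C_growth * (real n * p)\<^sup>2"
    unfolding S2_def
  proof (rule Ex_growth_sum_sq_le)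
    fix w k x t assume "w \<in> T" "k \<in> T"
    then show "growth p ({..<n} - {a, b, w}) (x(edge a k := t)) b w = growth p ({..<n} - {a, b, w}) x b w"
      by (intro growth_upd) (use f in \<open>auto simp: T_def edge_eq_iff\<close>)
  next
    fix w assume "w \<in> T"
    then show "Ex (\<lambda>x. (growth p ({..<n} - {a, b, w}) x b w)\<^sup>2) \<le> C_growth"
      unfolding C_growth_def by (intro Ex_growth_sq_le) (use f in \<open>auto simp: T_def\<close>)
  qed (use f C_growth_nonneg in \<open>auto simp: T_def\<close>)
  have "Ex (\<lambda>x. (influence n p f x)\<^sup>2) \<le> Ex (\<lambda>x. 3 * (G0 x a b)\<^sup>2 + 3 * (S1 x)\<^sup>2 + 3 * (S2 x)\<^sup>2)"
  proof (rule Ex_mono)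
    fix x
    have 3: "(u + v + w)\<^sup>2 \<le> 3 * u\<^sup>2 + 3 * v\<^sup>2 + 3 * w\<^sup>2" for u v w :: real
      using sum_squares_bound[of u v] sum_squares_bound[of u w] sum_squares_bound[of v w]
      by (simp add: power2_eq_square algebra_simps)
    show "(influence n p f x)\<^sup>2 \<le> 3 * (G0 x a b)\<^sup>2 + 3 * (S1 x)\<^sup>2 + 3 * (S2 x)\<^sup>2"
      unfolding influence_def f(1) prod.case S1_def S2_def G0_def T_def by (rule 3)
  qed
  also have "\<dots> \<le> 3 * C_growth + 3 * (8 * C_growth * (real n * p)\<^sup>2) + 3 * (8 * C_growth * (real n * p)\<^sup>2)"
    using b0 b1 b2 by (simp add: Ex_add Ex_cmult)
  also have "\<dots> \<le> 51 * C_growth * (real n * p)\<^sup>2"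
  proof -
    have "C_growth * 1 \<le> C_growth * (real n * p)\<^sup>2"
      using np1 C_growth_nonneg by (intro mult_left_mono one_le_power) auto
    then show ?thesis by simp
  qed
  finally show ?thesis .
qed

lemma card_pot_edges_le: "real (card (pot_edges n)) \<le> (real n)\<^sup>2"
  using card_pot_edges[of n] by (simp add: power2_eq_square right_diff_distrib)

lemma card_pot_edges_ge: "(real n)\<^sup>2 / 4 \<le> real (card (pot_edges n))"
proof -
  have "4 * real n \<le> real n * real n" using n4 by (intro mult_right_mono) auto
  then show ?thesis using card_pot_edges[of n] by (simp add: power2_eq_square right_diff_distrib)
qed

text \<open>With at most \<open>n^2\<close> edges, Efron--Stein gives the order
  \<open>p * n^2 * (n * p)^2 = (n * p^2) * (n^3 * p)\<close>, and the first factor is at most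
  \<open>L\<close>. The second is \<open>(n * p)^3 / p^2\<close>, so that \<open>p\<close> times the
  standard deviation is of order \<open>c * (n * p)^(3/2)\<close>.\<close>

lemma var_le_of_influence:
  assumes "0 \<le> c" "\<And>f x. f \<in> pot_edges n \<Longrightarrow> \<bar>F (x(f := True)) - F (x(f := False))\<bar> \<le> c * influence n p f x"
  shows "Ex (\<lambda>x. (F x - Ex F)\<^sup>2) \<le> c\<^sup>2 * (51 * C_growth * L * (real n ^ 3 * p))"
proof -
  have "Ex (\<lambda>x. (F x - Ex F)\<^sup>2) \<le> p * (\<Sum>f\<in>pot_edges n. Ex (\<lambda>x. (F (x(f := True)) - F (x(f := False)))\<^sup>2))"
    by (rule Efron_Stein_bernoulli) (use prob01 in auto)
  also have "\<dots> \<le> p * (\<Sum>f\<in>pot_edges n. c\<^sup>2 * (51 * C_growth * (real n * p)\<^sup>2))"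
  proof (intro mult_left_mono sum_mono)
    fix f assume f: "f \<in> pot_edges n"
    have "Ex (\<lambda>x. (F (x(f := True)) - F (x(f := False)))\<^sup>2) \<le> Ex (\<lambda>x. c\<^sup>2 * (influence n p f x)\<^sup>2)"
    proof (rule Ex_mono)
      fix x
      have "\<bar>F (x(f := True)) - F (x(f := False))\<bar>\<^sup>2 \<le> (c * influence n p f x)\<^sup>2"
        using assms(2)[OF f] by (intro power_mono) auto
      then show "(F (x(f := True)) - F (x(f := False)))\<^sup>2 \<le> c\<^sup>2 * (influence n p f x)\<^sup>2"
        by (simp add: power_mult_distrib)
    qed
    also have "\<dots> \<le> c\<^sup>2 * (51 * C_growth * (real n * p)\<^sup>2)"
      unfolding Ex_cmult using Ex_influence_sq_le[OF f] by (intro mult_left_mono) auto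
    finally show "Ex (\<lambda>x. (F (x(f := True)) - F (x(f := False)))\<^sup>2) \<le> c\<^sup>2 * (51 * C_growth * (real n * p)\<^sup>2)" .
  qed (use prob01 in auto)
  also have "\<dots> = real (card (pot_edges n)) * (p * (c\<^sup>2 * (51 * C_growth * (real n * p)\<^sup>2)))"
    by (simp add: ac_simps)
  also have "\<dots> \<le> (real n)\<^sup>2 * (p * (c\<^sup>2 * (51 * C_growth * (real n * p)\<^sup>2)))"
    using card_pot_edges_le prob01 C_growth_nonneg by (intro mult_right_mono) auto
  also have "\<dots> = c\<^sup>2 * (51 * C_growth * (real n * p\<^sup>2) * (real n ^ 3 * p))"
    by (simp add: power2_eq_square power3_eq_cube ac_simps)
  also have "\<dots> \<le> c\<^sup>2 * (51 * C_growth * L * (real n ^ 3 * p))"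
    using np2 C_growth_nonneg prob01 by (intro mult_left_mono mult_right_mono) auto
  finally show ?thesis .
qed

section \<open>The effect of flipping one edge\<close>

lemma edge_codeg_edge: "u \<noteq> v \<Longrightarrow> edge_codeg n x (edge u v) = codeg ({..<n} - {u, v}) x u v"
  by (cases "u < v") (auto simp: edge_codeg_def edge_def min_def max_def codeg_commute insert_commute)

lemma edge_chaos_edge: "u \<noteq> v \<Longrightarrow> edge_chaos n p x (edge u v) = chaos p ({..<n} - {u, v}) x u v"
  by (cases "u < v") (auto simp: edge_chaos_def edge_def min_def max_def chaos_commute insert_commute)

lemma sum_touching_edges:
  fixes t :: "nat \<times> nat \<Rightarrow> real"
  assumes "a < b" "b < n"
    and far: "\<And>u v. u < v \<Longrightarrow> v < n \<Longrightarrow> u \<noteq> a \<Longrightarrow> u \<noteq> b \<Longrightarrow> v \<noteq> a \<Longrightarrow> v \<noteq> b \<Longrightarrow> t (u, v) = 0"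
  shows "\<bar>\<Sum>e\<in>pot_edges n. t e\<bar>
    \<le> \<bar>t (a, b)\<bar> + (\<Sum>w\<in>{..<n} - {a, b}. \<bar>t (edge a w)\<bar>) + (\<Sum>w\<in>{..<n} - {a, b}. \<bar>t (edge b w)\<bar>)"
proof -
  define T where "T = {..<n} - {a, b}"
  define E where "E = insert (a, b) (edge a ` T \<union> edge b ` T)"
  have fin: "finite T" unfolding T_def by simp
  have "\<bar>\<Sum>e\<in>pot_edges n. t e\<bar> \<le> (\<Sum>e\<in>pot_edges n. \<bar>t e\<bar>)" by (rule sum_abs)
  also have "\<dots> \<le> (\<Sum>e\<in>E. \<bar>t e\<bar>)"
  proof -
    have "t e = 0" if "e \<in> pot_edges n" "e \<notin> E" for e
    proof -
      obtain u v where e: "e = (u, v)" "u < v" "v < n" using \<open>e \<in> pot_edges n\<close> by (auto simp: pot_edges_def)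
      have nb: "e \<noteq> (a, b)" "\<And>w. w \<in> T \<Longrightarrow> e \<noteq> edge a w" "\<And>w. w \<in> T \<Longrightarrow> e \<noteq> edge b w"
        using that(2) unfolding E_def by auto
      have "u \<noteq> a \<and> u \<noteq> b \<and> v \<noteq> a \<and> v \<noteq> b"
        using nb(1) nb(2)[of u] nb(2)[of v] nb(3)[of u] nb(3)[of v] e assms(1,2)
        by (auto simp: T_def edge_def min_def max_def split: if_splits)
      then show ?thesis using far e by simp
    qed
    then have "(\<Sum>e\<in>pot_edges n. \<bar>t e\<bar>) = (\<Sum>e\<in>pot_edges n \<inter> E. \<bar>t e\<bar>)"
      by (intro sum.mono_neutral_right) auto
    also have "\<dots> \<le> (\<Sum>e\<in>E. \<bar>t e\<bar>)"
      using fin by (intro sum_mono2) (auto simp: E_def)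
    finally show ?thesis .
  qed
  also have "\<dots> \<le> \<bar>t (a, b)\<bar> + (\<Sum>e\<in>edge a ` T \<union> edge b ` T. \<bar>t e\<bar>)"
    unfolding E_def using fin by (subst sum.insert_if) auto
  also have "(\<Sum>e\<in>edge a ` T \<union> edge b ` T. \<bar>t e\<bar>) \<le> (\<Sum>e\<in>edge a ` T. \<bar>t e\<bar>) + (\<Sum>e\<in>edge b ` T. \<bar>t e\<bar>)"
    using fin by (subst sum_Un) (auto intro!: sum_nonneg)
  also have "(\<Sum>e\<in>edge a ` T. \<bar>t e\<bar>) = (\<Sum>w\<in>T. \<bar>t (edge a w)\<bar>)"
    by (subst sum.reindex) (auto simp: inj_on_def edge_eq_iff)
  also have "(\<Sum>e\<in>edge b ` T. \<bar>t e\<bar>) = (\<Sum>w\<in>T. \<bar>t (edge b w)\<bar>)"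
    by (subst sum.reindex) (auto simp: inj_on_def edge_eq_iff)
  finally show ?thesis unfolding T_def by simp
qed

lemma edge_codeg_far:
  assumes "u < v" "u \<noteq> a" "u \<noteq> b" "v \<noteq> a" "v \<noteq> b" "a < b"
  shows "edge_codeg n (x((a, b) := t)) (u, v) = edge_codeg n x (u, v)"
    and "edge_chaos n p (x((a, b) := t)) (u, v) = edge_chaos n p x (u, v)"
proof -
  have ab: "(a, b) = edge a b" using assms by simp
  show "edge_codeg n (x((a, b) := t)) (u, v) = edge_codeg n x (u, v)"
    unfolding edge_codeg_def by (rule codeg_upd) (use assms in \<open>auto simp: ab edge_eq_iff simp del: edge_less\<close>)
  show "edge_chaos n p (x((a, b) := t)) (u, v) = edge_chaos n p x (u, v)"
    unfolding edge_chaos_def by (rule chaos_upd) (use assms in \<open>auto simp: ab edge_eq_iff simp del: edge_less\<close>)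
qed

text \<open>The edge \<open>aw\<close> sees the flipped edge \<open>ab\<close> only through the
  third vertex \<open>b\<close>; splitting \<open>b\<close> off leaves a part on \<open>S\<close>
  that the flip does not touch. The order of \<open>a\<close> and \<open>b\<close> is left open, so
  the lemma serves both endpoints.\<close>

lemma near_edge:
  assumes "a < n" "b < n" "a \<noteq> b" "w < n" "w \<noteq> a" "w \<noteq> b"
  defines "S \<equiv> {..<n} - {a, b, w}"
  shows "edge_codeg n (x(edge a b := t)) (edge a w) = codeg S x a w + of_bool (t \<and> x (edge b w))"
    and "edge_chaos n p (x(edge a b := t)) (edge a w)
       = chaos p S x a w + (of_bool t * adj x b w / 3 + p * (of_bool t + adj x b w) / 6 + p\<^sup>2 / 3)"
proof -
  have Sw: "{..<n} - {a, w} = insert b S" and b: "b \<notin> S" "finite S"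
    using assms by (auto simp: S_def)
  have u1: "codeg S (x(edge a b := t)) a w = codeg S x a w"
    by (rule codeg_upd) (use assms in \<open>auto simp: S_def edge_eq_iff\<close>)
  have u2: "chaos p S (x(edge a b := t)) a w = chaos p S x a w"
    by (rule chaos_upd) (use assms in \<open>auto simp: S_def edge_eq_iff\<close>)
  have e: "edge w b \<noteq> edge a b" "edge b w \<noteq> edge a b" using assms by (auto simp: edge_eq_iff)
  show "edge_codeg n (x(edge a b := t)) (edge a w) = codeg S x a w + of_bool (t \<and> x (edge b w))"
    using assms e u1 b by (simp add: edge_codeg_edge Sw codeg_insert edge_commute[of w b])
  have "chaos p (insert b S) (x(edge a b := t)) a w = chaos p S (x(edge a b := t)) a w
     + (adj (x(edge a b := t)) a b * adj (x(edge a b := t)) w b / 3 + p * (adj (x(edge a b := t)) a b + adj (x(edge a b := t)) w b) / 6 + p\<^sup>2 / 3)"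
    using b by (simp add: chaos_def)
  also have "adj (x(edge a b := t)) a b = of_bool t" by (simp add: adj_upd)
  also have "adj (x(edge a b := t)) w b = adj x b w" using e by (simp add: adj_upd adj_commute)
  finally show "edge_chaos n p (x(edge a b := t)) (edge a w)
       = chaos p S x a w + (of_bool t * adj x b w / 3 + p * (of_bool t + adj x b w) / 6 + p\<^sup>2 / 3)"
    unfolding edge_chaos_edge[OF assms(5)[symmetric]] Sw u2 .
qed

text \<open>Flipping an edge \<open>f\<close> changes only the summands of \<open>f\<close> itself and of the edges meeting \<open>f\<close> in one vertex.\<close>

lemma edge_sum_diff_le_influence:
  fixes \<phi> :: "(nat \<times> nat \<Rightarrow> bool) \<Rightarrow> nat \<times> nat \<Rightarrow> real"
  assumes "0 \<le> c" "f \<in> pot_edges n"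
    and far: "\<And>a b u v t. a < b \<Longrightarrow> u < v \<Longrightarrow> v < n \<Longrightarrow> u \<noteq> a \<Longrightarrow> u \<noteq> b \<Longrightarrow> v \<noteq> a \<Longrightarrow> v \<noteq> b
        \<Longrightarrow> \<phi> (x((a, b) := t)) (u, v) = \<phi> x (u, v)"
    and own: "\<And>a b. a < b \<Longrightarrow> b < n \<Longrightarrow>
        \<bar>\<phi> (x((a, b) := True)) (a, b) - \<phi> (x((a, b) := False)) (a, b)\<bar> \<le> c * growth p ({..<n} - {a, b}) x a b"
    and near: "\<And>a b w. a < n \<Longrightarrow> b < n \<Longrightarrow> w < n \<Longrightarrow> a \<noteq> b \<Longrightarrow> w \<noteq> a \<Longrightarrow> w \<noteq> b \<Longrightarrow>
        \<bar>\<phi> (x(edge a b := True)) (edge a w) - \<phi> (x(edge a b := False)) (edge a w)\<bar>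
          \<le> c * ((adj x b w + p) * growth p ({..<n} - {a, b, w}) x a w)"
  shows "\<bar>(\<Sum>e\<in>pot_edges n. \<phi> (x(f := True)) e) - (\<Sum>e\<in>pot_edges n. \<phi> (x(f := False)) e)\<bar> \<le> c * influence n p f x"
proof -
  obtain a b where f: "f = (a, b)" "a < b" "b < n" using assms(2) by (auto simp: pot_edges_def)
  have fe: "f = edge a b" "f = edge b a" using f by (auto simp: edge_def)
  define t where "t = (\<lambda>e. \<phi> (x(f := True)) e - \<phi> (x(f := False)) e)"
  define T where "T = {..<n} - {a, b}"
  have "\<bar>(\<Sum>e\<in>pot_edges n. t e)\<bar> \<le> \<bar>t (a, b)\<bar> + (\<Sum>w\<in>T. \<bar>t (edge a w)\<bar>) + (\<Sum>w\<in>T. \<bar>t (edge b w)\<bar>)"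
    unfolding T_def
  proof (rule sum_touching_edges)
    fix u v assume "u < v" "v < n" "u \<noteq> a" "u \<noteq> b" "v \<noteq> a" "v \<noteq> b"
    then show "t (u, v) = 0" unfolding t_def f(1) using far[of a b u v] f(2) by simp
  qed (use f in auto)
  also have "\<dots> \<le> c * growth p T x a b + (\<Sum>w\<in>T. c * ((adj x b w + p) * growth p ({..<n} - {a, b, w}) x a w))
      + (\<Sum>w\<in>T. c * ((adj x a w + p) * growth p ({..<n} - {b, a, w}) x b w))"
  proof (intro add_mono sum_mono)
    show "\<bar>t (a, b)\<bar> \<le> c * growth p T x a b" unfolding t_def T_def f(1) using own f by simp
    fix w assume w: "w \<in> T"
    show "\<bar>t (edge a w)\<bar> \<le> c * ((adj x b w + p) * growth p ({..<n} - {a, b, w}) x a w)"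
      unfolding t_def fe(1) by (rule near) (use w f in \<open>auto simp: T_def\<close>)
    show "\<bar>t (edge b w)\<bar> \<le> c * ((adj x a w + p) * growth p ({..<n} - {b, a, w}) x b w)"
      unfolding t_def fe(2) by (rule near) (use w f in \<open>auto simp: T_def\<close>)
  qed
  also have "\<dots> = c * influence n p f x"
    unfolding influence_def f(1) T_def by (simp add: sum_distrib_left distrib_left insert_commute)
  finally show ?thesis by (simp add: t_def sum_subtractf)
qed

lemma level_diff_le:
  assumes "f \<in> pot_edges n"
  shows "\<bar>level n p i (x(f := True)) - level n p i (x(f := False))\<bar> \<le> (1 / 2) ^ i * influence n p f x"
  unfolding level_def
proof (rule edge_sum_diff_le_influence)
  \<comment> \<open>The source of the factor \<open>(1 / 2) ^ i\<close>. The condition is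
    \<open>i \<le> c\<close> because a new third vertex turns \<open>i < c\<close> into
    \<open>i < c + 1\<close>.\<close>
  have ind: "of_bool (i \<le> c) \<le> (1 / 2 :: real) ^ i * 2 ^ c" for c
  proof (cases "i \<le> c")
    case True
    then have "(2 :: real) ^ i \<le> 2 ^ c" by (intro power_increasing) auto
    then show ?thesis by (simp add: power_one_over field_simps)
  qed simp
  {
    fix a b assume ab: "a < b" "b < n"
    let ?S = "{..<n} - {a, b}"
    have e: "(a, b) \<in> pot_edges n" using ab by (simp add: pot_edges_def)
    have "edge_chaos n p x (a, b) * of_bool (i < edge_codeg n x (a, b)) \<le> (2 + chaos p ?S x a b) * ((1 / 2) ^ i * 2 ^ codeg ?S x a b)"
      using order_trans[OF _ ind[of "codeg ?S x a b"], of "of_bool (i < codeg ?S x a b)"] prob01 chaos_nonneg[of p ?S x a b]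
      by (intro mult_mono) (auto simp: edge_chaos_def edge_codeg_def)
    moreover have "0 \<le> edge_chaos n p x (a, b) * of_bool (i < edge_codeg n x (a, b))"
      using prob01 by (auto simp: edge_chaos_def chaos_nonneg)
    ultimately show "\<bar>absent (x((a, b) := True)) (a, b) * edge_chaos n p (x((a, b) := True)) (a, b) * of_bool (i < edge_codeg n (x((a, b) := True)) (a, b))
      - absent (x((a, b) := False)) (a, b) * edge_chaos n p (x((a, b) := False)) (a, b) * of_bool (i < edge_codeg n (x((a, b) := False)) (a, b))\<bar>
      \<le> (1 / 2) ^ i * growth p ?S x a b"
      using e by (simp add: absent_def growth_def ac_simps)
  }
  {
    fix a b w assume h: "a < n" "b < n" "w < n" "a \<noteq> b" "w \<noteq> a" "w \<noteq> b"
    let ?S = "{..<n} - {a, b, w}"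
    define \<alpha> where "\<alpha> = absent x (edge a w)"
    have ab: "absent (x(edge a b := t)) (edge a w) = \<alpha>" for t
      using h by (auto simp: absent_def \<alpha>_def edge_eq_iff)
    have \<alpha>: "0 \<le> \<alpha>" "\<alpha> \<le> 1" by (auto simp: \<alpha>_def absent_def)
    define c where "c = codeg ?S x a w"
    define h' where "h' = chaos p ?S x a w"
    define B where "B = of_bool (x (edge b w)) * (1 / 3 + p / 6)"
    have h0: "0 \<le> h'" unfolding h'_def using prob01 by (simp add: chaos_nonneg)
    have p2: "p\<^sup>2 \<le> 1" using prob01 by (simp add: power_le_one)
    note near = near_edge[OF h(1,2,4,3,5,6)]
    have "\<bar>edge_chaos n p (x(edge a b := True)) (edge a w) * of_bool (i < edge_codeg n (x(edge a b := True)) (edge a w))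
         - edge_chaos n p (x(edge a b := False)) (edge a w) * of_bool (i < edge_codeg n (x(edge a b := False)) (edge a w))\<bar>
      \<le> (adj x b w + p) * ((2 + h') * of_bool (i \<le> c))"
    \<comment> \<open>If \<open>bw\<close> is present, the weight is at least 1 and the whole
      summand may change; if not, only the chaos changes, by \<open>p / 6\<close>.\<close>
    proof (cases "x (edge b w)")
      case True
      have hp: "0 \<le> h' * p" using h0 prob01 by simp
      show ?thesis unfolding near c_def[symmetric] h'_def[symmetric] using True h0 prob01 p2 p_half
        by (auto simp: adj_def of_bool_def abs_if algebra_simps; insert hp h0; linarith)
    next
      case False
      have hp: "0 \<le> h' * p" using h0 prob01 by simp
      show ?thesis unfolding near c_def[symmetric] h'_def[symmetric] using False h0 prob01 p2 p_half
        by (auto simp: adj_def of_bool_def abs_if algebra_simps; insert hp h0; linarith)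
    qed
    also have "\<dots> \<le> (adj x b w + p) * ((2 + h') * ((1 / 2) ^ i * 2 ^ c))"
      using ind[of c] h0 prob01 by (intro mult_left_mono) auto
    finally have *: "\<bar>edge_chaos n p (x(edge a b := True)) (edge a w) * of_bool (i < edge_codeg n (x(edge a b := True)) (edge a w))
         - edge_chaos n p (x(edge a b := False)) (edge a w) * of_bool (i < edge_codeg n (x(edge a b := False)) (edge a w))\<bar>
      \<le> (1 / 2) ^ i * ((adj x b w + p) * growth p ?S x a w)"
      by (simp add: growth_def c_def h'_def ac_simps)
    show "\<bar>absent (x(edge a b := True)) (edge a w) * edge_chaos n p (x(edge a b := True)) (edge a w) * of_bool (i < edge_codeg n (x(edge a b := True)) (edge a w))
         - absent (x(edge a b := False)) (edge a w) * edge_chaos n p (x(edge a b := False)) (edge a w) * of_bool (i < edge_codeg n (x(edge a b := False)) (edge a w))\<bar>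
      \<le> (1 / 2) ^ i * ((adj x b w + p) * growth p ?S x a w)"
      unfolding ab mult.assoc right_diff_distrib[symmetric] abs_mult
      using mult_left_le_one_le[OF abs_ge_zero, of "\<bar>\<alpha>\<bar>"] \<alpha> * by (smt (verit, best) abs_ge_zero mult_left_le_one_le)
  }
  {
    fix a b u v :: nat and t assume h: "a < b" "u < v" "v < n" "u \<noteq> a" "u \<noteq> b" "v \<noteq> a" "v \<noteq> b"
    have "absent (x((a, b) := t)) (u, v) = absent x (u, v)" using h by (simp add: absent_def)
    then show "absent (x((a, b) := t)) (u, v) * edge_chaos n p (x((a, b) := t)) (u, v) * of_bool (i < edge_codeg n (x((a, b) := t)) (u, v))
        = absent x (u, v) * edge_chaos n p x (u, v) * of_bool (i < edge_codeg n x (u, v))"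
      by (simp only: edge_codeg_far[OF h(2,4-7,1)])
  }
qed (use assms in simp_all)

text \<open>Together with \<open>unit_present\<close> this counts the edges whose flip changes the
  triangle count by exactly one, separated by their state.\<close>

definition unit_absent :: "(nat \<times> nat \<Rightarrow> bool) \<Rightarrow> real" where
  "unit_absent x = (\<Sum>e\<in>pot_edges n. absent x e * of_bool (edge_codeg n x e = 1))"

definition unit_present :: "(nat \<times> nat \<Rightarrow> bool) \<Rightarrow> real" where
  "unit_present x = (\<Sum>e\<in>pot_edges n. of_bool (x e) * of_bool (edge_codeg n x e = 1))"

lemma unit_absent_diff_le:
  assumes "f \<in> pot_edges n"
  shows "\<bar>unit_absent (x(f := True)) - unit_absent (x(f := False))\<bar> \<le> 1 * influence n p f x"
  unfolding unit_absent_def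
proof (rule edge_sum_diff_le_influence)
  {
    fix a b assume ab: "a < b" "b < n"
    have e: "(a, b) \<in> pot_edges n" using ab by (simp add: pot_edges_def)
    show "\<bar>absent (x((a, b) := True)) (a, b) * of_bool (edge_codeg n (x((a, b) := True)) (a, b) = 1)
      - absent (x((a, b) := False)) (a, b) * of_bool (edge_codeg n (x((a, b) := False)) (a, b) = 1)\<bar>
      \<le> 1 * growth p ({..<n} - {a, b}) x a b"
      using e growth_ge_1[of p "{..<n} - {a, b}" x a b] prob01 by (auto simp: absent_def)
  }
  {
    fix a b w assume h: "a < n" "b < n" "w < n" "a \<noteq> b" "w \<noteq> a" "w \<noteq> b"
    let ?S = "{..<n} - {a, b, w}"
    have ab: "absent (x(edge a b := t)) (edge a w) = absent x (edge a w)" for t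
      using h by (auto simp: absent_def edge_eq_iff)
    note near = near_edge[OF h(1,2,4,3,5,6)]
    have "\<bar>absent (x(edge a b := True)) (edge a w) * of_bool (edge_codeg n (x(edge a b := True)) (edge a w) = 1)
         - absent (x(edge a b := False)) (edge a w) * of_bool (edge_codeg n (x(edge a b := False)) (edge a w) = 1)\<bar>
      \<le> (adj x b w + p) * 1"
      unfolding ab near using prob01 by (auto simp: adj_def absent_def of_bool_def)
    also have "\<dots> \<le> (adj x b w + p) * growth p ?S x a w"
      using growth_ge_1[of p ?S x a w] prob01 by (intro mult_left_mono) auto
    finally show "\<bar>absent (x(edge a b := True)) (edge a w) * of_bool (edge_codeg n (x(edge a b := True)) (edge a w) = 1)
         - absent (x(edge a b := False)) (edge a w) * of_bool (edge_codeg n (x(edge a b := False)) (edge a w) = 1)\<bar>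
      \<le> 1 * ((adj x b w + p) * growth p ?S x a w)" by simp
  }
  {
    fix a b u v :: nat and t assume h: "a < b" "u < v" "v < n" "u \<noteq> a" "u \<noteq> b" "v \<noteq> a" "v \<noteq> b"
    have "absent (x((a, b) := t)) (u, v) = absent x (u, v)" using h by (simp add: absent_def)
    then show "absent (x((a, b) := t)) (u, v) * of_bool (edge_codeg n (x((a, b) := t)) (u, v) = 1)
        = absent x (u, v) * of_bool (edge_codeg n x (u, v) = 1)"
      by (simp only: edge_codeg_far[OF h(2,4-7,1)])
  }
qed (use assms in simp_all)

text \<open>Besides \<open>f\<close> itself, only the other two sides of the triangles over
  \<open>f\<close> matter: \<open>aw\<close> counts only if present, and its codegree moves only if
  \<open>bw\<close> is present. This is sharper than \<open>influence\<close>, as required because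
  \<open>smoothness\<close> weights \<open>unit_present\<close> by \<open>1 - p\<close> and not by
  \<open>p\<close>.\<close>

lemma unit_present_diff_le:
  assumes "f \<in> pot_edges n"
  shows "\<bar>unit_present (x(f := True)) - unit_present (x(f := False))\<bar> \<le> 3 * real (edge_codeg n x f)"
proof -
  obtain a b where f: "f = (a, b)" "a < b" "b < n" using assms by (auto simp: pot_edges_def)
  have fe: "f = edge a b" "f = edge b a" using f by (auto simp: edge_def)
  define t where "t = (\<lambda>e. of_bool ((x(f := True)) e) * of_bool (edge_codeg n (x(f := True)) e = 1)
     - of_bool ((x(f := False)) e) * (of_bool (edge_codeg n (x(f := False)) e = 1) :: real))"
  define T where "T = {..<n} - {a, b}"
  have near: "\<bar>of_bool ((x(edge a b := True)) (edge a w)) * of_bool (edge_codeg n (x(edge a b := True)) (edge a w) = 1)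
     - of_bool ((x(edge a b := False)) (edge a w)) * (of_bool (edge_codeg n (x(edge a b := False)) (edge a w) = 1) :: real)\<bar>
     \<le> adj x a w * adj x b w"
    if h: "a < n" "b < n" "w < n" "a \<noteq> b" "w \<noteq> a" "w \<noteq> b" for a b w
  proof -
    have "edge a w \<noteq> edge a b" using h by (auto simp: edge_eq_iff)
    then show ?thesis
      unfolding near_edge[OF h(1,2,4,3,5,6)] by (auto simp: adj_def of_bool_def)
  qed
  have "\<bar>(\<Sum>e\<in>pot_edges n. t e)\<bar> \<le> \<bar>t (a, b)\<bar> + (\<Sum>w\<in>T. \<bar>t (edge a w)\<bar>) + (\<Sum>w\<in>T. \<bar>t (edge b w)\<bar>)"
    unfolding T_def
  proof (rule sum_touching_edges)
    fix u v assume "u < v" "v < n" "u \<noteq> a" "u \<noteq> b" "v \<noteq> a" "v \<noteq> b"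
    then show "t (u, v) = 0" unfolding t_def f(1) using f(2) by (simp add: edge_codeg_far)
  qed (use f in auto)
  also have "\<dots> \<le> real (edge_codeg n x f) + (\<Sum>w\<in>T. adj x a w * adj x b w) + (\<Sum>w\<in>T. adj x b w * adj x a w)"
  proof (intro add_mono sum_mono)
    show "\<bar>t (a, b)\<bar> \<le> real (edge_codeg n x f)" using assms by (auto simp: t_def f(1))
    fix w assume w: "w \<in> T"
    show "\<bar>t (edge a w)\<bar> \<le> adj x a w * adj x b w"
      unfolding t_def fe(1) by (rule near) (use w f in \<open>auto simp: T_def\<close>)
    show "\<bar>t (edge b w)\<bar> \<le> adj x b w * adj x a w"
      unfolding t_def fe(2) by (rule near) (use w f in \<open>auto simp: T_def\<close>)
  qed
  also have "(\<Sum>w\<in>T. adj x b w * adj x a w) = (\<Sum>w\<in>T. adj x a w * adj x b w)"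
    by (simp add: mult.commute)
  also have "(\<Sum>w\<in>T. adj x a w * adj x b w) = real (edge_codeg n x f)"
    by (simp add: edge_codeg_def f(1) T_def real_codeg)
  finally show ?thesis by (simp add: unit_present_def t_def sum_subtractf)
qed

end

section \<open>Smoothness and Stein approximation\<close>

context tri_regime
begin

lemma Ex_edge_codeg_power_le:
  assumes "e \<in> pot_edges n" "0 < k"
  shows "Ex (\<lambda>x. real (edge_codeg n x e) ^ k) \<le> 2 ^ k * exp (2 ^ k * L) * (real n * p\<^sup>2)"
  unfolding edge_codeg_def by (rule Ex_codeg_power_le) (use assms in \<open>auto simp: pot_edges_def\<close>)

lemma Ex_edge_codeg:
  assumes "e \<in> pot_edges n"
  shows "Ex (\<lambda>x. real (edge_codeg n x e)) = (real n - 2) * p\<^sup>2"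
proof -
  obtain a b where e: "e = (a, b)" "a < b" "b < n" using assms by (auto simp: pot_edges_def)
  have pair: "Ex (\<lambda>x. adj x a k * adj x b k) = p\<^sup>2" if "k \<in> {..<n} - {a, b}" for k
    using Ex_pair_mult[of a b k "\<lambda>_. 1"] that e by auto
  have "Ex (\<lambda>x. real (edge_codeg n x e)) = (\<Sum>k\<in>{..<n} - {a, b}. p\<^sup>2)"
    by (simp add: edge_codeg_def e(1) real_codeg Ex_sum pair)
  also have "\<dots> = (real n - 2) * p\<^sup>2"
    using e n4 by (simp add: card_Diff_subset)
  finally show ?thesis .
qed

lemma var_unit_present_le: "Ex (\<lambda>x. (unit_present x - Ex unit_present)\<^sup>2) \<le> 36 * exp (4 * L) * (real n * p) ^ 3"
proof -
  have "Ex (\<lambda>x. (unit_present x - Ex unit_present)\<^sup>2)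
      \<le> p * (\<Sum>f\<in>pot_edges n. Ex (\<lambda>x. (unit_present (x(f := True)) - unit_present (x(f := False)))\<^sup>2))"
    by (rule Efron_Stein_bernoulli) (use prob01 in auto)
  also have "\<dots> \<le> p * (\<Sum>f\<in>pot_edges n. 36 * exp (4 * L) * (real n * p\<^sup>2))"
  proof (intro mult_left_mono sum_mono)
    fix f assume f: "f \<in> pot_edges n"
    have "Ex (\<lambda>x. (unit_present (x(f := True)) - unit_present (x(f := False)))\<^sup>2) \<le> Ex (\<lambda>x. 9 * real (edge_codeg n x f) ^ 2)"
    proof (rule Ex_mono)
      fix x
      have "\<bar>unit_present (x(f := True)) - unit_present (x(f := False))\<bar>\<^sup>2 \<le> (3 * real (edge_codeg n x f))\<^sup>2"
        using unit_present_diff_le[OF f, of x] by (intro power_mono) auto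
      then show "(unit_present (x(f := True)) - unit_present (x(f := False)))\<^sup>2 \<le> 9 * real (edge_codeg n x f) ^ 2"
        by (simp add: power_mult_distrib)
    qed
    also have "\<dots> \<le> 36 * exp (4 * L) * (real n * p\<^sup>2)"
      using Ex_edge_codeg_power_le[OF f, of 2] by (simp add: Ex_cmult ac_simps)
    finally show "Ex (\<lambda>x. (unit_present (x(f := True)) - unit_present (x(f := False)))\<^sup>2) \<le> 36 * exp (4 * L) * (real n * p\<^sup>2)" .
  qed (use prob01 in auto)
  also have "\<dots> = real (card (pot_edges n)) * (p * (36 * exp (4 * L) * (real n * p\<^sup>2)))"
    by (simp add: ac_simps)
  also have "\<dots> \<le> (real n)\<^sup>2 * (p * (36 * exp (4 * L) * (real n * p\<^sup>2)))"
    using card_pot_edges_le prob01 by (intro mult_right_mono) auto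
  also have "\<dots> = 36 * exp (4 * L) * (real n * p) ^ 3"
    by (simp add: power2_eq_square power3_eq_cube ac_simps)
  finally show ?thesis .
qed

text \<open>Detailed balance: the two states of an edge have odds \<open>p : 1 - p\<close>, and
  toggling an edge of codegree one shifts \<open>W\<close> by one.\<close>

lemma Ex_unit_absent_unit_present:
  fixes f :: "int \<Rightarrow> real"
  shows "(1 - p) * Ex (\<lambda>x. unit_present x * f (W x)) = p * Ex (\<lambda>x. unit_absent x * f (W x + 1))"
proof -
  have "(1 - p) * Ex (\<lambda>x. of_bool (x e) * of_bool (edge_codeg n x e = 1) * f (W x))
      = p * Ex (\<lambda>x. absent x e * of_bool (edge_codeg n x e = 1) * f (W x + 1))" if e: "e \<in> pot_edges n" for e
  proof -
    define h where "h = Ex (\<lambda>x. of_bool (edge_codeg n x e = 1) * f (W (x(e := False)) + 1))"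
    have "Ex (\<lambda>x. of_bool (x e) * of_bool (edge_codeg n x e = 1) * f (W x)) = p * h"
      unfolding h_def
      by (subst Ex_resample[OF e])
         (auto simp: e triangles_upd' of_bool_def intro!: arg_cong[where f = Ex] disjI2)
    moreover have "Ex (\<lambda>x. absent x e * of_bool (edge_codeg n x e = 1) * f (W x + 1)) = (1 - p) * h"
      unfolding h_def
      by (subst Ex_resample[OF e]) (simp add: e absent_def)
    ultimately show ?thesis by simp
  qed
  then show ?thesis
    by (simp add: unit_absent_def unit_present_def sum_distrib_right sum_distrib_left Ex_sum
        del: sum_of_bool_mult_eq sum_mult_of_bool_eq)
qed

definition unit_rate :: real where "unit_rate = p * Ex unit_absent"

lemma unit_rate_eq: "unit_rate = (1 - p) * Ex unit_present"
  using Ex_unit_absent_unit_present[of "\<lambda>_. 1"] by (simp add: unit_rate_def)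

lemma unit_rate_ge: "exp (- 2 * L) / 16 * (real n * p) ^ 3 \<le> unit_rate"
proof -
  have p2: "0 \<le> p\<^sup>2" "p\<^sup>2 \<le> 1 / 2" 
    using prob01 p_half mult_mono[of p "1/2" p "1/2"] by (auto simp: power2_eq_square)
  \<comment> \<open>For \<open>p^2 \<le> 1 / 2\<close> the product
    \<open>(1 - p^2) * (1 + 2 * p^2)\<close> is at least 1, so a lower bound on powers of
    \<open>1 - p^2\<close> follows from an upper bound on powers of
    \<open>1 + 2 * p^2\<close>.\<close>
  have ep: "exp (- 2 * L) \<le> (1 - p\<^sup>2) ^ m" if "m \<le> n" for m
  proof -
    have "(1 + 2 * p\<^sup>2) ^ m \<le> exp (2 * L)"
      using np2 that p2 mult_right_mono[of "real m" "real n" "p\<^sup>2"] by (intro one_add_power_le_exp) auto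
    moreover have "1 \<le> ((1 - p\<^sup>2) * (1 + 2 * p\<^sup>2)) ^ m"
    proof (rule one_le_power)
      have "0 \<le> p\<^sup>2 * (1 - 2 * p\<^sup>2)" using p2 by simp
      then show "1 \<le> (1 - p\<^sup>2) * (1 + 2 * p\<^sup>2)" by (simp add: algebra_simps)
    qed
    moreover have "(1 - p\<^sup>2) ^ m * (1 + 2 * p\<^sup>2) ^ m \<le> (1 - p\<^sup>2) ^ m * exp (2 * L)"
      using calculation(1) p2 by (intro mult_left_mono) auto
    ultimately have "1 \<le> (1 - p\<^sup>2) ^ m * exp (2 * L)"
      by (simp add: power_mult_distrib)
    then show ?thesis by (simp add: exp_minus field_simps)
  qed
  have one: "exp (- 2 * L) / 4 * (real n * p\<^sup>2) \<le> Ex (\<lambda>x. absent x e * of_bool (edge_codeg n x e = 1))"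
    if e: "e \<in> pot_edges n" for e
  proof -
    obtain a b where ab: "e = (a, b)" "a < b" "b < n" using e by (auto simp: pot_edges_def)
    let ?S = "{..<n} - {a, b}"
    have c: "real (card ?S) = real n - 2" "card ?S \<le> n" using ab n4 by (auto simp: card_Diff_subset)
    have "(real n / 2) * p\<^sup>2 * exp (- 2 * L) \<le> (real n - 2) * p\<^sup>2 * (1 - p\<^sup>2) ^ card ?S"
      using ep[OF c(2)] n4 by (intro mult_mono) auto
    also have "\<dots> \<le> Ex (\<lambda>x. of_bool (codeg ?S x a b = 1))"
      using Ex_codeg_eq_1[of a b ?S] ab c by simp
    finally have "(real n / 2) * p\<^sup>2 * exp (- 2 * L) \<le> Ex (\<lambda>x. of_bool (edge_codeg n x e = 1))"
      by (simp add: edge_codeg_def ab(1))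
    then have "(1 / 2) * ((real n / 2) * p\<^sup>2 * exp (- 2 * L)) \<le> (1 - p) * Ex (\<lambda>x. of_bool (edge_codeg n x e = 1))"
      using p_half by (intro mult_mono) (auto intro: Ex_nonneg)
    also have "\<dots> = Ex (\<lambda>x. absent x e * of_bool (edge_codeg n x e = 1))"
      unfolding absent_def by (rule Ex_nonedge_mult[symmetric]) (use e in auto)
    finally show ?thesis by (simp add: ac_simps)
  qed
  have "exp (- 2 * L) / 16 * (real n * p) ^ 3 = p * ((real n)\<^sup>2 / 4 * (exp (- 2 * L) / 4 * (real n * p\<^sup>2)))"
    by (simp add: power2_eq_square power3_eq_cube)
  also have "\<dots> \<le> p * (real (card (pot_edges n)) * (exp (- 2 * L) / 4 * (real n * p\<^sup>2)))"
    using card_pot_edges_ge prob01 by (intro mult_left_mono mult_right_mono) auto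
  also have "\<dots> = p * (\<Sum>e\<in>pot_edges n. exp (- 2 * L) / 4 * (real n * p\<^sup>2))" by simp
  also have "\<dots> \<le> p * (\<Sum>e\<in>pot_edges n. Ex (\<lambda>x. absent x e * of_bool (edge_codeg n x e = 1)))"
    using prob01 one by (intro mult_left_mono sum_mono) auto
  also have "\<dots> = unit_rate" unfolding unit_rate_def unit_absent_def
    by (simp add: Ex_sum del: sum_of_bool_mult_eq sum_mult_of_bool_eq)
  finally show ?thesis .
qed

text \<open>The explicit order of the variance, by \<open>variance_le\<close> and
  \<open>variance_ge\<close>; error bounds are stated in terms of it.\<close>

definition scale :: real where "scale = (real n * p) ^ 3"

lemma scale_ge_1: "1 \<le> scale" unfolding scale_def using np1 by (rule one_le_power)

lemma scale_pos: "0 < scale" using scale_ge_1 by simp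

lemma unit_rate_pos: "0 < unit_rate"
  using unit_rate_ge scale_pos unfolding scale_def by (meson divide_pos_pos exp_gt_zero less_le_trans mult_pos_pos zero_less_numeral)

definition C_sd :: real where "C_sd = sqrt (51 * C_growth * L)"

definition C_smooth :: real where "C_smooth = 16 * exp (2 * L) * (C_sd + 6 * exp (2 * L))"

lemma C_sd_nonneg: "0 \<le> C_sd" unfolding C_sd_def using C_growth_nonneg L_nonneg by simp

lemma C_smooth_nonneg: "0 \<le> C_smooth" unfolding C_smooth_def using C_sd_nonneg by simp

lemma Ex_centered_bound:
  assumes "Ex (\<lambda>x. (F x - Ex F)\<^sup>2) \<le> V" "Ex (\<lambda>x. (G x)\<^sup>2) \<le> \<theta>\<^sup>2" "0 \<le> \<theta>"
  shows "\<bar>Ex (\<lambda>x. (F x - Ex F) * G x)\<bar> \<le> sqrt V * \<theta>"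
proof -
  have "\<bar>Ex (\<lambda>x. (F x - Ex F) * G x)\<bar> \<le> sqrt (Ex (\<lambda>x. (F x - Ex F)\<^sup>2)) * sqrt (Ex (\<lambda>x. (G x)\<^sup>2))"
    by (rule Ex_Cauchy_Schwarz)
  also have "\<dots> \<le> sqrt V * sqrt (\<theta>\<^sup>2)"
    using assms by (intro mult_mono real_sqrt_le_mono real_sqrt_ge_zero) (auto intro!: Ex_nonneg order_trans[OF Ex_nonneg assms(1)])
  finally show ?thesis using assms(3) by simp
qed

lemma sqrt_p2_n3p: "p * sqrt (c * (real n ^ 3 * p)) = sqrt c * sqrt scale"
proof -
  have "p * sqrt (c * (real n ^ 3 * p)) = sqrt (p\<^sup>2) * sqrt (c * (real n ^ 3 * p))"
    using prob01 by simp
  also have "\<dots> = sqrt (c * scale)"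
    unfolding real_sqrt_mult[symmetric] scale_def
    by (intro arg_cong[where f = sqrt]) (simp add: power2_eq_square power3_eq_cube)
  finally show ?thesis by (simp add: real_sqrt_mult)
qed

text \<open>Centring both sides of \<open>Ex_unit_absent_unit_present\<close> expresses
  \<open>unit_rate\<close> times the difference by two covariances. By Cauchy--Schwarz each is
  \<open>O(sqrt scale * \<theta>)\<close>, while \<open>unit_rate\<close> is at least of order
  \<open>scale\<close>.\<close>

lemma smoothness:
  fixes f :: "int \<Rightarrow> real"
  assumes "Ex (\<lambda>x. (f (W x + 1))\<^sup>2) \<le> \<theta>\<^sup>2" "Ex (\<lambda>x. (f (W x))\<^sup>2) \<le> \<theta>\<^sup>2" "0 \<le> \<theta>"
  shows "\<bar>Ex (\<lambda>x. f (W x + 1)) - Ex (\<lambda>x. f (W x))\<bar> \<le> C_smooth * \<theta> / sqrt scale"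
proof -
  define d where "d = Ex (\<lambda>x. f (W x + 1)) - Ex (\<lambda>x. f (W x))"
  have i1: "Ex (\<lambda>x. (unit_absent x - Ex unit_absent) * f (W x + 1)) = Ex (\<lambda>x. unit_absent x * f (W x + 1)) - Ex unit_absent * Ex (\<lambda>x. f (W x + 1))"
    by (simp add: left_diff_distrib Ex_diff Ex_cmult)
  have i2: "Ex (\<lambda>x. (unit_present x - Ex unit_present) * f (W x)) = Ex (\<lambda>x. unit_present x * f (W x)) - Ex unit_present * Ex (\<lambda>x. f (W x))"
    by (simp add: left_diff_distrib Ex_diff Ex_cmult)
  have "unit_rate * d = (1 - p) * Ex (\<lambda>x. (unit_present x - Ex unit_present) * f (W x)) - p * Ex (\<lambda>x. (unit_absent x - Ex unit_absent) * f (W x + 1))"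
  proof -
    have "(1 - p) * Ex (\<lambda>x. (unit_present x - Ex unit_present) * f (W x)) = p * Ex (\<lambda>x. unit_absent x * f (W x + 1)) - unit_rate * Ex (\<lambda>x. f (W x))"
      unfolding i2 right_diff_distrib Ex_unit_absent_unit_present unit_rate_eq by simp
    moreover have "p * Ex (\<lambda>x. (unit_absent x - Ex unit_absent) * f (W x + 1)) = p * Ex (\<lambda>x. unit_absent x * f (W x + 1)) - unit_rate * Ex (\<lambda>x. f (W x + 1))"
      unfolding i1 right_diff_distrib unit_rate_def by simp
    ultimately show ?thesis unfolding d_def by (simp add: right_diff_distrib)
  qed
  then have "\<bar>unit_rate * d\<bar> \<le> \<bar>(1 - p) * Ex (\<lambda>x. (unit_present x - Ex unit_present) * f (W x))\<bar> + \<bar>p * Ex (\<lambda>x. (unit_absent x - Ex unit_absent) * f (W x + 1))\<bar>"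
    by linarith
  also have "\<dots> \<le> 6 * exp (2 * L) * sqrt scale * \<theta> + C_sd * sqrt scale * \<theta>"
  proof (rule add_mono)
    have s: "sqrt (36 * exp (4 * L) * scale) = 6 * exp (2 * L) * sqrt scale"
    proof -
      have "sqrt (exp (4 * L)) = exp (2 * L)"
        by (rule real_sqrt_unique) (auto simp: power2_eq_square simp flip: exp_add)
      moreover have "sqrt (36 :: real) = 6" by (rule real_sqrt_unique) auto
      ultimately show ?thesis by (simp add: real_sqrt_mult)
    qed
    have "\<bar>Ex (\<lambda>x. (unit_present x - Ex unit_present) * f (W x))\<bar> \<le> sqrt (36 * exp (4 * L) * scale) * \<theta>"
      unfolding scale_def using assms by (intro Ex_centered_bound var_unit_present_le) auto
    then have "(1 - p) * \<bar>Ex (\<lambda>x. (unit_present x - Ex unit_present) * f (W x))\<bar> \<le> 1 * (sqrt (36 * exp (4 * L) * scale) * \<theta>)"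
      using prob01 by (intro mult_mono) auto
    then show "\<bar>(1 - p) * Ex (\<lambda>x. (unit_present x - Ex unit_present) * f (W x))\<bar> \<le> 6 * exp (2 * L) * sqrt scale * \<theta>"
      using prob01 by (simp add: abs_mult s)
    have "\<bar>Ex (\<lambda>x. (unit_absent x - Ex unit_absent) * f (W x + 1))\<bar> \<le> sqrt (1\<^sup>2 * (51 * C_growth * L * (real n ^ 3 * p))) * \<theta>"
      using assms by (intro Ex_centered_bound var_le_of_influence unit_absent_diff_le) auto
    then have "p * \<bar>Ex (\<lambda>x. (unit_absent x - Ex unit_absent) * f (W x + 1))\<bar> \<le> p * (sqrt (51 * C_growth * L * (real n ^ 3 * p)) * \<theta>)"
      using prob01 by (intro mult_left_mono) auto
    also have "\<dots> = (p * sqrt (51 * C_growth * L * (real n ^ 3 * p))) * \<theta>" by (simp only: mult.assoc)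
    also have "\<dots> = C_sd * sqrt scale * \<theta>" by (simp only: sqrt_p2_n3p C_sd_def)
    finally show "\<bar>p * Ex (\<lambda>x. (unit_absent x - Ex unit_absent) * f (W x + 1))\<bar> \<le> C_sd * sqrt scale * \<theta>"
      using prob01 by (simp add: abs_mult)
  qed
  also have "\<dots> = (C_sd + 6 * exp (2 * L)) * (sqrt scale * \<theta>)" by (simp add: algebra_simps)
  finally have b: "unit_rate * \<bar>d\<bar> \<le> (C_sd + 6 * exp (2 * L)) * (sqrt scale * \<theta>)"
    using unit_rate_pos by (simp add: abs_mult)
  have "exp (- 2 * L) / 16 * scale * \<bar>d\<bar> \<le> unit_rate * \<bar>d\<bar>"
    using unit_rate_ge by (intro mult_right_mono) (auto simp: scale_def)
  with b have "exp (- 2 * L) / 16 * scale * \<bar>d\<bar> \<le> (C_sd + 6 * exp (2 * L)) * (sqrt scale * \<theta>)" by linarith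
  then have "16 * exp (2 * L) * (exp (- 2 * L) / 16 * scale * \<bar>d\<bar>) \<le> 16 * exp (2 * L) * ((C_sd + 6 * exp (2 * L)) * (sqrt scale * \<theta>))"
    by (intro mult_left_mono) auto
  also have "16 * exp (2 * L) * (exp (- 2 * L) / 16 * scale * \<bar>d\<bar>) = scale * \<bar>d\<bar>"
    by (simp add: exp_minus)
  also have "scale * \<bar>d\<bar> = sqrt scale * (sqrt scale * \<bar>d\<bar>)" using scale_pos by simp
  also have "16 * exp (2 * L) * ((C_sd + 6 * exp (2 * L)) * (sqrt scale * \<theta>)) = sqrt scale * (C_smooth * \<theta>)"
    by (simp add: C_smooth_def ac_simps)
  finally have "sqrt scale * \<bar>d\<bar> \<le> C_smooth * \<theta>"
    using scale_pos by (subst (asm) mult_le_cancel_left_pos) auto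
  then show ?thesis using scale_pos unfolding d_def by (simp add: pos_le_divide_eq mult.commute)
qed

text \<open>Since \<open>chaos\<close> is linear in the codegree and the two degrees, moments of the
  codegree up to order four and second moments of \<open>p\<close> times a degree suffice; each is
  at most a constant times \<open>n * p^2\<close>.\<close>

lemma Ex_edge_chaos_edge_codeg_sq_le:
  assumes "e \<in> pot_edges n"
  defines "C_var \<equiv> 8 * exp (8 * L) + 16 * exp (16 * L) + 4 * L * exp (4 * L) + 16 * L"
  shows "Ex (\<lambda>x. edge_chaos n p x e * real (edge_codeg n x e) ^ 2) \<le> C_var * (real n * p\<^sup>2)"
proof -
  obtain a b where e: "e = (a, b)" "a < b" "b < n" using assms by (auto simp: pot_edges_def)
  define S where "S = {..<n} - {a, b}"
  define c where "c = (\<lambda>x. real (edge_codeg n x e))"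
  define D1 where "D1 = (\<lambda>x. p * real (deg S x a))"
  define D2 where "D2 = (\<lambda>x. p * real (deg S x b))"
  have fin: "finite S" by (simp add: S_def)
  have deg: "Ex (\<lambda>x. (p * real (deg S x u))\<^sup>2) \<le> 8 * L * (real n * p\<^sup>2)" if u: "u = a \<or> u = b" for u
  proof -
    have "Ex (\<lambda>x. (p * real (deg S x u))\<^sup>2) \<le> Ex (\<lambda>x. p\<^sup>2 * (\<Sum>w\<in>S. (adj x u w + p) * 1)\<^sup>2)"
    proof (rule Ex_mono)
      fix x
      have "(real (deg S x u))\<^sup>2 \<le> (\<Sum>w\<in>S. (adj x u w + p) * 1)\<^sup>2"
        unfolding real_deg[OF fin] using prob01 by (intro power_mono sum_mono sum_nonneg) auto
      then show "(p * real (deg S x u))\<^sup>2 \<le> p\<^sup>2 * (\<Sum>w\<in>S. (adj x u w + p) * 1)\<^sup>2"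
        unfolding power_mult_distrib by (intro mult_left_mono) auto
    qed
    \<comment> \<open>The case \<open>G = 1\<close>, \<open>K = 1\<close> of
      \<open>Ex_growth_sum_sq_le\<close>. Of the two resulting factors \<open>n * p^2\<close>, one
      is bounded by \<open>L\<close>.\<close>
    also have "\<dots> \<le> p\<^sup>2 * (8 * 1 * (real n * p)\<^sup>2)"
      unfolding Ex_cmult
      by (intro mult_left_mono Ex_growth_sum_sq_le) (use e u in \<open>auto simp: S_def\<close>)
    also have "\<dots> = 8 * (real n * p\<^sup>2) * (real n * p\<^sup>2)" by (simp add: power2_eq_square)
    also have "\<dots> \<le> 8 * L * (real n * p\<^sup>2)"
      using np2 by (intro mult_right_mono mult_left_mono) auto
    finally show ?thesis .
  qed
  have "Ex (\<lambda>x. edge_chaos n p x e * real (edge_codeg n x e) ^ 2)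
      \<le> Ex (\<lambda>x. c x ^ 3 + c x ^ 4 + ((D1 x)\<^sup>2 + (D2 x)\<^sup>2) + L * c x ^ 2)"
  proof (rule Ex_mono)
    fix x
    have c0: "0 \<le> c x" and D0: "0 \<le> D1 x" "0 \<le> D2 x"
      using prob01 by (auto simp: c_def D1_def D2_def)
    have m: "real (card S) * p\<^sup>2 \<le> L"
      by (rule order_trans[OF card_p2_le np2]) (auto simp: S_def)
    have am: "u * v \<le> (u\<^sup>2 + v\<^sup>2) / 2" for u v :: real
      using sum_squares_bound[of u v] by simp
    have "edge_chaos n p x e = c x / 3 + (D1 x + D2 x) / 6 + real (card S) * p\<^sup>2 / 3"
      by (simp add: edge_chaos_def e(1) chaos_eq c_def D1_def D2_def edge_codeg_def S_def distrib_left)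
    also have "\<dots> \<le> c x + (D1 x + D2 x) + L"
    proof -
      have "u / 3 + (v + v') / 6 + w / 3 \<le> u + (v + v') + l"
        if "0 \<le> u" "0 \<le> v" "0 \<le> v'" "0 \<le> w" "w \<le> l" for u v v' w l :: real
        using that by argo
      then show ?thesis using c0 D0 m by simp
    qed
    finally have "edge_chaos n p x e * (c x)\<^sup>2 \<le> (c x + (D1 x + D2 x) + L) * (c x)\<^sup>2"
      by (intro mult_right_mono) auto
    also have "\<dots> = c x ^ 3 + (D1 x * (c x)\<^sup>2 + D2 x * (c x)\<^sup>2) + L * (c x)\<^sup>2"
      by (simp add: power2_eq_square power3_eq_cube algebra_simps)
    also have "\<dots> \<le> c x ^ 3 + (((D1 x)\<^sup>2 + ((c x)\<^sup>2)\<^sup>2) / 2 + ((D2 x)\<^sup>2 + ((c x)\<^sup>2)\<^sup>2) / 2) + L * (c x)\<^sup>2"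
      by (intro add_mono am) auto
    also have "\<dots> \<le> c x ^ 3 + c x ^ 4 + ((D1 x)\<^sup>2 + (D2 x)\<^sup>2) + L * c x ^ 2"
      by (simp add: field_simps flip: power_mult)
    finally show "edge_chaos n p x e * real (edge_codeg n x e) ^ 2
        \<le> c x ^ 3 + c x ^ 4 + ((D1 x)\<^sup>2 + (D2 x)\<^sup>2) + L * c x ^ 2" by (simp add: c_def)
  qed
  also have "\<dots> = Ex (\<lambda>x. c x ^ 3) + Ex (\<lambda>x. c x ^ 4) + (Ex (\<lambda>x. (D1 x)\<^sup>2) + Ex (\<lambda>x. (D2 x)\<^sup>2)) + L * Ex (\<lambda>x. c x ^ 2)"
    by (simp only: Ex_add Ex_cmult)
  also have "\<dots> \<le> 8 * exp (8 * L) * (real n * p\<^sup>2) + 16 * exp (16 * L) * (real n * p\<^sup>2)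
      + (8 * L * (real n * p\<^sup>2) + 8 * L * (real n * p\<^sup>2)) + L * (4 * exp (4 * L) * (real n * p\<^sup>2))"
    unfolding c_def D1_def D2_def
    using Ex_edge_codeg_power_le[OF assms(1), of 2] Ex_edge_codeg_power_le[OF assms(1), of 3] Ex_edge_codeg_power_le[OF assms(1), of 4] L_nonneg
    by (intro add_mono mult_left_mono deg) auto
  also have "\<dots> = C_var * (real n * p\<^sup>2)" by (simp add: C_var_def algebra_simps)
  finally show ?thesis .
qed

definition C_var :: real where
  "C_var = 8 * exp (8 * L) + 16 * exp (16 * L) + 4 * L * exp (4 * L) + 16 * L"

lemma C_var_nonneg: "0 \<le> C_var" unfolding C_var_def using L_nonneg by simp

lemma edge_chaos_nonneg: "0 \<le> edge_chaos n p x e"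
  unfolding edge_chaos_def using prob01 by (simp add: chaos_nonneg)

lemma absent_01: "0 \<le> absent x e" "absent x e \<le> 1"
  by (auto simp: absent_def)

lemma level_nonneg: "0 \<le> level n p i x"
  unfolding level_def using edge_chaos_nonneg absent_01 by (intro sum_nonneg) auto

text \<open>The weights \<open>1\<close> and \<open>i\<close> produce the codegree \<open>c\<close>
  and \<open>c * (c - 1) / 2\<close>; these cases serve the variance and the cost of shifting
  \<open>W\<close> by \<open>i\<close>.\<close>

lemma level_sum:
  fixes r :: "nat \<Rightarrow> real"
  shows "(\<Sum>i<n. r i * level n p i x) = (\<Sum>e\<in>pot_edges n. absent x e * edge_chaos n p x e * (\<Sum>i<edge_codeg n x e. r i))"
proof -
  have "(\<Sum>i<n. r i * level n p i x) = (\<Sum>e\<in>pot_edges n. \<Sum>i<n. absent x e * edge_chaos n p x e * (of_bool (i < edge_codeg n x e) * r i))"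
    unfolding level_def sum_distrib_left by (subst sum.swap) (simp only: ac_simps)
  also have "\<dots> = (\<Sum>e\<in>pot_edges n. absent x e * edge_chaos n p x e * (\<Sum>i<edge_codeg n x e. r i))"
  proof (intro sum.cong refl)
    fix e
    have "{..<n} \<inter> {i. i < edge_codeg n x e} = {..<edge_codeg n x e}" using edge_codeg_le[of n x e] by auto
    then show "(\<Sum>i<n. absent x e * edge_chaos n p x e * (of_bool (i < edge_codeg n x e) * r i))
      = absent x e * edge_chaos n p x e * (\<Sum>i<edge_codeg n x e. r i)"
      unfolding sum_distrib_left[symmetric] by simp
  qed
  finally show ?thesis .
qed

lemma level_moment_le:
  assumes "\<And>c. c \<le> n \<Longrightarrow> (\<Sum>i<c. r i) \<le> real c ^ 2"
  shows "p * (\<Sum>i<n. r i * Ex (level n p i)) \<le> C_var * scale"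
proof -
  have "(\<Sum>i<n. r i * Ex (level n p i)) = Ex (\<lambda>x. \<Sum>i<n. r i * level n p i x)"
    by (simp add: Ex_sum Ex_cmult)
  also have "\<dots> \<le> Ex (\<lambda>x. \<Sum>e\<in>pot_edges n. edge_chaos n p x e * real (edge_codeg n x e) ^ 2)"
    unfolding level_sum
  proof (intro Ex_mono sum_mono)
    fix x e
    have "absent x e * edge_chaos n p x e * (\<Sum>i<edge_codeg n x e. r i) \<le> absent x e * (edge_chaos n p x e * real (edge_codeg n x e) ^ 2)"
      unfolding mult.assoc using assms[OF edge_codeg_le] edge_chaos_nonneg absent_01 by (intro mult_left_mono) auto
    also have "\<dots> \<le> edge_chaos n p x e * real (edge_codeg n x e) ^ 2"
      using edge_chaos_nonneg absent_01 by (intro mult_left_le_one_le) auto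
    finally show "absent x e * edge_chaos n p x e * (\<Sum>i<edge_codeg n x e. r i) \<le> edge_chaos n p x e * real (edge_codeg n x e) ^ 2" .
  qed
  also have "\<dots> \<le> (\<Sum>e\<in>pot_edges n. C_var * (real n * p\<^sup>2))"
    unfolding Ex_sum C_var_def by (intro sum_mono Ex_edge_chaos_edge_codeg_sq_le)
  also have "\<dots> \<le> (real n)\<^sup>2 * (C_var * (real n * p\<^sup>2))"
    using card_pot_edges_le C_var_nonneg by (simp add: mult_right_mono)
  finally have "p * (\<Sum>i<n. r i * Ex (level n p i)) \<le> p * ((real n)\<^sup>2 * (C_var * (real n * p\<^sup>2)))"
    using prob01 by (intro mult_left_mono) auto
  also have "\<dots> = C_var * scale" by (simp add: scale_def power2_eq_square power3_eq_cube)
  finally show ?thesis .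
qed

section \<open>The variance and Stein's approximation\<close>

definition variance :: real where "variance = Ex (\<lambda>x. (of_int (W x) - mean)\<^sup>2)"

text \<open>The covariance identity with \<open>g\<close> the identity, whose increments are all
  1.\<close>

lemma variance_eq: "variance = p * (\<Sum>i<n. Ex (level n p i))"
proof -
  have "variance = Ex (\<lambda>x. (of_int (W x) - mean) * of_int (W x) - mean * (of_int (W x) - mean))"
    unfolding variance_def by (intro arg_cong[where f = Ex] ext) (simp add: power2_eq_square algebra_simps)
  also have "\<dots> = Ex (\<lambda>x. (of_int (W x) - mean) * of_int (W x))"
    by (simp add: Ex_diff Ex_cmult mean_def)
  also have "\<dots> = p * (\<Sum>i<n. Ex (level n p i))"
    unfolding Ex_centered_mult_levels by simp
  finally show ?thesis .
qed

lemma variance_le: "variance \<le> C_var * scale"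
proof -
  have "real c \<le> real c ^ 2" for c :: nat
    by (cases c) (auto simp: power2_eq_square)
  then show ?thesis
    using level_moment_le[of "\<lambda>_. 1"] by (simp add: variance_eq)
qed

text \<open>All terms are nonnegative and \<open>chaos\<close> is at least a third of the codegree.
  An integer is dominated by its square, which leaves the mean codegree
  \<open>(n - 2) * p^2 \<ge> n * p^2 / 2\<close>.\<close>

lemma variance_ge: "scale / 48 \<le> variance"
proof -
  have one: "real n * p\<^sup>2 / 12 \<le> Ex (\<lambda>x. absent x e * (edge_chaos n p x e * real (edge_codeg n x e)))" if e: "e \<in> pot_edges n" for e
  proof -
    have "real n * p\<^sup>2 / 6 \<le> Ex (\<lambda>x. real (edge_codeg n x e)) / 3"
      using n4 mult_right_mono[of "real n" "(real n - 2) * 2" "p\<^sup>2"] by (simp add: Ex_edge_codeg[OF e] algebra_simps)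
    also have "\<dots> = Ex (\<lambda>x. real (edge_codeg n x e) * (1 / 3))"
      unfolding Ex_multc by simp
    also have "\<dots> \<le> Ex (\<lambda>x. edge_chaos n p x e * real (edge_codeg n x e))"
    proof (rule Ex_mono)
      fix x
      have "real (edge_codeg n x e) / 3 \<le> edge_chaos n p x e"
        unfolding edge_chaos_def edge_codeg_def using prob01 by (simp add: chaos_eq)
      then have "real (edge_codeg n x e) / 3 * real (edge_codeg n x e) \<le> edge_chaos n p x e * real (edge_codeg n x e)"
        by (intro mult_right_mono) auto
      moreover have "real (edge_codeg n x e) * (1 / 3) \<le> real (edge_codeg n x e) / 3 * real (edge_codeg n x e)"
        by (cases "edge_codeg n x e") (auto simp: algebra_simps)
      ultimately show "real (edge_codeg n x e) * (1 / 3) \<le> edge_chaos n p x e * real (edge_codeg n x e)" by linarith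
    qed
    finally have "(1 / 2) * (real n * p\<^sup>2 / 6) \<le> (1 - p) * Ex (\<lambda>x. edge_chaos n p x e * real (edge_codeg n x e))"
      using p_half by (intro mult_mono) auto
    also have "\<dots> = Ex (\<lambda>x. absent x e * (edge_chaos n p x e * real (edge_codeg n x e)))"
      unfolding absent_def by (rule Ex_nonedge_mult[symmetric]) (use e in auto)
    finally show ?thesis by simp
  qed
  have "scale / 48 = p * ((real n)\<^sup>2 / 4 * (real n * p\<^sup>2 / 12))"
    by (simp add: scale_def power2_eq_square power3_eq_cube)
  also have "\<dots> \<le> p * (real (card (pot_edges n)) * (real n * p\<^sup>2 / 12))"
    using card_pot_edges_ge prob01 by (intro mult_left_mono mult_right_mono) auto
  also have "\<dots> = p * (\<Sum>e\<in>pot_edges n. real n * p\<^sup>2 / 12)" by simp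
  also have "\<dots> \<le> p * (\<Sum>e\<in>pot_edges n. Ex (\<lambda>x. absent x e * (edge_chaos n p x e * real (edge_codeg n x e))))"
    using prob01 one by (intro mult_left_mono sum_mono) auto
  also have "\<dots> = p * Ex (\<lambda>x. \<Sum>i<n. 1 * level n p i x)"
    unfolding level_sum by (simp add: Ex_sum mult.assoc)
  also have "\<dots> = variance" by (simp add: variance_eq Ex_sum)
  finally show ?thesis .
qed

definition C_stein :: real where "C_stein = 2 * C_sd + C_var * C_smooth"

text \<open>Two replacements in the covariance identity. Each \<open>level\<close> is replaced by
  its mean, with errors decaying like \<open>(1 / 2) ^ i\<close>; then \<open>W + i\<close> is
  replaced by \<open>W\<close> in the increment, at a cost proportional to \<open>i\<close>,
  controlled by \<open>level_moment_le\<close>. The mean levels that remain add up to the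
  variance.\<close>

theorem stein_approximation:
  fixes g :: "int \<Rightarrow> real"
  defines "d \<equiv> \<lambda>z. g (z + 1) - g z"
  assumes bound: "\<And>i :: nat. Ex (\<lambda>x. (d (W x + int i))\<^sup>2) \<le> \<theta>\<^sup>2" and "0 \<le> \<theta>"
  shows "\<bar>Ex (\<lambda>x. (of_int (W x) - mean) * g (W x)) - variance * Ex (\<lambda>x. d (W x))\<bar> \<le> C_stein * \<theta> * sqrt scale"
proof -
  \<comment> \<open>One application of \<open>smoothness\<close> per unit shift, which is why
    \<open>bound\<close> is assumed at every shift.\<close>
  have sm: "\<bar>Ex (\<lambda>x. d (W x + int i)) - Ex (\<lambda>x. d (W x))\<bar> \<le> real i * (C_smooth * \<theta> / sqrt scale)" for i
  proof (induction i)
    case 0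
    then show ?case by simp
  next
    case (Suc i)
    have "\<bar>Ex (\<lambda>x. d (W x + 1 + int i)) - Ex (\<lambda>x. d (W x + int i))\<bar> \<le> C_smooth * \<theta> / sqrt scale"
    proof (rule smoothness)
      show "Ex (\<lambda>x. (d (W x + 1 + int i))\<^sup>2) \<le> \<theta>\<^sup>2"
        using bound[of "Suc i"] by (simp add: add.assoc)
    qed (use bound assms in auto)
    moreover have "real (Suc i) * (C_smooth * \<theta> / sqrt scale) = C_smooth * \<theta> / sqrt scale + real i * (C_smooth * \<theta> / sqrt scale)"
      unfolding of_nat_Suc distrib_right by simp
    moreover have "W x + int (Suc i) = W x + 1 + int i" for x by simp
    ultimately show ?case using Suc by (simp only:)
  qed
  have "Ex (\<lambda>x. (of_int (W x) - mean) * g (W x)) - variance * Ex (\<lambda>x. d (W x))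
     = p * (\<Sum>i<n. Ex (\<lambda>x. level n p i x * d (W x + int i)) - Ex (level n p i) * Ex (\<lambda>x. d (W x)))"
    unfolding Ex_centered_mult_levels variance_eq d_def
    by (simp add: sum_subtractf right_diff_distrib sum_distrib_right)
  also have "\<dots> = p * (\<Sum>i<n. Ex (\<lambda>x. (level n p i x - Ex (level n p i)) * d (W x + int i))
       + Ex (level n p i) * (Ex (\<lambda>x. d (W x + int i)) - Ex (\<lambda>x. d (W x))))"
    by (intro arg_cong[where f = "(*) p"] sum.cong refl) (simp add: left_diff_distrib right_diff_distrib Ex_diff Ex_cmult)
  finally have eq: "Ex (\<lambda>x. (of_int (W x) - mean) * g (W x)) - variance * Ex (\<lambda>x. d (W x)) = \<dots>" .
  have "\<bar>Ex (\<lambda>x. (of_int (W x) - mean) * g (W x)) - variance * Ex (\<lambda>x. d (W x))\<bar>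
      \<le> p * (\<Sum>i<n. (1 / 2) ^ i * (sqrt (51 * C_growth * L * (real n ^ 3 * p)) * \<theta>)
          + Ex (level n p i) * (real i * (C_smooth * \<theta> / sqrt scale)))"
    unfolding eq abs_mult abs_of_nonneg[OF prob01(1)]
  proof (intro mult_left_mono order_trans[OF sum_abs] sum_mono order_trans[OF abs_triangle_ineq] add_mono)
    fix i
    have "\<bar>Ex (\<lambda>x. (level n p i x - Ex (level n p i)) * d (W x + int i))\<bar>
        \<le> sqrt (((1 / 2) ^ i)\<^sup>2 * (51 * C_growth * L * (real n ^ 3 * p))) * \<theta>"
      using bound assms(3) by (intro Ex_centered_bound var_le_of_influence level_diff_le) auto
    also have "\<dots> = (1 / 2) ^ i * (sqrt (51 * C_growth * L * (real n ^ 3 * p)) * \<theta>)"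
      unfolding real_sqrt_mult by simp
    finally show "\<bar>Ex (\<lambda>x. (level n p i x - Ex (level n p i)) * d (W x + int i))\<bar>
        \<le> (1 / 2) ^ i * (sqrt (51 * C_growth * L * (real n ^ 3 * p)) * \<theta>)" .
    have l: "0 \<le> Ex (level n p i)" by (rule Ex_nonneg) (rule level_nonneg)
    show "\<bar>Ex (level n p i) * (Ex (\<lambda>x. d (W x + int i)) - Ex (\<lambda>x. d (W x)))\<bar>
        \<le> Ex (level n p i) * (real i * (C_smooth * \<theta> / sqrt scale))"
      unfolding abs_mult abs_of_nonneg[OF l] by (rule mult_left_mono[OF sm l])
  qed (use prob01 in auto)
  also have "\<dots> = (\<Sum>i<n. (1 / 2) ^ i) * ((p * sqrt (51 * C_growth * L * (real n ^ 3 * p))) * \<theta>)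
       + (p * (\<Sum>i<n. real i * Ex (level n p i))) * (C_smooth * \<theta> / sqrt scale)"
    by (simp add: sum.distrib sum_distrib_left sum_distrib_right distrib_left ac_simps)
  also have "\<dots> \<le> 2 * (C_sd * sqrt scale * \<theta>) + C_var * scale * (C_smooth * \<theta> / sqrt scale)"
  proof (rule add_mono)
    have "(\<Sum>i<m. (1 / 2 :: real) ^ i) = 2 - 2 * (1 / 2) ^ m" for m
      by (induction m) auto
    then have "(\<Sum>i<n. (1 / 2 :: real) ^ i) \<le> 2" by simp
    then show "(\<Sum>i<n. (1 / 2) ^ i) * ((p * sqrt (51 * C_growth * L * (real n ^ 3 * p))) * \<theta>) \<le> 2 * (C_sd * sqrt scale * \<theta>)"
      unfolding sqrt_p2_n3p C_sd_def[symmetric] using C_sd_nonneg scale_pos assms(3) by (intro mult_right_mono) auto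
    have "(\<Sum>i<c. real i) \<le> real c ^ 2" for c
      by (induction c) (auto simp: power2_eq_square algebra_simps)
    then show "(p * (\<Sum>i<n. real i * Ex (level n p i))) * (C_smooth * \<theta> / sqrt scale) \<le> C_var * scale * (C_smooth * \<theta> / sqrt scale)"
      using C_smooth_nonneg scale_pos assms(3) by (intro mult_right_mono level_moment_le) auto
  qed
  also have "C_var * scale * (C_smooth * \<theta> / sqrt scale) = C_var * C_smooth * \<theta> * (scale / sqrt scale)" by simp
  also have "scale / sqrt scale = sqrt scale" using scale_pos by (simp add: real_div_sqrt)
  finally show ?thesis by (simp add: C_stein_def algebra_simps)
qed

end

section \<open>Distances to the translated Poisson law\<close>

text \<open>On a finite set the positive and the negative part of the difference are each a
  difference of probabilities of one event; the factor 1/2 in \<open>d_TV\<close> compensates for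
  the two parts.\<close>

lemma d_TV_le:
  assumes "\<And>B. \<bar>measure_pmf.prob P B - measure_pmf.prob Q B\<bar> \<le> \<epsilon>"
  shows "d_TV P Q \<le> \<epsilon>"
proof -
  have fin: "(\<Sum>j\<in>F. \<bar>pmf P j - pmf Q j\<bar>) \<le> 2 * \<epsilon>" if "finite F" for F
  proof -
    define B where "B = {j \<in> F. pmf Q j \<le> pmf P j}"
    have B: "finite B" "B \<subseteq> F" using that by (auto simp: B_def)
    have "(\<Sum>j\<in>F. \<bar>pmf P j - pmf Q j\<bar>) = (\<Sum>j\<in>F - B. \<bar>pmf P j - pmf Q j\<bar>) + (\<Sum>j\<in>B. \<bar>pmf P j - pmf Q j\<bar>)"
      using that B by (simp add: sum.subset_diff)
    also have "(\<Sum>j\<in>F - B. \<bar>pmf P j - pmf Q j\<bar>) = (\<Sum>j\<in>F - B. pmf Q j - pmf P j)"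
      by (intro sum.cong) (auto simp: B_def)
    also have "(\<Sum>j\<in>B. \<bar>pmf P j - pmf Q j\<bar>) = (\<Sum>j\<in>B. pmf P j - pmf Q j)"
      by (intro sum.cong) (auto simp: B_def)
    also have "(\<Sum>j\<in>F - B. pmf Q j - pmf P j) + (\<Sum>j\<in>B. pmf P j - pmf Q j)
       = (measure_pmf.prob Q (F - B) - measure_pmf.prob P (F - B)) + (measure_pmf.prob P B - measure_pmf.prob Q B)"
      using that B by (simp add: measure_measure_pmf_finite sum_subtractf)
    also have "\<dots> \<le> \<epsilon> + \<epsilon>"
      using assms[of "F - B"] assms[of B] by linarith
    finally show ?thesis by simp
  qed
  have "(\<Sum>\<^sub>\<infinity>j\<in>UNIV. \<bar>pmf P j - pmf Q j\<bar>) \<le> 2 * \<epsilon>"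
  proof (rule infsum_le_finite_sums)
    show "(\<lambda>j. \<bar>pmf P j - pmf Q j\<bar>) summable_on UNIV"
      by (rule nonneg_bdd_above_summable_on) (use fin in \<open>auto intro!: bdd_aboveI2\<close>)
  qed (use fin in auto)
  then show ?thesis unfolding d_TV_def by simp
qed

lemma d_TV_nonneg: "0 \<le> d_TV P Q"
  unfolding d_TV_def by (simp add: infsum_nonneg)

lemma d_loc_le: "(\<And>j. \<bar>pmf P j - pmf Q j\<bar> \<le> \<epsilon>) \<Longrightarrow> d_loc P Q \<le> \<epsilon>"
  unfolding d_loc_def by (rule cSUP_least) auto

lemma d_loc_nonneg: "0 \<le> d_loc P Q"
proof -
  have "bdd_above (range (\<lambda>j. \<bar>pmf P j - pmf Q j\<bar>))"
  proof (rule bdd_aboveI2)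
    fix j show "\<bar>pmf P j - pmf Q j\<bar> \<le> 1"
      using pmf_le_1[of P j] pmf_le_1[of Q j] pmf_nonneg[of P j] pmf_nonneg[of Q j] by linarith
  qed
  then have "\<bar>pmf P 0 - pmf Q 0\<bar> \<le> d_loc P Q"
    unfolding d_loc_def by (intro cSUP_upper) auto
  then show ?thesis by linarith
qed

lemma expectation_tri_law:
  "measure_pmf.expectation (tri_law n p) f = cube_exp (pot_edges n) p (\<lambda>x. f (int (triangles n x)))"
  by (simp add: tri_law_def erdos_renyi_def cube_exp_def)

lemma prob_tri_law:
  "measure_pmf.prob (tri_law n p) B = cube_exp (pot_edges n) p (\<lambda>x. indicator B (int (triangles n x)))"
proof -
  have "measure_pmf.prob (tri_law n p) B = measure_pmf.expectation (tri_law n p) (indicator B)"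
    by simp
  then show ?thesis by (simp only: expectation_tri_law)
qed

context tri_regime
begin

lemma variance_pos: "0 < variance"
  using variance_ge scale_pos by simp

definition shift :: int where "shift = \<lfloor>mean - variance\<rfloor>"

text \<open>The Poisson parameter \<open>s2 + \<gamma>\<close> simplifies to this, so the Poisson
  law has the mean of \<open>W - shift\<close>; rounding makes it exceed the variance by at most
  1.\<close>

definition rate :: real where "rate = mean - of_int shift"

lemma rate_ge: "variance \<le> rate"
  unfolding rate_def shift_def by linarith

lemma rate_le: "rate \<le> variance + 1"
  unfolding rate_def shift_def by linarith

lemma rate_positive: "0 < rate"
  using rate_ge variance_pos by linarith

lemma transl_poisson_eq: "transl_poisson mean variance = map_pmf (\<lambda>k. int k + shift) (poisson_pmf rate)"
  by (simp add: transl_poisson_def Let_def shift_def rate_def)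

text \<open>Chebyshev's inequality: below \<open>shift\<close> the deviation from the mean exceeds
  \<open>rate\<close>, and \<open>variance / rate^2 \<le> 1 / variance\<close>.\<close>

lemma prob_below_shift: "Ex (\<lambda>x. indicator {..<shift} (W x)) \<le> 1 / variance"
proof -
  have "Ex (\<lambda>x. rate\<^sup>2 * indicator {..<shift} (W x)) \<le> variance"
    unfolding variance_def
  proof (rule Ex_mono)
    fix x
    show "rate\<^sup>2 * indicator {..<shift} (W x) \<le> (of_int (W x) - mean)\<^sup>2"
    proof (cases "W x < shift")
      case True
      then have "rate \<le> mean - of_int (W x)" unfolding rate_def by linarith
      then have "rate\<^sup>2 \<le> (mean - of_int (W x))\<^sup>2" using rate_positive by (intro power_mono) auto
      then show ?thesis using True by (simp add: power2_commute)
    qed simp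
  qed
  moreover have "variance\<^sup>2 * Ex (\<lambda>x. indicator {..<shift} (W x)) \<le> rate\<^sup>2 * Ex (\<lambda>x. indicator {..<shift} (W x))"
    using rate_ge variance_pos by (intro mult_right_mono power_mono Ex_nonneg) auto
  ultimately have "variance * (variance * Ex (\<lambda>x. indicator {..<shift} (W x))) \<le> variance * 1"
    by (simp add: Ex_cmult power2_eq_square mult.assoc)
  then have "variance * Ex (\<lambda>x. indicator {..<shift} (W x)) \<le> 1"
    using variance_pos by (subst (asm) mult_le_cancel_left_pos)
  then show ?thesis using variance_pos by (simp add: pos_le_divide_eq mult.commute)
qed

sublocale poisson_stein rate
  by unfold_locales (rule rate_positive)

text \<open>The Stein equation is evaluated at \<open>W - shift\<close> where this is nonnegative;
  the remaining event costs \<open>1 / variance\<close>. Exchanging \<open>rate\<close> for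
  \<open>variance\<close> costs a further \<open>\<theta>\<close>, because they differ by at most
  1.\<close>

lemma discrepancy:
  fixes B :: "int set"
  defines "A \<equiv> {k. int k + shift \<in> B}"
  assumes bound: "\<And>i :: nat. Ex (\<lambda>x. (stein_int A (W x - shift + int i + 1) - stein_int A (W x - shift + int i))\<^sup>2) \<le> \<theta>\<^sup>2"
    and "0 \<le> \<theta>"
  shows "\<bar>measure_pmf.prob (tri_law n p) B - measure_pmf.prob (transl_poisson mean variance) B\<bar>
    \<le> (C_stein * sqrt scale + 1) * \<theta> + 1 / variance"
proof -
  define g where "g = (\<lambda>w. stein_int A (w - shift))"
  define d where "d = (\<lambda>w. g (w + 1) - g w)"
  have bd: "Ex (\<lambda>x. (d (W x + int i))\<^sup>2) \<le> \<theta>\<^sup>2" for i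
    using bound[of i] unfolding d_def g_def by (simp add: algebra_simps)
  have tp: "measure_pmf.prob (transl_poisson mean variance) B = Po A"
    unfolding transl_poisson_eq by (simp add: A_def vimage_def)
  have pw: "\<bar>indicator B (W x) - Po A - (rate * d (W x) - (of_int (W x) - mean) * g (W x))\<bar> \<le> indicator {..<shift} (W x)" for x
  proof (cases "W x < shift")
    case True
    then have "g (W x) = 0" "g (W x + 1) = 0" by (simp_all add: g_def stein_int_nonpos)
    moreover have "0 \<le> Po A" "Po A \<le> 1" by auto
    moreover have "indicator B (W x) \<in> {0, 1 :: real}" by (auto simp: indicator_def)
    ultimately show ?thesis using True by (auto simp: d_def)
  next
    case False
    have "rate * g (W x + 1) - (of_int (W x - shift)) * g (W x) = indicator A (nat (W x - shift)) - Po A"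
      using stein_int_eq[of "W x - shift" A] False unfolding g_def by (simp add: algebra_simps)
    moreover have "indicator A (nat (W x - shift)) = (indicator B (W x) :: real)"
      using False by (simp add: A_def indicator_def)
    \<comment> \<open>As \<open>W - shift = rate + (W - mean)\<close>, the equation takes the
      centred form of \<open>stein_approximation\<close>.\<close>
    moreover have "rate * g (W x + 1) - (of_int (W x - shift)) * g (W x)
        = rate * d (W x) - (of_int (W x) - mean) * g (W x)"
      by (simp add: d_def rate_def algebra_simps)
    ultimately show ?thesis using False by simp
  qed
  have "\<bar>measure_pmf.prob (tri_law n p) B - Po A - (rate * Ex (\<lambda>x. d (W x)) - Ex (\<lambda>x. (of_int (W x) - mean) * g (W x)))\<bar>
      = \<bar>Ex (\<lambda>x. indicator B (W x) - Po A - (rate * d (W x) - (of_int (W x) - mean) * g (W x)))\<bar>"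
    by (simp only: prob_tri_law Ex_diff Ex_cmult Ex_const)
  also have "\<dots> \<le> Ex (\<lambda>x. indicator {..<shift} (W x))"
    by (rule order_trans[OF Ex_abs Ex_mono]) (rule pw)
  also have "\<dots> \<le> 1 / variance" by (rule prob_below_shift)
  finally have 1: "\<bar>measure_pmf.prob (tri_law n p) B - Po A - (rate * Ex (\<lambda>x. d (W x)) - Ex (\<lambda>x. (of_int (W x) - mean) * g (W x)))\<bar> \<le> 1 / variance" .
  have 2: "\<bar>Ex (\<lambda>x. (of_int (W x) - mean) * g (W x)) - variance * Ex (\<lambda>x. d (W x))\<bar> \<le> C_stein * \<theta> * sqrt scale"
    using bd assms(3) unfolding d_def by (rule stein_approximation)
  have "\<bar>Ex (\<lambda>x. d (W x) * 1)\<bar> \<le> sqrt (Ex (\<lambda>x. (d (W x))\<^sup>2)) * sqrt (Ex (\<lambda>x. 1\<^sup>2))"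
    by (rule Ex_Cauchy_Schwarz)
  also have "\<dots> \<le> \<theta>"
    using real_sqrt_le_mono[OF bd[of 0]] assms(3) by simp
  finally have "\<bar>Ex (\<lambda>x. d (W x))\<bar> \<le> \<theta>" by simp
  then have 3: "\<bar>(rate - variance) * Ex (\<lambda>x. d (W x))\<bar> \<le> 1 * \<theta>"
    unfolding abs_mult using rate_ge rate_le by (intro mult_mono) auto
  have "(rate - variance) * Ex (\<lambda>x. d (W x)) = rate * Ex (\<lambda>x. d (W x)) - variance * Ex (\<lambda>x. d (W x))"
    by (rule left_diff_distrib)
  moreover have "(C_stein * sqrt scale + 1) * \<theta> = C_stein * \<theta> * sqrt scale + \<theta>" by (simp add: algebra_simps)
  ultimately show ?thesis unfolding tp using 1 2 3 by linarith
qed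

lemma C_stein_nonneg: "0 \<le> C_stein"
  unfolding C_stein_def using C_sd_nonneg C_var_nonneg C_smooth_nonneg by simp

lemma inverse_variance_le: "1 / variance \<le> 48 / scale"
  using variance_ge scale_pos variance_pos by (simp add: field_simps)

lemma inverse_rate_le: "1 / rate \<le> 48 / scale"
proof -
  have "1 / rate \<le> 1 / variance" using rate_ge variance_pos by (intro divide_left_mono) auto
  then show ?thesis using inverse_variance_le by linarith
qed

text \<open>Here \<open>\<theta>\<close> is measured in units of \<open>1 / rate\<close>, the
  uniform bound on Stein increments: \<open>\<tau> = 1\<close> serves total variation, and
  \<open>\<tau>\<close> of order \<open>scale^(-1/4)\<close> the local distance.\<close>

lemma discrepancy':
  fixes B :: "int set"
  defines "A \<equiv> {k. int k + shift \<in> B}"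
  assumes bound: "\<And>i :: nat. Ex (\<lambda>x. (stein_int A (W x - shift + int i + 1) - stein_int A (W x - shift + int i))\<^sup>2) \<le> (\<tau> / rate)\<^sup>2"
    and "0 \<le> \<tau>"
  shows "\<bar>measure_pmf.prob (tri_law n p) B - measure_pmf.prob (transl_poisson mean variance) B\<bar>
    \<le> 48 * ((C_stein + 1) * \<tau> / sqrt scale + 1 / scale)"
proof -
  have s: "1 \<le> sqrt scale" "sqrt scale * sqrt scale = scale" using scale_ge_1 by auto
  have "\<bar>measure_pmf.prob (tri_law n p) B - measure_pmf.prob (transl_poisson mean variance) B\<bar>
    \<le> (C_stein * sqrt scale + 1) * (\<tau> / rate) + 1 / variance"
    using assms(2) unfolding A_def by (rule discrepancy) (use assms(3) rate_positive in simp)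
  also have "\<dots> \<le> (C_stein * sqrt scale + sqrt scale) * (\<tau> * (48 / scale)) + 48 / scale"
  proof (intro add_mono mult_mono)
    have "\<tau> * (1 / rate) \<le> \<tau> * (48 / scale)" using inverse_rate_le assms(3) by (rule mult_left_mono)
    then show "\<tau> / rate \<le> \<tau> * (48 / scale)" by simp
  qed (use s C_stein_nonneg assms(3) rate_positive scale_pos inverse_variance_le in auto)
  also have "\<dots> = 48 * ((C_stein + 1) * \<tau> * (sqrt scale / scale) + 1 / scale)"
    by (simp add: algebra_simps)
  also have "sqrt scale / scale = 1 / sqrt scale" using s scale_pos by (simp add: field_simps)
  finally show ?thesis by simp
qed

theorem d_TV_bound: "d_TV (tri_law n p) (transl_poisson mean variance) \<le> 48 * (C_stein + 2) / sqrt scale"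
proof (rule d_TV_le)
  fix B
  have "\<bar>measure_pmf.prob (tri_law n p) B - measure_pmf.prob (transl_poisson mean variance) B\<bar>
    \<le> 48 * ((C_stein + 1) * 1 / sqrt scale + 1 / scale)"
  proof (rule discrepancy')
    fix i :: nat
    let ?A = "{k. int k + shift \<in> B}"
    have "Ex (\<lambda>x. (stein_int ?A (W x - shift + int i + 1) - stein_int ?A (W x - shift + int i))\<^sup>2) \<le> Ex (\<lambda>x. (1 / rate)\<^sup>2)"
      using abs_stein_int_diff_le[of ?A] rate_positive by (intro Ex_mono) (auto simp: abs_le_square_iff[symmetric])
    then show "Ex (\<lambda>x. (stein_int ?A (W x - shift + int i + 1) - stein_int ?A (W x - shift + int i))\<^sup>2) \<le> (1 / rate)\<^sup>2"
      by simp
  qed simp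
  also have "\<dots> \<le> 48 * ((C_stein + 1) * 1 / sqrt scale + 1 / sqrt scale)"
  proof -
    have "sqrt scale \<le> scale" using scale_ge_1 real_sqrt_le_iff[of scale "scale\<^sup>2"] by (simp add: power2_eq_square)
    then have "1 / scale \<le> 1 / sqrt scale" using scale_pos by (intro divide_left_mono) auto
    then show ?thesis by simp
  qed
  also have "\<dots> = 48 * (C_stein + 2) / sqrt scale"
    by (simp add: algebra_simps add_divide_distrib)
  finally show "\<bar>measure_pmf.prob (tri_law n p) B - measure_pmf.prob (transl_poisson mean variance) B\<bar> \<le> 48 * (C_stein + 2) / sqrt scale" .
qed

text \<open>The indicator of a point is the difference of the indicator of a half line and its
  shift, so \<open>smoothness\<close> applies with \<open>\<theta> = 1\<close>.\<close>

lemma concentration: "Ex (\<lambda>x. indicator {k} (W x)) \<le> C_smooth / sqrt scale"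
proof -
  define f where "f = (\<lambda>z :: int. indicator {..k} z :: real)"
  have "(f z)\<^sup>2 \<le> 1" for z by (simp add: f_def indicator_def)
  then have "Ex (\<lambda>x. (f (h x))\<^sup>2) \<le> Ex (\<lambda>x. 1)" for h by (intro Ex_mono) auto
  then have "\<bar>Ex (\<lambda>x. f (W x + 1)) - Ex (\<lambda>x. f (W x))\<bar> \<le> C_smooth * 1 / sqrt scale"
    by (intro smoothness) auto
  moreover have "Ex (\<lambda>x. f (W x)) - Ex (\<lambda>x. f (W x + 1)) = Ex (\<lambda>x. indicator {k} (W x))"
    unfolding Ex_diff[symmetric] by (intro arg_cong[where f = Ex] ext) (auto simp: f_def indicator_def)
  ultimately show ?thesis by simp
qed

lemma Ex_sum_concentration:
  fixes r :: "int \<Rightarrow> real"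
  assumes "\<And>z. 0 \<le> r z" "\<And>S. finite S \<Longrightarrow> sum r S \<le> R"
  shows "Ex (\<lambda>x. r (W x + h)) \<le> C_smooth / sqrt scale * R"
proof -
  define S where "S = {0..int (n ^ 3)}"
  have WS: "W x \<in> S" for x
  proof -
    have "triangles n x \<le> card ({..<n} \<times> {..<n} \<times> {..<n})"
      unfolding triangles_def by (intro card_mono) auto
    also have "\<dots> = n ^ 3" by (simp add: card_cartesian_product power3_eq_cube)
    finally show ?thesis unfolding S_def by simp
  qed
  have fin: "finite S" unfolding S_def by simp
  have "Ex (\<lambda>x. r (W x + h)) = Ex (\<lambda>x. \<Sum>w\<in>S. r (w + h) * indicator {w} (W x))"
  proof (intro arg_cong[where f = Ex] ext)
    fix x
    have "(\<Sum>w\<in>S. r (w + h) * indicator {w} (W x)) = (\<Sum>w\<in>S. if w = W x then r (w + h) else 0)"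
      by (intro sum.cong) (auto simp: indicator_def)
    then show "r (W x + h) = (\<Sum>w\<in>S. r (w + h) * indicator {w} (W x))"
      using fin WS[of x] by simp
  qed
  also have "\<dots> = (\<Sum>w\<in>S. r (w + h) * Ex (\<lambda>x. indicator {w} (W x)))"
    by (simp add: Ex_sum Ex_cmult)
  also have "\<dots> \<le> (\<Sum>w\<in>S. r (w + h) * (C_smooth / sqrt scale))"
    using assms(1) concentration by (intro sum_mono mult_left_mono) auto
  also have "\<dots> = C_smooth / sqrt scale * (\<Sum>w\<in>S. r (w + h))" by (simp only: sum_distrib_right[symmetric] mult.commute)
  also have "(\<Sum>w\<in>S. r (w + h)) = sum r ((\<lambda>w. w + h) ` S)"
    by (subst sum.reindex) (auto simp: inj_on_def)
  also have "C_smooth / sqrt scale * sum r ((\<lambda>w. w + h) ` S) \<le> C_smooth / sqrt scale * R"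
    using assms(2) fin C_smooth_nonneg scale_pos by (intro mult_left_mono) auto
  finally show ?thesis .
qed

definition C_loc :: real where "C_loc = 48 * ((C_stein + 1) * sqrt (2 * C_smooth) + 1)"

lemma C_loc_nonneg: "0 \<le> C_loc" unfolding C_loc_def using C_stein_nonneg C_smooth_nonneg by simp

text \<open>A squared increment is at most \<open>1 / rate\<close> times its modulus, and
  \<open>Ex_sum_concentration\<close> averages the moduli against the point probabilities of
  \<open>W\<close>, using their total \<open>2 / rate\<close>.\<close>

theorem d_loc_bound:
  "d_loc (tri_law n p) (transl_poisson mean variance) \<le> C_loc * (1 / sqrt scale) * sqrt (1 / sqrt scale)"
proof (rule d_loc_le)
  fix j
  define T where "T = 1 / sqrt scale"
  have T: "0 < T" "T \<le> 1" "T * T = 1 / scale" using scale_ge_1 by (auto simp: T_def)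
  \<comment> \<open>The remainder \<open>1 / scale = T^2\<close> is of smaller order than the target
    \<open>T^(3/2)\<close>.\<close>
  have "T \<le> sqrt T" using T(1,2) by (intro real_le_rsqrt) (simp add: power2_eq_square mult_left_le)
  then have v: "1 / scale \<le> T * sqrt T" unfolding T(3)[symmetric] using T by (intro mult_left_mono) auto
  have mn: "48 * (1 / scale) \<le> C_loc * T * sqrt T"
  proof -
    have "48 * (1 / scale) \<le> C_loc * (T * sqrt T)"
      using v T C_stein_nonneg C_smooth_nonneg scale_pos unfolding C_loc_def by (intro mult_mono) auto
    then show ?thesis by (simp add: mult.assoc)
  qed
  have "\<bar>measure_pmf.prob (tri_law n p) {j} - measure_pmf.prob (transl_poisson mean variance) {j}\<bar> \<le> C_loc * T * sqrt T"
  \<comment> \<open>Below \<open>shift\<close> the translated Poisson law has no mass, and the left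
    tail of \<open>W\<close> is already small enough.\<close>
  proof (cases "j < shift")
    case True
    have "measure_pmf.prob (transl_poisson mean variance) {j} = 0"
      unfolding transl_poisson_eq using True by (simp add: vimage_def measure_pmf.prob_eq_0 AE_measure_pmf_iff)
    moreover have "measure_pmf.prob (tri_law n p) {j} \<le> 48 * (1 / scale)"
    proof -
      have "measure_pmf.prob (tri_law n p) {j} \<le> Ex (\<lambda>x. indicator {..<shift} (W x))"
        unfolding prob_tri_law using True by (intro Ex_mono) (auto simp: indicator_def)
      then show ?thesis using prob_below_shift inverse_variance_le by linarith
    qed
    ultimately show ?thesis using mn by simp
  next
    case False
    define k where "k = nat (j - shift)"
    have A: "{k. int k + shift \<in> {j}} = {k}" using False by (auto simp: k_def)
    have "\<bar>measure_pmf.prob (tri_law n p) {j} - measure_pmf.prob (transl_poisson mean variance) {j}\<bar>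
      \<le> 48 * ((C_stein + 1) * sqrt (2 * C_smooth * T) / sqrt scale + 1 / scale)"
    proof (rule discrepancy', unfold A)
      fix i :: nat
      define r where "r = (\<lambda>z. \<bar>stein_int {k} (z + 1) - stein_int {k} z\<bar>)"
      have "Ex (\<lambda>x. (stein_int {k} (W x - shift + int i + 1) - stein_int {k} (W x - shift + int i))\<^sup>2)
          \<le> Ex (\<lambda>x. 1 / rate * r (W x + (int i - shift)))"
      proof (rule Ex_mono)
        fix x
        have "(stein_int {k} (W x - shift + int i + 1) - stein_int {k} (W x - shift + int i))\<^sup>2
            = r (W x + (int i - shift)) * r (W x + (int i - shift))"
          by (simp add: r_def power2_eq_square algebra_simps flip: abs_mult)
        also have "\<dots> \<le> 1 / rate * r (W x + (int i - shift))"
          unfolding r_def by (intro mult_right_mono abs_stein_int_diff_le) auto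
        finally show "(stein_int {k} (W x - shift + int i + 1) - stein_int {k} (W x - shift + int i))\<^sup>2
          \<le> 1 / rate * r (W x + (int i - shift))" .
      qed
      also have "\<dots> = 1 / rate * Ex (\<lambda>x. r (W x + (int i - shift)))" by (rule Ex_cmult)
      also have "\<dots> \<le> 1 / rate * (C_smooth / sqrt scale * (2 / rate))"
        using rate_positive stein_int_point_variation unfolding r_def
        by (intro mult_left_mono Ex_sum_concentration) auto
      also have "\<dots> = (sqrt (2 * C_smooth * T) / rate)\<^sup>2"
        using C_smooth_nonneg T by (simp add: power_divide T_def) (simp add: power2_eq_square ac_simps)
      finally show "Ex (\<lambda>x. (stein_int {k} (W x - shift + int i + 1) - stein_int {k} (W x - shift + int i))\<^sup>2)
         \<le> (sqrt (2 * C_smooth * T) / rate)\<^sup>2" .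
    qed (use C_smooth_nonneg T in simp)
    also have "(C_stein + 1) * sqrt (2 * C_smooth * T) / sqrt scale = (C_stein + 1) * sqrt (2 * C_smooth) * (T * sqrt T)"
      unfolding real_sqrt_mult[of "2 * C_smooth" T] by (simp add: T_def)
    also have "48 * ((C_stein + 1) * sqrt (2 * C_smooth) * (T * sqrt T) + 1 / scale) \<le> 48 * ((C_stein + 1) * sqrt (2 * C_smooth) * (T * sqrt T) + T * sqrt T)"
      using v by simp
    also have "\<dots> = C_loc * T * sqrt T" by (simp add: C_loc_def algebra_simps)
    finally show ?thesis .
  qed
  then show "\<bar>pmf (tri_law n p) j - pmf (transl_poisson mean variance) j\<bar> \<le> C_loc * (1 / sqrt scale) * sqrt (1 / sqrt scale)"
    by (simp add: measure_pmf_single T_def)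
qed

end

section \<open>Asymptotics for \<open>n^\<alpha> * p\<close> converging to \<open>c\<close>\<close>

lemma (in tri_graph) mean_tri_law: "measure_pmf.expectation (tri_law n p) real_of_int = mean"
  by (simp only: expectation_tri_law mean_def)

lemma (in tri_regime) variance_tri_law: "measure_pmf.variance (tri_law n p) real_of_int = variance"
  by (simp only: expectation_tri_law mean_def variance_def)

text \<open>Here the sharper order \<open>(n * p)^(3/2)\<close> is given up, since
  \<open>n * p\<close> already matches the claimed rates.\<close>

lemma (in tri_regime) sqrt_scale_ge: "real n * p \<le> sqrt scale"
proof (rule real_le_rsqrt)
  show "(real n * p)\<^sup>2 \<le> scale" unfolding scale_def using np1 by (intro power_increasing) auto
qed

theorem theorem14:
  fixes p :: "nat \<Rightarrow> real" and \<alpha> c :: real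
  assumes p_prob: "\<And>n. 0 \<le> p n \<and> p n \<le> 1"
    and alpha: "1/2 \<le> \<alpha>" "\<alpha> < 1"
    and c_pos: "c > 0"
    and lim: "(\<lambda>n. real n powr \<alpha> * p n) \<longlonglongrightarrow> c"
  defines "\<mu> \<equiv> \<lambda>n. measure_pmf.expectation (tri_law n (p n)) real_of_int"
    and "\<sigma>2 \<equiv> \<lambda>n. measure_pmf.variance (tri_law n (p n)) real_of_int"
  shows "\<sigma>2 \<in> \<Theta>(\<lambda>n. real n ^ 3 * p n ^ 3)
     \<and> (\<lambda>n. d_TV (tri_law n (p n)) (transl_poisson (\<mu> n) (\<sigma>2 n)))
           \<in> O(\<lambda>n. real n powr (-(1 - \<alpha>)))
     \<and> (\<lambda>n. d_loc (tri_law n (p n)) (transl_poisson (\<mu> n) (\<sigma>2 n)))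
           \<in> O(\<lambda>n. 1 / sqrt (\<sigma>2 n) * real n powr (-(1 - \<alpha>) / 2))"
proof -
  \<comment> \<open>Eventually \<open>n^\<alpha> * p < 2 * c\<close>, and
    \<open>n * p^2 = n^(1 - 2 * \<alpha>) * (n^\<alpha> * p)^2\<close>, where the first factor is at
    most 1 because \<open>\<alpha> \<ge> 1/2\<close>.\<close>
  define L where "L = (2 * c)\<^sup>2"
  define rt where "rt = (\<lambda>n. real n powr (-(1 - \<alpha>)))"
  have p0: "p \<longlonglongrightarrow> 0"
  proof -
    have "(\<lambda>n. real n powr (- \<alpha>)) \<longlonglongrightarrow> 0"
      by (rule tendsto_neg_powr) (use alpha filterlim_real_sequentially in auto)
    then have "(\<lambda>n. real n powr (- \<alpha>) * (real n powr \<alpha> * p n)) \<longlonglongrightarrow> 0 * c"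
      using lim by (rule tendsto_mult)
    moreover have "\<forall>\<^sub>F n in sequentially. real n powr (- \<alpha>) * (real n powr \<alpha> * p n) = p n"
      using eventually_gt_at_top[of 0]
      by eventually_elim (simp add: mult.assoc[symmetric] flip: powr_add)
    ultimately show ?thesis by (simp add: tendsto_cong)
  qed
  have ev_lo: "\<forall>\<^sub>F n in sequentially. c / 2 < real n powr \<alpha> * p n"
    using order_tendstoD(1)[OF lim, of "c / 2"] c_pos by simp
  have ev_hi: "\<forall>\<^sub>F n in sequentially. real n powr \<alpha> * p n < 2 * c"
    using order_tendstoD(2)[OF lim, of "2 * c"] c_pos by simp
  have ev_half: "\<forall>\<^sub>F n in sequentially. p n < 1 / 2"
    using order_tendstoD(2)[OF p0, of "1 / 2"] by simp
  have "rt \<longlonglongrightarrow> 0"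
    unfolding rt_def by (rule tendsto_neg_powr) (use alpha filterlim_real_sequentially in auto)
  then have "\<forall>\<^sub>F n in sequentially. rt n < c / 2"
    using order_tendstoD(2)[of rt 0 sequentially "c / 2"] c_pos by simp
  \<comment> \<open>Yields \<open>1 \<le> n * p\<close>, as
    \<open>n * p = n^(1 - \<alpha>) * (n^\<alpha> * p)\<close> and the last factor exceeds
    \<open>c / 2\<close>. The divergence of \<open>n^(1 - \<alpha>)\<close> rests on
    \<open>\<alpha> < 1\<close>.\<close>
  then have ev_big: "\<forall>\<^sub>F n in sequentially. 2 / c \<le> real n powr (1 - \<alpha>)"
    using eventually_gt_at_top[of 0]
  proof eventually_elim
    case (elim n)
    have "rt n = 1 / real n powr (1 - \<alpha>)" unfolding rt_def by (rule powr_minus_divide)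
    moreover have "0 < real n powr (1 - \<alpha>)" using elim by simp
    ultimately show ?case using elim(1) c_pos by (simp add: field_simps)
  qed
  have ev: "\<forall>\<^sub>F n in sequentially. tri_regime n (p n) L \<and> 1 / (real n * p n) \<le> 2 / c * rt n"
    using ev_lo ev_hi ev_half ev_big eventually_ge_at_top[of 4]
  proof eventually_elim
    case (elim n)
    have n: "0 < real n" "1 \<le> real n" using elim by auto
    have np: "real n * p n = real n powr (1 - \<alpha>) * (real n powr \<alpha> * p n)"
      using n by (simp add: mult.assoc[symmetric] flip: powr_add)
    have lo: "real n powr (1 - \<alpha>) * (c / 2) \<le> real n * p n"
      unfolding np using elim by (intro mult_left_mono) auto
    have "1 \<le> real n powr (1 - \<alpha>) * (c / 2)"
      using elim c_pos by (simp add: field_simps)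
    then have np1: "1 \<le> real n * p n" using lo by linarith
    have "real n * (p n)\<^sup>2 = real n powr (1 - 2 * \<alpha>) * (real n powr \<alpha> * p n)\<^sup>2"
    proof -
      have "real n powr (1 - 2 * \<alpha>) * (real n powr \<alpha>)\<^sup>2 = real n"
        using n by (simp add: power2_eq_square mult.assoc[symmetric] flip: powr_add)
      then show ?thesis by (simp add: power_mult_distrib mult.assoc[symmetric])
    qed
    also have "\<dots> \<le> 1 * (2 * c)\<^sup>2"
    proof (rule mult_mono)
      show "(real n powr \<alpha> * p n)\<^sup>2 \<le> (2 * c)\<^sup>2"
        using elim p_prob by (intro power_mono) auto
      show "real n powr (1 - 2 * \<alpha>) \<le> 1"
        using n alpha powr_mono[of "1 - 2 * \<alpha>" 0 "real n"] by simp
    qed auto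
    finally have np2: "real n * (p n)\<^sup>2 \<le> L" by (simp add: L_def)
    have "1 / (real n * p n) \<le> 1 / (real n powr (1 - \<alpha>) * (c / 2))"
      using n c_pos by (intro frac_le lo) auto
    also have "\<dots> = 2 / c * rt n"
      using n by (simp add: rt_def powr_minus_divide powr_diff ac_simps)
    finally show ?case
      using np1 np2 elim p_prob[of n] unfolding tri_regime_def tri_graph_def tri_regime_axioms_def by auto
  qed
  have mu: "\<mu> n = tri_graph.mean n (p n)" "\<sigma>2 n = tri_regime.variance n (p n)"
    if "tri_regime n (p n) L" for n
  proof -
    interpret tri_regime n "p n" L by (rule that)
    show "\<mu> n = tri_graph.mean n (p n)" unfolding \<mu>_def by (rule mean_tri_law)
    show "\<sigma>2 n = tri_regime.variance n (p n)" unfolding \<sigma>2_def by (rule variance_tri_law)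
  qed
  show ?thesis
  proof (intro conjI)
    show "\<sigma>2 \<in> \<Theta>(\<lambda>n. real n ^ 3 * p n ^ 3)"
    proof (rule bigthetaI)
      show "\<sigma>2 \<in> O(\<lambda>n. real n ^ 3 * p n ^ 3)"
      proof (rule bigoI)
        \<comment> \<open>Outside the locale the constant has \<open>L\<close> as its only argument,
          so it is the same for all \<open>n\<close>.\<close>
        show "\<forall>\<^sub>F n in sequentially. norm (\<sigma>2 n) \<le> tri_regime.C_var L * norm (real n ^ 3 * p n ^ 3)"
          using ev
        proof eventually_elim
          case (elim n)
          interpret tri_regime n "p n" L using elim by simp
          show ?case using mu(2)[of n] elim variance_le variance_pos scale_pos
            by (simp add: scale_def power_mult_distrib)
        qed
      qed
      show "\<sigma>2 \<in> \<Omega>(\<lambda>n. real n ^ 3 * p n ^ 3)"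
      proof (rule landau_omega.bigI)
        show "\<forall>\<^sub>F n in sequentially. norm (\<sigma>2 n) \<ge> 1 / 48 * norm (real n ^ 3 * p n ^ 3)"
          using ev
        proof eventually_elim
          case (elim n)
          interpret tri_regime n "p n" L using elim by simp
          show ?case using mu(2)[of n] elim variance_ge variance_pos scale_pos
            by (simp add: scale_def power_mult_distrib)
        qed
      qed simp
    qed
    show "(\<lambda>n. d_TV (tri_law n (p n)) (transl_poisson (\<mu> n) (\<sigma>2 n))) \<in> O(\<lambda>n. real n powr (-(1 - \<alpha>)))"
    proof (rule bigoI)
      show "\<forall>\<^sub>F n in sequentially. norm (d_TV (tri_law n (p n)) (transl_poisson (\<mu> n) (\<sigma>2 n)))
          \<le> 48 * (tri_regime.C_stein L + 2) * (2 / c) * norm (real n powr (-(1 - \<alpha>)))"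
        using ev
      proof eventually_elim
        case (elim n)
        interpret tri_regime n "p n" L using elim by simp
        have "1 / sqrt scale \<le> 1 / (real n * p n)"
          by (intro frac_le sqrt_scale_ge less_le_trans[OF zero_less_one np1]) auto
        then have "1 / sqrt scale \<le> 2 / c * rt n" using elim by linarith
        then have le: "48 * (C_stein + 2) * (1 / sqrt scale) \<le> 48 * (C_stein + 2) * (2 / c * rt n)"
          using C_stein_nonneg by (intro mult_left_mono) auto
        have "d_TV (tri_law n (p n)) (transl_poisson mean variance) \<le> 48 * (C_stein + 2) * (1 / sqrt scale)"
          using d_TV_bound by simp
        also note le
        also have "48 * (C_stein + 2) * (2 / c * rt n) = 48 * (C_stein + 2) * (2 / c) * rt n"
          by (simp only: mult.assoc)
        finally have "d_TV (tri_law n (p n)) (transl_poisson mean variance) \<le> 48 * (C_stein + 2) * (2 / c) * rt n" .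
        then show ?case using mu[of n] elim d_TV_nonneg by (simp add: rt_def)
      qed
    qed
    show "(\<lambda>n. d_loc (tri_law n (p n)) (transl_poisson (\<mu> n) (\<sigma>2 n)))
           \<in> O(\<lambda>n. 1 / sqrt (\<sigma>2 n) * real n powr (-(1 - \<alpha>) / 2))"
    proof (rule bigoI)
      show "\<forall>\<^sub>F n in sequentially. norm (d_loc (tri_law n (p n)) (transl_poisson (\<mu> n) (\<sigma>2 n)))
          \<le> tri_regime.C_loc L * sqrt (tri_regime.C_var L) * sqrt (2 / c) * norm (1 / sqrt (\<sigma>2 n) * real n powr (-(1 - \<alpha>) / 2))"
        using ev
      proof eventually_elim
        case (elim n)
        interpret tri_regime n "p n" L using elim by simp
        \<comment> \<open>One factor \<open>1 / sqrt scale\<close> becomes \<open>1 / sigma\<close>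
          through \<open>variance_le\<close>; the remaining square root supplies the power of
          \<open>n\<close>.\<close>
        have "1 / sqrt scale \<le> 1 / (real n * p n)"
          by (intro frac_le sqrt_scale_ge less_le_trans[OF zero_less_one np1]) auto
        then have "sqrt (1 / sqrt scale) \<le> sqrt (2 / c * rt n)" using elim by simp
        also have "\<dots> = sqrt (2 / c) * real n powr (-(1 - \<alpha>) / 2)"
        proof -
          have "sqrt (rt n) = real n powr (-(1 - \<alpha>) / 2)"
            unfolding rt_def by (simp add: powr_half_sqrt[symmetric] powr_powr)
          then show ?thesis by (simp only: real_sqrt_mult)
        qed
        finally have 1: "sqrt (1 / sqrt scale) \<le> sqrt (2 / c) * real n powr (-(1 - \<alpha>) / 2)" .
        have "sqrt variance \<le> sqrt C_var * sqrt scale"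
          using variance_le by (simp flip: real_sqrt_mult)
        then have 2: "1 / sqrt scale \<le> sqrt C_var * (1 / sqrt variance)"
          using scale_pos variance_pos by (simp add: field_simps)
        have le: "C_loc * (1 / sqrt scale) * sqrt (1 / sqrt scale)
           \<le> C_loc * (sqrt C_var * (1 / sqrt variance)) * (sqrt (2 / c) * real n powr (-(1 - \<alpha>) / 2))"
          using 1 2 C_loc_nonneg C_var_nonneg scale_pos variance_pos by (intro mult_mono) auto
        have "d_loc (tri_law n (p n)) (transl_poisson mean variance)
           \<le> C_loc * sqrt C_var * sqrt (2 / c) * (1 / sqrt variance * real n powr (-(1 - \<alpha>) / 2))"
          using order_trans[OF d_loc_bound le] by (simp only: ac_simps)
        then show ?case using mu[of n] elim d_loc_nonneg variance_pos by simp
      qed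
    qed
  qed
qed

end
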